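(* Let $G$ be a DAG on $\{1,\dots,K\}$ such that for every $k$ the set $\mathrm{pa}(k)$ is fully connected, and let $\mu\in\mathcal{P}_G$ satisfy, for some constant $L$, for all $2\le k\le K$ and all $x_{\mathrm{pa}(k)},\tilde x_{\mathrm{pa}(k)}\in\mathcal{X}_{\mathrm{pa}(k)}$, $$\mathcal{W}\big(\mu(dx_k\mid x_{\mathrm{pa}(k)}),\mu(dx_k\mid\tilde x_{\mathrm{pa}(k)})\big)\le L\|x_{\mathrm{pa}(k)}-\tilde x_{\mathrm{pa}(k)}\|.$$ Let $n\ge1$, $\eta=\lfloor\frac{1}{d_{\rm loc}}\log_2(n)\rfloor$, let $\mathcal{A}$ be the partition of $\mathcal{X}$ into cubes of side length $2^{-\eta}$, let $\hat\mu$ be the empirical measure of $n$ i.i.d. samples from $\mu$, and let $\hat\mu^{\mathcal{A}}=(\hat\mu)^{\mathcal{A}}$ (see context). Then $$\mathbb{E}\left[\mathcal{W}(\mu,\hat\mu^{\mathcal{A}})\right]\le C\cdot l_n\cdot n^{-1/d_{\rm loc}},$$ where $C$ is a constant depending only on $G,L,d_{\rm loc}$, and $l_n=\max\{1,\log(n)\}$ if there is a node $k$ with $d_k=2$ and $d_{\rm loc}=d_k+d_{\mathrm{pa}(k)}$, and $l_n=1$ otherwise.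
   Context: Setting: $G$ is a directed acyclic graph with nodes $\{1,\dots,K\}$, topologically sorted (every edge $i\to j$ has $i<j$); $\mathrm{pa}(k)$ is the set of parents of $k$. A set $J$ of nodes is fully connected if there is an edge $k\to\ell$ for all $k,\ell\in J$ with $k<\ell$. $\mathcal{X}=[0,1]^d=\mathcal{X}_1\times\dots\times\mathcal{X}_K$, $\mathcal{X}_k=[0,1]^{d_k}$, $\mathcal{X}_I=\prod_{i\in I}\mathcal{X}_i$. $\|\cdot\|$ is the sup-norm, $\mathcal{W}$ the first-order Wasserstein distance w.r.t. it. $\mathcal{P}_G$ is the set of Borel probability measures $\mu$ on $\mathcal{X}$ with $\mu(dx)=\prod_{k=1}^K\mu(dx_k\mid x_{\mathrm{pa}(k)})$ (regular conditional distributions; the marginal if $\mathrm{pa}(k)=\emptyset$). Lipschitz conditions on kernels mean that versions satisfying them exist; they are void if $\mathrm{pa}(k)=\emptyset$. $d_{\mathrm{pa}(k)}=\sum_{\ell\in\mathrm{pa}(k)}d_\ell$, $d_{\rm loc}=\max_k(\max\{2,d_k\}+d_{\mathrm{pa}(k)})$. Smoothing operation: for $\eta\in\mathbb{N}\cup\{0\}$, $\mathcal{A}$ is the partition of $\mathcal{X}$ into $2^{\eta d}$ (grid) cubes of side length $2^{-\eta}$, $\mathcal{A}_S$ the induced partition of $\mathcal{X}_S$, and $c_S(x_S)$ the cell of $\mathcal{A}_S$ containing $x_S$. For $\nu\in\mathcal{P}(\mathcal{X})$ and a cell $c\in\mathcal{A}_S$, $\nu_{|c}$ is the $S$-marginal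 of $\nu$ conditioned on $c$ (Dirac at the midpoint of $c$ if $c$ has mass zero). Set $\nu^{\mathcal{A}}(dx_k\mid x_{\mathrm{pa}(k)})=\int\nu(dx_k\mid\tilde x_{\mathrm{pa}(k)})\,\nu_{|c_{\mathrm{pa}(k)}(x_{\mathrm{pa}(k)})}(d\tilde x_{\mathrm{pa}(k)})$ if $\mathrm{pa}(k)\ne\emptyset$, and $\nu^{\mathcal{A}}(dx_k)=\nu(dx_k)$ (the $k$-th marginal) otherwise; then $\nu^{\mathcal{A}}(dx)=\prod_{k=1}^K\nu^{\mathcal{A}}(dx_k\mid x_{\mathrm{pa}(k)})$. *)

theory Defs
  imports "HOL-Probability.Probability"
begin

section \<open>Graphs\<close>

text \<open>A graph is an edge relation \<open>E\<close> on the nodes \<open>{1..K}\<close>; topological sorting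
  (\<open>i < j\<close> for every edge) makes it acyclic.\<close>

definition sorted_dag :: "nat \<Rightarrow> (nat \<times> nat) set \<Rightarrow> bool" where
  "sorted_dag K E \<longleftrightarrow> (\<forall>(i, j) \<in> E. 1 \<le> i \<and> i < j \<and> j \<le> K)"

definition pa :: "(nat \<times> nat) set \<Rightarrow> nat \<Rightarrow> nat set" where
  "pa E k = {i. (i, k) \<in> E}"

definition fully_connected :: "(nat \<times> nat) set \<Rightarrow> nat set \<Rightarrow> bool" where
  "fully_connected E J \<longleftrightarrow> (\<forall>k\<in>J. \<forall>l\<in>J. k < l \<longrightarrow> (k, l) \<in> E)"

definition d_pa :: "(nat \<Rightarrow> nat) \<Rightarrow> (nat \<times> nat) set \<Rightarrow> nat \<Rightarrow> nat" where
  "d_pa d E k = (\<Sum>l\<in>pa E k. d l)"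

definition d_loc :: "(nat \<Rightarrow> nat) \<Rightarrow> nat \<Rightarrow> (nat \<times> nat) set \<Rightarrow> nat" where
  "d_loc d K E = Max ((\<lambda>k. max 2 (d k) + d_pa d E k) ` {1..K})"

section \<open>The spaces\<close>

text \<open>A point of \<open>X_S\<close> is a function on the coordinate set \<open>{(k, i). k \<in> S, i < d k}\<close>
  (\<open>undefined\<close> elsewhere), so that the space of node \<open>k\<close> is \<open>X_S\<close> for \<open>S = {k}\<close>,
  projections are restrictions, and \<open>X_S\<close> for \<open>S = {}\<close> is a one-point space.\<close>

definition coords :: "(nat \<Rightarrow> nat) \<Rightarrow> nat set \<Rightarrow> (nat \<times> nat) set" where
  "coords d S = (SIGMA k:S. {..<d k})"

definition cube :: "(nat \<Rightarrow> nat) \<Rightarrow> nat set \<Rightarrow> (nat \<times> nat \<Rightarrow> real) measure" where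
  "cube d S = PiM (coords d S) (\<lambda>_. restrict_space borel {0..1})"

definition proj :: "(nat \<Rightarrow> nat) \<Rightarrow> nat set \<Rightarrow> (nat \<times> nat \<Rightarrow> real) \<Rightarrow> nat \<times> nat \<Rightarrow> real" where
  "proj d S x = restrict x (coords d S)"

text \<open>The inserted \<open>0\<close> only matters when \<open>coords d S\<close> is empty.\<close>

definition sup_dist ::
  "(nat \<Rightarrow> nat) \<Rightarrow> nat set \<Rightarrow> (nat \<times> nat \<Rightarrow> real) \<Rightarrow> (nat \<times> nat \<Rightarrow> real) \<Rightarrow> real" where
  "sup_dist d S x y = Max (insert 0 ((\<lambda>j. \<bar>x j - y j\<bar>) ` coords d S))"

section \<open>Wasserstein distance\<close>

definition couplings :: "'a measure \<Rightarrow> 'b measure \<Rightarrow> ('a \<times> 'b) measure set" where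
  "couplings M N =
     {Q. sets Q = sets (M \<Otimes>\<^sub>M N) \<and> distr Q M fst = M \<and> distr Q N snd = N}"

definition wasserstein ::
  "(nat \<Rightarrow> nat) \<Rightarrow> nat set \<Rightarrow> (nat \<times> nat \<Rightarrow> real) measure \<Rightarrow> (nat \<times> nat \<Rightarrow> real) measure \<Rightarrow> ennreal"
  where
  "wasserstein d S M N =
     (INF Q\<in>couplings M N. \<integral>\<^sup>+(x, y). ennreal (sup_dist d S x y) \<partial>Q)"

section \<open>Conditional distributions and the Markov property\<close>

definition marginal ::
  "(nat \<Rightarrow> nat) \<Rightarrow> nat set \<Rightarrow> (nat \<times> nat \<Rightarrow> real) measure \<Rightarrow> (nat \<times> nat \<Rightarrow> real) measure" where
  "marginal d S \<nu> = distr \<nu> (cube d S) (proj d S)"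

text \<open>\<open>\<kappa>\<close> is a version of the regular conditional distribution of \<open>x_k\<close> given \<open>x_S\<close>.
  For \<open>S = {}\<close> this says that \<open>\<kappa>\<close> is constantly the \<open>k\<close>-th marginal.\<close>

definition is_rcd ::
  "(nat \<Rightarrow> nat) \<Rightarrow> (nat \<times> nat \<Rightarrow> real) measure \<Rightarrow> nat set \<Rightarrow> nat
     \<Rightarrow> ((nat \<times> nat \<Rightarrow> real) \<Rightarrow> (nat \<times> nat \<Rightarrow> real) measure) \<Rightarrow> bool" where
  "is_rcd d \<nu> S k \<kappa> \<longleftrightarrow>
     \<kappa> \<in> cube d S \<rightarrow>\<^sub>M prob_algebra (cube d {k}) \<and>
     (\<forall>A\<in>sets (cube d S). \<forall>B\<in>sets (cube d {k}).
        emeasure \<nu> {x \<in> space \<nu>. proj d S x \<in> A \<and> proj d {k} x \<in> B} =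
        (\<integral>\<^sup>+x\<in>A. emeasure (\<kappa> x) B \<partial>marginal d S \<nu>))"

text \<open>\<open>kernel_prod d E \<kappa> m\<close> is the law on \<open>X_{1..m}\<close> obtained by successively drawing \<open>x_k\<close>
  from \<open>\<kappa> k x_pa(k)\<close> for \<open>k = 1, ..., m\<close>.\<close>

primrec kernel_prod ::
  "(nat \<Rightarrow> nat) \<Rightarrow> (nat \<times> nat) set
     \<Rightarrow> (nat \<Rightarrow> (nat \<times> nat \<Rightarrow> real) \<Rightarrow> (nat \<times> nat \<Rightarrow> real) measure)
     \<Rightarrow> nat \<Rightarrow> (nat \<times> nat \<Rightarrow> real) measure" where
  "kernel_prod d E \<kappa> 0 = return (cube d {1..0}) (\<lambda>_. undefined)"
| "kernel_prod d E \<kappa> (Suc m) =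
     kernel_prod d E \<kappa> m \<bind>
       (\<lambda>x. distr (\<kappa> (Suc m) (proj d (pa E (Suc m)) x)) (cube d {1..Suc m})
              (\<lambda>y. merge (coords d {1..m}) (coords d {Suc m}) (x, y)))"

definition markov_measures ::
  "(nat \<Rightarrow> nat) \<Rightarrow> nat \<Rightarrow> (nat \<times> nat) set \<Rightarrow> (nat \<times> nat \<Rightarrow> real) measure set" where
  "markov_measures d K E =
     {\<mu> \<in> space (prob_algebra (cube d {1..K})).
        \<exists>\<kappa>. (\<forall>k\<in>{1..K}. is_rcd d \<mu> (pa E k) k (\<kappa> k)) \<and> \<mu> = kernel_prod d E \<kappa> K}"

definition lipschitz_kernels ::
  "(nat \<Rightarrow> nat) \<Rightarrow> nat \<Rightarrow> (nat \<times> nat) set \<Rightarrow> real \<Rightarrow> (nat \<times> nat \<Rightarrow> real) measure \<Rightarrow> bool" where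
  "lipschitz_kernels d K E L \<mu> \<longleftrightarrow>
     (\<forall>k\<in>{2..K}. pa E k \<noteq> {} \<longrightarrow>
        (\<exists>\<kappa>. is_rcd d \<mu> (pa E k) k \<kappa> \<and>
             (\<forall>x\<in>space (cube d (pa E k)). \<forall>x'\<in>space (cube d (pa E k)).
                wasserstein d {k} (\<kappa> x) (\<kappa> x') \<le> ennreal (L * sup_dist d (pa E k) x x'))))"

section \<open>The smoothing operation\<close>

text \<open>Index of the dyadic interval of length \<open>2^-\<eta>\<close> containing \<open>t \<in> [0,1]\<close>. The intervals are
  \<open>[m 2^-\<eta>, (m+1) 2^-\<eta>)\<close>, except that the last one includes \<open>1\<close>.\<close>

definition cell_index :: "nat \<Rightarrow> real \<Rightarrow> int" where
  "cell_index \<eta> t = min \<lfloor>2 ^ \<eta> * t\<rfloor> (2 ^ \<eta> - 1)"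

definition cell ::
  "(nat \<Rightarrow> nat) \<Rightarrow> nat \<Rightarrow> nat set \<Rightarrow> (nat \<times> nat \<Rightarrow> real) \<Rightarrow> (nat \<times> nat \<Rightarrow> real) set" where
  "cell d \<eta> S x =
     {y \<in> space (cube d S). \<forall>j\<in>coords d S. cell_index \<eta> (y j) = cell_index \<eta> (x j)}"

text \<open>The midpoint of \<open>cell d \<eta> S x\<close>.\<close>

definition cell_midpoint ::
  "(nat \<Rightarrow> nat) \<Rightarrow> nat \<Rightarrow> nat set \<Rightarrow> (nat \<times> nat \<Rightarrow> real) \<Rightarrow> nat \<times> nat \<Rightarrow> real" where
  "cell_midpoint d \<eta> S x =
     (\<lambda>j\<in>coords d S. (of_int (cell_index \<eta> (x j)) + 1 / 2) / 2 ^ \<eta>)"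

text \<open>\<open>\<nu>\<close> conditioned on the cell containing \<open>x \<in> X_S\<close>.\<close>

definition cell_cond ::
  "(nat \<Rightarrow> nat) \<Rightarrow> nat \<Rightarrow> (nat \<times> nat \<Rightarrow> real) measure \<Rightarrow> nat set
     \<Rightarrow> (nat \<times> nat \<Rightarrow> real) \<Rightarrow> (nat \<times> nat \<Rightarrow> real) measure" where
  "cell_cond d \<eta> \<nu> S x =
     (if emeasure (marginal d S \<nu>) (cell d \<eta> S x) = 0
      then return (cube d S) (cell_midpoint d \<eta> S x)
      else uniform_measure (marginal d S \<nu>) (cell d \<eta> S x))"

text \<open>A fixed version of the regular conditional distribution. In the smoothing below the choice
  influences only the kernel on cells without mass: on a cell \<open>c\<close> with mass, the averaged kernel
  at \<open>B\<close> is \<open>\<nu>(x_pa(k) \<in> c, x_k \<in> B) / \<nu>(x_pa(k) \<in> c)\<close> for every version.\<close>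

definition rcd ::
  "(nat \<Rightarrow> nat) \<Rightarrow> (nat \<times> nat \<Rightarrow> real) measure \<Rightarrow> nat set \<Rightarrow> nat
     \<Rightarrow> (nat \<times> nat \<Rightarrow> real) \<Rightarrow> (nat \<times> nat \<Rightarrow> real) measure" where
  "rcd d \<nu> S k = (SOME \<kappa>. is_rcd d \<nu> S k \<kappa>)"

definition smoothed_kernel ::
  "(nat \<Rightarrow> nat) \<Rightarrow> (nat \<times> nat) set \<Rightarrow> nat \<Rightarrow> (nat \<times> nat \<Rightarrow> real) measure \<Rightarrow> nat
     \<Rightarrow> (nat \<times> nat \<Rightarrow> real) \<Rightarrow> (nat \<times> nat \<Rightarrow> real) measure" where
  "smoothed_kernel d E \<eta> \<nu> k x =
     (if pa E k = {} then marginal d {k} \<nu>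
      else cell_cond d \<eta> \<nu> (pa E k) x \<bind> rcd d \<nu> (pa E k) k)"

definition smoothing ::
  "(nat \<Rightarrow> nat) \<Rightarrow> nat \<Rightarrow> (nat \<times> nat) set \<Rightarrow> nat
     \<Rightarrow> (nat \<times> nat \<Rightarrow> real) measure \<Rightarrow> (nat \<times> nat \<Rightarrow> real) measure" where
  "smoothing d K E \<eta> \<nu> = kernel_prod d E (smoothed_kernel d E \<eta> \<nu>) K"

section \<open>Empirical measure and the logarithmic factor\<close>

definition empirical ::
  "(nat \<Rightarrow> nat) \<Rightarrow> nat \<Rightarrow> nat \<Rightarrow> (nat \<Rightarrow> nat \<times> nat \<Rightarrow> real) \<Rightarrow> (nat \<times> nat \<Rightarrow> real) measure" where
  "empirical d K n \<omega> = distr (uniform_count_measure {..<n}) (cube d {1..K}) \<omega>"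

definition log_factor :: "(nat \<Rightarrow> nat) \<Rightarrow> nat \<Rightarrow> (nat \<times> nat) set \<Rightarrow> nat \<Rightarrow> real" where
  "log_factor d K E n =
     (if \<exists>k\<in>{1..K}. d k = 2 \<and> d_loc d K E = d k + d_pa d E k then max 1 (ln (real n)) else 1)"

end

theory Submission
  imports Defs
begin

text \<open>
  Couplings enter only through a duality argument on dyadic grids: the Wasserstein distance of two laws
  on a cube is at most the largest difference of the integrals of a 1-Lipschitz function.
  For such a function \<open>\<mu>\<close> and the smoothed empirical measure are compared by replacing one kernel
  after another. Each step multiplies the Lipschitz constant by at most \<open>1 + L\<close>, so that it remains to compare, on every cell
  \<open>c\<close> of the parents of \<open>k\<close>, the smoothed kernel of the empirical measure with that of \<open>\<mu>\<close>
  (the smoothing of \<open>\<mu>\<close> itself costs \<open>L 2\<^sup>-\<^sup>\<eta>\<close>). Since the parent sets are fully connected,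
  the smoothed empirical measure gives these cells their empirical frequencies; with these weights,
  chaining over dyadic scales \<open>j \<le> \<eta>\<close> bounds the comparison by \<open>2\<^sup>-\<^sup>\<eta>\<close> plus the sum over \<open>j\<close>
  of \<open>2\<^sup>-\<^sup>j\<close> times the total fluctuation of centred cell frequencies, which has expectation at most
  \<open>sqrt (2 ^ (\<eta> d_pa + j d_k) / n)\<close> by Cauchy--Schwarz.
\<close>

section \<open>Duality on finite sets\<close>

text \<open>A conditional cell frequency of the sample is a ratio, and an undefined one on empty
  cells. It only enters integrated against the empirical law of the parent cells: multiplied by the
  frequency of its cell it is a joint frequency, so the error becomes a sample mean of bounded
  centred variables, and empty cells get weight zero. Smoothed kernels jump between cells and
  destroy Lipschitz test functions. Nodes are therefore integrated out from the last one downwards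
  through Lipschitz kernels of \<mu>, while the error at a node is evaluated under the smoothed law
  of the preceding nodes; it depends on the parent cell alone, so only the cell law of the parents
  matters there. The kernels in the product formula for \<mu> and the Lipschitz ones may be
  different versions; they are exchanged off a null set common to all test functions. The rate rests
  on 2^(\<eta> d_loc) \<le> n: the contribution 2^-j sqrt(2^(\<eta> d_pa + j d_k) / n) of scale j
  decays in j for d_k = 1, is constant for d_k = 2 and grows for d_k \<ge> 3. Only the constant case
  can produce a factor \<eta>, that is, a logarithm.\<close>

lemma compact_box_fun:
  fixes u :: "'z \<Rightarrow> real"
  shows "compact {f :: 'z \<Rightarrow> real. \<forall>z. f z \<in> {0..u z}}"
proof -
  \<comment> \<open>Tychonoff on the whole function type: the index type may be infinite, and
    irrelevant coordinates can be pinned by \<open>u z = 0\<close>.\<close>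
  have "compactin (product_topology (\<lambda>_. euclidean) UNIV) (PiE UNIV (\<lambda>z. {0..u z}))"
    by (simp add: compactin_PiE)
  moreover have "PiE UNIV (\<lambda>z. {0..u z}) = {f :: 'z \<Rightarrow> real. \<forall>z. f z \<in> {0..u z}}"
    by (auto simp: PiE_def Pi_def)
  ultimately show ?thesis
    by (simp add: euclidean_product_topology)
qed

text \<open>Divide by \<open>s\<close> and let it decrease to 0. This is the first-order condition
  at a minimiser along a segment, for an objective that is linear plus quadratic; only
  \<open>s \<le> 1\<close> stays within the segment.\<close>

lemma linear_coeff_nonneg:
  fixes a q :: real
  assumes "\<And>s. 0 < s \<Longrightarrow> s \<le> 1 \<Longrightarrow> 0 \<le> s * a + s\<^sup>2 * q"
  shows "0 \<le> a"
proof (rule tendsto_lowerbound)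
  show "((\<lambda>s. a + s * q) \<longlongrightarrow> a) (at_right 0)"
    by (auto intro!: tendsto_eq_intros)
  show "\<forall>\<^sub>F s in at_right 0. 0 \<le> a + s * q"
  proof (rule eventually_at_rightI[of 0 1])
    fix s :: real assume s: "s \<in> {0<..<1}"
    then have "0 \<le> s * (a + s * q)"
      using assms[of s] by (simp add: power2_eq_square algebra_simps)
    then show "0 \<le> a + s * q" using s by (simp add: zero_le_mult_iff)
  qed simp
qed simp

text \<open>Minimise \<open>cost \<pi> + t h \<pi>\<close> over all probability matrices, where \<open>h\<close> is the squared error of the
  marginals: the first-order condition at the minimiser \<open>\<pi>\<close> says that the gradient of the penalty is a dual
  potential, whence \<open>cost \<pi> + 2 t h \<pi> \<le> R\<close>. Let \<open>t\<close> tend to infinity.\<close>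

lemma finite_kantorovich:
  fixes A :: "'a set" and B :: "'b set" and c :: "'a \<Rightarrow> 'b \<Rightarrow> real"
  assumes fin: "finite A" "finite B"
    and c0: "\<And>a b. a \<in> A \<Longrightarrow> b \<in> B \<Longrightarrow> 0 \<le> c a b"
    and p1: "(\<Sum>a\<in>A. p a) = 1" and r1: "(\<Sum>b\<in>B. r b) = 1"
    and dual: "\<And>\<phi> \<psi>. (\<And>a b. a \<in> A \<Longrightarrow> b \<in> B \<Longrightarrow> \<phi> a + \<psi> b \<le> c a b) \<Longrightarrow>
      (\<Sum>a\<in>A. p a * \<phi> a) + (\<Sum>b\<in>B. r b * \<psi> b) \<le> R"
  obtains \<pi> where "\<And>a b. a \<in> A \<Longrightarrow> b \<in> B \<Longrightarrow> 0 \<le> \<pi> (a, b)"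
    and "\<And>a. a \<in> A \<Longrightarrow> (\<Sum>b\<in>B. \<pi> (a, b)) = p a"
    and "\<And>b. b \<in> B \<Longrightarrow> (\<Sum>a\<in>A. \<pi> (a, b)) = r b"
    and "(\<Sum>a\<in>A. \<Sum>b\<in>B. \<pi> (a, b) * c a b) \<le> R"
proof -
  define m1 where "m1 = (\<lambda>(\<pi> :: 'a \<times> 'b \<Rightarrow> real) a. \<Sum>b\<in>B. \<pi> (a, b))"
  define m2 where "m2 = (\<lambda>(\<pi> :: 'a \<times> 'b \<Rightarrow> real) b. \<Sum>a\<in>A. \<pi> (a, b))"
  define cost where "cost = (\<lambda>(\<pi> :: 'a \<times> 'b \<Rightarrow> real). \<Sum>a\<in>A. \<Sum>b\<in>B. \<pi> (a, b) * c a b)"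
  define h where "h = (\<lambda>\<pi>. (\<Sum>a\<in>A. (m1 \<pi> a - p a)\<^sup>2) + (\<Sum>b\<in>B. (m2 \<pi> b - r b)\<^sup>2))"
  \<comment> \<open>Probability matrices on \<open>A \<times> B\<close>, written as functions on all
    pairs: the upper bound 0 outside \<open>A \<times> B\<close> makes the set compact in the
    product topology.\<close>
  define K where "K = {f :: 'a \<times> 'b \<Rightarrow> real. \<forall>z. f z \<in> {0..(if z \<in> A \<times> B then 1 else 0)}}
      \<inter> {f. (\<Sum>a\<in>A. \<Sum>b\<in>B. f (a, b)) = 1}"
  have cont [continuous_intros]: "continuous_on S (\<lambda>f :: 'a \<times> 'b \<Rightarrow> real. f z)" for S z
    by (rule continuous_on_product_coordinates[THEN continuous_on_subset]) simp
  have contm: "continuous_on S cost" "continuous_on S h" for S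
    unfolding cost_def h_def m1_def m2_def by (intro continuous_intros)+
  have "compact K"
    unfolding K_def
    by (intro compact_Int_closed compact_box_fun closed_Collect_eq continuous_intros)
  obtain a0 b0 where ab0: "a0 \<in> A" "b0 \<in> B"
    using p1 r1 by (metis sum.empty zero_neq_one ex_in_conv)
  \<comment> \<open>Point masses serve as competitors: moving \<pi> towards the one at
    \<open>(x, y)\<close> stays in \<open>K\<close> and tests the dual inequality at exactly this
    pair.\<close>
  define \<delta> where "\<delta> = (\<lambda>(x::'a) (y::'b) z. if z = (x, y) then 1 else 0 :: real)"
  have \<delta>sum: "(\<Sum>a\<in>A. \<Sum>b\<in>B. \<delta> x y (a, b)) = 1" if "x \<in> A" "y \<in> B" for x y
    unfolding \<delta>_def prod.inject using that fin
    by (subst sum.swap) (simp add: if_conn cong: if_cong)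
  have m1\<delta>: "m1 (\<delta> x y) a = (if a = x then 1 else 0)" if "y \<in> B" for x y a
    unfolding m1_def \<delta>_def using that fin by (simp add: sum.delta)
  have m2\<delta>: "m2 (\<delta> x y) b = (if b = y then 1 else 0)" if "x \<in> A" for x y b
    unfolding m2_def \<delta>_def using that fin by (simp add: sum.delta)
  have cost\<delta>: "cost (\<delta> x y) = c x y" if "x \<in> A" "y \<in> B" for x y
    unfolding cost_def \<delta>_def prod.inject
    using that fin by (subst sum.swap) (simp add: if_conn if_distrib[of "\<lambda>u. u * _"] cong: if_cong)
  have \<delta>K: "\<delta> x y \<in> K" if "x \<in> A" "y \<in> B" for x y
    using that \<delta>sum[OF that] by (auto simp: K_def \<delta>_def)
  have approx: "\<exists>\<pi>\<in>K. cost \<pi> + 2 * t * h \<pi> \<le> R" if "t > 0" for t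
  proof -
    obtain \<pi> where \<pi>: "\<pi> \<in> K" and min: "\<And>\<pi>'. \<pi>' \<in> K \<Longrightarrow> cost \<pi> + t * h \<pi> \<le> cost \<pi>' + t * h \<pi>'"
    proof -
      have "continuous_on K (\<lambda>\<pi>. cost \<pi> + t * h \<pi>)"
        by (intro continuous_intros contm)
      moreover have "K \<noteq> {}" using \<delta>K[OF ab0] by blast
      ultimately show thesis
        using continuous_attains_inf[of K "\<lambda>\<pi>. cost \<pi> + t * h \<pi>"] \<open>compact K\<close> that by blast
    qed
    define \<phi> where "\<phi> = (\<lambda>a. 2 * t * (m1 \<pi> a - p a))"
    define \<psi> where "\<psi> = (\<lambda>b. 2 * t * (m2 \<pi> b - r b))"
    \<comment> \<open>The mean of \<open>c + \<phi> + \<psi>\<close> under \<pi>. It is the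
      multiplier of the constraint that the total mass is 1, and is absorbed into the first
      potential.\<close>
    define l where "l = cost \<pi> + (\<Sum>a\<in>A. \<phi> a * m1 \<pi> a) + (\<Sum>b\<in>B. \<psi> b * m2 \<pi> b)"
    let ?d1 = "\<lambda>x y a. m1 (\<delta> x y) a - m1 \<pi> a" and ?d2 = "\<lambda>x y b. m2 (\<delta> x y) b - m2 \<pi> b"
    have feas: "(l - \<phi> x) + (- \<psi> y) \<le> c x y" if xy: "x \<in> A" "y \<in> B" for x y
    proof -
      define q where "q = t * ((\<Sum>a\<in>A. (?d1 x y a)\<^sup>2) + (\<Sum>b\<in>B. (?d2 x y b)\<^sup>2))"
      have "0 \<le> c x y + \<phi> x + \<psi> y - l"
      proof (rule linear_coeff_nonneg)
        fix s :: real assume s: "0 < s" "s \<le> 1"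
        define \<sigma> where "\<sigma> = (\<lambda>z. \<pi> z + s * (\<delta> x y z - \<pi> z))"
        have m1\<sigma>: "m1 \<sigma> a = m1 \<pi> a + s * ?d1 x y a" for a
          unfolding m1_def \<sigma>_def by (simp add: sum.distrib sum_subtractf sum_distrib_left right_diff_distrib)
        have m2\<sigma>: "m2 \<sigma> b = m2 \<pi> b + s * ?d2 x y b" for b
          unfolding m2_def \<sigma>_def by (simp add: sum.distrib sum_subtractf sum_distrib_left right_diff_distrib)
        have cost\<sigma>: "cost \<sigma> = cost \<pi> + s * (c x y - cost \<pi>)"
          unfolding cost\<delta>[OF xy, symmetric] unfolding cost_def \<sigma>_def
          by (simp add: sum.distrib sum_subtractf sum_distrib_left algebra_simps)
        have "\<sigma> z \<in> {0..(if z \<in> A \<times> B then 1 else 0)}" for z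
        proof -
          have "\<pi> z \<in> {0..(if z \<in> A \<times> B then 1 else 0)}" "\<delta> x y z \<in> {0..(if z \<in> A \<times> B then 1 else 0)}"
            using \<pi> \<delta>K[OF xy] unfolding K_def by blast+
          moreover have "\<sigma> z = (1 - s) * \<pi> z + s * \<delta> x y z"
            unfolding \<sigma>_def by (simp add: algebra_simps)
          ultimately show ?thesis
            using s convex_bound_le[of "\<pi> z" 1 "\<delta> x y z" "1 - s" s] by (auto split: if_splits)
        qed
        moreover have "(\<Sum>a\<in>A. \<Sum>b\<in>B. \<sigma> (a, b)) = 1"
          using \<pi> \<delta>sum[OF xy] unfolding K_def \<sigma>_def
          by (simp add: sum.distrib sum_subtractf flip: sum_distrib_left)
        ultimately have "\<sigma> \<in> K" unfolding K_def by blast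
        from min[OF this] have "0 \<le> s * (c x y - cost \<pi>) + t * (h \<sigma> - h \<pi>)"
          unfolding cost\<sigma> by (simp add: algebra_simps)
        also have "h \<sigma> - h \<pi> =
            (\<Sum>a\<in>A. 2 * s * (m1 \<pi> a - p a) * ?d1 x y a + s\<^sup>2 * (?d1 x y a)\<^sup>2)
          + (\<Sum>b\<in>B. 2 * s * (m2 \<pi> b - r b) * ?d2 x y b + s\<^sup>2 * (?d2 x y b)\<^sup>2)"
          unfolding h_def m1\<sigma> m2\<sigma>
          by (simp add: algebra_simps power2_eq_square sum.distrib sum_subtractf)
        also have "t * \<dots> = s * ((\<Sum>a\<in>A. \<phi> a * ?d1 x y a)
            + (\<Sum>b\<in>B. \<psi> b * ?d2 x y b)) + s\<^sup>2 * q"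
          unfolding \<phi>_def \<psi>_def q_def by (simp add: sum.distrib sum_distrib_left distrib_left mult_ac)
        also have "(\<Sum>a\<in>A. \<phi> a * ?d1 x y a) = \<phi> x - (\<Sum>a\<in>A. \<phi> a * m1 \<pi> a)"
          using xy fin by (simp add: right_diff_distrib sum_subtractf m1\<delta> if_distrib[of "\<lambda>u. _ * u"] cong: if_cong)
        also have "(\<Sum>b\<in>B. \<psi> b * ?d2 x y b) = \<psi> y - (\<Sum>b\<in>B. \<psi> b * m2 \<pi> b)"
          using xy fin by (simp add: right_diff_distrib sum_subtractf m2\<delta> if_distrib[of "\<lambda>u. _ * u"] cong: if_cong)
        finally show "0 \<le> s * (c x y + \<phi> x + \<psi> y - l) + s\<^sup>2 * q"
          unfolding l_def by (simp add: algebra_simps)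
      qed
      then show ?thesis by simp
    qed
    \<comment> \<open>The potentials are paired with the prescribed marginals instead of those of
      \<pi>. The difference is the gradient of the penalty times the marginal error, which is
      \<open>2 * t * h \<pi>\<close>.\<close>
    have "(\<Sum>a\<in>A. p a * (l - \<phi> a)) + (\<Sum>b\<in>B. r b * (- \<psi> b)) \<le> R"
      using dual[of "\<lambda>a. l - \<phi> a" "\<lambda>b. - \<psi> b"] feas by blast
    also have "(\<Sum>a\<in>A. p a * (l - \<phi> a)) = l - (\<Sum>a\<in>A. p a * \<phi> a)"
      using p1 by (simp add: right_diff_distrib sum_subtractf flip: sum_distrib_right)
    also have "l - (\<Sum>a\<in>A. p a * \<phi> a) + (\<Sum>b\<in>B. r b * (- \<psi> b)) =
        cost \<pi> + (\<Sum>a\<in>A. \<phi> a * (m1 \<pi> a - p a)) + (\<Sum>b\<in>B. \<psi> b * (m2 \<pi> b - r b))"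
      unfolding l_def by (simp add: algebra_simps sum_subtractf sum_negf)
    also have "\<dots> = cost \<pi> + 2 * t * h \<pi>"
      unfolding \<phi>_def \<psi>_def h_def by (simp add: algebra_simps sum_distrib_left power2_eq_square)
    finally show ?thesis using \<pi> by blast
  qed
  have cost0: "0 \<le> cost \<pi>" if "\<pi> \<in> K" for \<pi>
  proof -
    have "0 \<le> \<pi> z" for z
    proof -
      have "\<pi> z \<in> {0..(if z \<in> A \<times> B then 1 else 0)}" using that unfolding K_def by blast
      then show ?thesis by simp
    qed
    then show ?thesis unfolding cost_def by (intro sum_nonneg mult_nonneg_nonneg c0) auto
  qed
  have h0: "0 \<le> h \<pi>" for \<pi>
    unfolding h_def by (intro add_nonneg_nonneg sum_nonneg) auto
  \<comment> \<open>The penalised minimisers have cost at most \<open>R\<close> and error at most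
    \<open>R / (2 * t)\<close>. On this compact set the error attains its minimum, which must then
    be 0.\<close>
  define T where "T = K \<inter> {\<pi>. cost \<pi> \<le> R}"
  have "compact T"
    unfolding T_def by (intro compact_Int_closed \<open>compact K\<close> closed_Collect_le contm continuous_intros)
  moreover have ex: "\<exists>\<pi>\<in>T. h \<pi> \<le> R / (2 * t)" if t: "t > 0" for t
  proof -
    obtain \<pi> where \<pi>: "\<pi> \<in> K" "cost \<pi> + 2 * t * h \<pi> \<le> R" using approx[OF t] by blast
    moreover have "0 \<le> 2 * t * h \<pi>" using h0[of \<pi>] t by simp
    ultimately show ?thesis
      using t cost0[OF \<pi>(1)] by (intro bexI[of _ \<pi>]) (auto simp: T_def field_simps)
  qed
  obtain \<pi> where \<pi>: "\<pi> \<in> T" and min: "\<And>\<pi>'. \<pi>' \<in> T \<Longrightarrow> h \<pi> \<le> h \<pi>'"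
  proof -
    have "T \<noteq> {}" using ex[of 1] by auto
    then show thesis
      using continuous_attains_inf[of T h] contm(2) \<open>compact T\<close> that by blast
  qed
  have "h \<pi> \<le> 0"
  proof (rule field_le_epsilon)
    fix e :: real assume "e > 0"
    have "R \<ge> 0" using \<pi> cost0 unfolding T_def by fastforce
    \<comment> \<open>\<open>R + 1\<close> instead of \<open>R\<close> keeps \<open>t\<close>
      positive if \<open>R = 0\<close>.\<close>
    define t where "t = (R + 1) / e"
    have "t > 0" using \<open>e > 0\<close> \<open>R \<ge> 0\<close> by (simp add: t_def)
    obtain \<pi>' where "\<pi>' \<in> T" "h \<pi>' \<le> R / (2 * t)" using ex[OF \<open>t > 0\<close>] by blast
    moreover have "R / (2 * t) \<le> e"
      using \<open>e > 0\<close> \<open>R \<ge> 0\<close> by (simp add: t_def field_simps)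
    ultimately show "h \<pi> \<le> 0 + e" using min by fastforce
  qed
  moreover have "0 \<le> (\<Sum>a\<in>A. (m1 \<pi> a - p a)\<^sup>2)" "0 \<le> (\<Sum>b\<in>B. (m2 \<pi> b - r b)\<^sup>2)"
    by (auto intro: sum_nonneg)
  ultimately have "(\<Sum>a\<in>A. (m1 \<pi> a - p a)\<^sup>2) = 0" "(\<Sum>b\<in>B. (m2 \<pi> b - r b)\<^sup>2) = 0"
    unfolding h_def by linarith+
  then have "\<And>a. a \<in> A \<Longrightarrow> m1 \<pi> a = p a" "\<And>b. b \<in> B \<Longrightarrow> m2 \<pi> b = r b"
    using fin by (simp_all add: sum_nonneg_eq_0_iff)
  moreover have "0 \<le> \<pi> z" for z
  proof -
    have "\<pi> z \<in> {0..(if z \<in> A \<times> B then 1 else 0)}" using \<pi> unfolding T_def K_def by blast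
    then show ?thesis by simp
  qed
  moreover have "cost \<pi> \<le> R" using \<pi> unfolding T_def by blast
  ultimately show thesis
    using that[of \<pi>] unfolding m1_def m2_def cost_def by blast
qed

section \<open>Coordinates, projections and the sup-distance on cubes\<close>

lemma space_cube: "space (cube d S) = PiE (coords d S) (\<lambda>_. {0..1})"
  by (simp add: cube_def space_PiM space_restrict_space)

lemma space_cubeD: "x \<in> space (cube d S) \<Longrightarrow> j \<in> coords d S \<Longrightarrow> x j \<in> {0..1}"
  unfolding space_cube by (rule PiE_mem)

lemma finite_coords [simp]: "finite S \<Longrightarrow> finite (coords d S)"
  by (simp add: coords_def)

lemma card_coords: "finite S \<Longrightarrow> card (coords d S) = (\<Sum>k\<in>S. d k)"
  by (simp add: coords_def)

lemma coords_mono: "S \<subseteq> T \<Longrightarrow> coords d S \<subseteq> coords d T"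
  by (auto simp: coords_def)

lemma measurable_coord:
  assumes "j \<in> coords d S"
  shows "(\<lambda>x. x j) \<in> borel_measurable (cube d S)"
proof -
  have "(\<lambda>x. x j) \<in> cube d S \<rightarrow>\<^sub>M restrict_space borel {0..1::real}"
    unfolding cube_def by (rule measurable_component_singleton[OF assms])
  then show ?thesis
    by (simp add: measurable_restrict_space2_iff)
qed

lemma proj_measurable: "S \<subseteq> T \<Longrightarrow> proj d S \<in> cube d T \<rightarrow>\<^sub>M cube d S"
  unfolding cube_def proj_def by (rule measurable_restrict_subset) (rule coords_mono)

lemma proj_space: "S \<subseteq> T \<Longrightarrow> x \<in> space (cube d T) \<Longrightarrow> proj d S x \<in> space (cube d S)"
  by (rule measurable_space[OF proj_measurable])

lemma proj_proj: "S \<subseteq> T \<Longrightarrow> proj d S (proj d T x) = proj d S x"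
  using coords_mono[of S T d] by (auto simp: proj_def fun_eq_iff)

lemma proj_ident: "x \<in> space (cube d S) \<Longrightarrow> proj d S x = x"
  by (simp add: proj_def space_cube PiE_restrict)

lemma sup_dist_nonneg: "finite S \<Longrightarrow> 0 \<le> sup_dist d S x y"
  unfolding sup_dist_def by (rule Max_ge) simp_all

lemma sup_dist_le_iff:
  assumes "finite S"
  shows "sup_dist d S x y \<le> r \<longleftrightarrow> 0 \<le> r \<and> (\<forall>j\<in>coords d S. \<bar>x j - y j\<bar> \<le> r)"
  unfolding sup_dist_def using assms by (subst Max_le_iff) auto

lemma abs_le_sup_dist: "finite S \<Longrightarrow> j \<in> coords d S \<Longrightarrow> \<bar>x j - y j\<bar> \<le> sup_dist d S x y"
  using sup_dist_le_iff[of S d x y "sup_dist d S x y"] by blast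

lemma sup_dist_refl [simp]: "finite S \<Longrightarrow> sup_dist d S x x = 0"
  by (rule antisym) (simp_all add: sup_dist_le_iff sup_dist_nonneg)

lemma sup_dist_commute: "sup_dist d S x y = sup_dist d S y x"
  by (simp add: sup_dist_def abs_minus_commute)

lemma sup_dist_triangle:
  assumes "finite S"
  shows "sup_dist d S x z \<le> sup_dist d S x y + sup_dist d S y z"
  unfolding sup_dist_le_iff[OF assms, of d x z]
proof (intro conjI ballI)
  fix j assume "j \<in> coords d S"
  then show "\<bar>x j - z j\<bar> \<le> sup_dist d S x y + sup_dist d S y z"
    using abs_le_sup_dist[OF assms, of j d x y] abs_le_sup_dist[OF assms, of j d y z] by linarith
qed (simp add: assms sup_dist_nonneg)

lemma sup_dist_mono:
  assumes "finite T" "S \<subseteq> T"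
  shows "sup_dist d S x y \<le> sup_dist d T x y"
  using assms coords_mono[OF assms(2), of d] finite_subset[OF assms(2,1)]
  by (subst sup_dist_le_iff) (auto simp: sup_dist_nonneg abs_le_sup_dist)

lemma sup_dist_cong:
  assumes "\<And>j. j \<in> coords d S \<Longrightarrow> x j = x' j" "\<And>j. j \<in> coords d S \<Longrightarrow> y j = y' j"
  shows "sup_dist d S x y = sup_dist d S x' y'"
  unfolding sup_dist_def using assms by (simp cong: image_cong)

lemma sup_dist_proj: "S \<subseteq> T \<Longrightarrow> sup_dist d S (proj d T x) (proj d T y) = sup_dist d S x y"
  using coords_mono[of S T d] by (intro sup_dist_cong) (auto simp: proj_def)

lemma sup_dist_le_1:
  assumes "finite S" "x \<in> space (cube d S)" "y \<in> space (cube d S)"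
  shows "sup_dist d S x y \<le> 1"
  unfolding sup_dist_le_iff[OF assms(1)]
proof (intro conjI ballI)
  fix j assume "j \<in> coords d S"
  then have "x j \<in> {0..1}" "y j \<in> {0..1}"
    using assms by (auto simp: space_cube)
  then show "\<bar>x j - y j\<bar> \<le> 1" by auto
qed simp

lemma sup_dist_measurable:
  assumes "finite S"
  shows "(\<lambda>x. sup_dist d S x y) \<in> borel_measurable (cube d S)"
proof (rule borel_measurableI_le)
  fix a
  have [measurable]: "j \<in> coords d S \<Longrightarrow> (\<lambda>x. x j) \<in> borel_measurable (cube d S)" for j
    by (rule measurable_coord)
  have "{x \<in> space (cube d S). 0 \<le> a \<and> (\<forall>j\<in>coords d S. \<bar>x j - y j\<bar> \<le> a)} \<in> sets (cube d S)"
    using assms by (intro sets.sets_Collect sets.sets_Collect_finite_All) measurable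
  then show "{x \<in> space (cube d S). sup_dist d S x y \<le> a} \<in> sets (cube d S)"
    by (simp add: sup_dist_le_iff[OF assms])
qed

section \<open>Dyadic quantization\<close>

text \<open>The last inequality cannot be strict: the last dyadic interval is closed at 1.\<close>

lemma cell_index_bounds:
  assumes "t \<in> {0..1}"
  shows "0 \<le> cell_index \<eta> t" "cell_index \<eta> t < 2 ^ \<eta>"
    and "of_int (cell_index \<eta> t) \<le> 2 ^ \<eta> * t" "2 ^ \<eta> * t \<le> of_int (cell_index \<eta> t) + 1"
proof -
  have t: "0 \<le> 2 ^ \<eta> * t" "2 ^ \<eta> * t \<le> 2 ^ \<eta>"
    using assms by (auto simp: mult_le_cancel_left1)
  show "0 \<le> cell_index \<eta> t" "cell_index \<eta> t < 2 ^ \<eta>"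
    unfolding cell_index_def using t by (auto simp: le_floor_iff)
  show "of_int (cell_index \<eta> t) \<le> 2 ^ \<eta> * t"
    unfolding cell_index_def
    by (rule order_trans[OF _ of_int_floor_le]) simp
  show "2 ^ \<eta> * t \<le> of_int (cell_index \<eta> t) + 1"
    unfolding cell_index_def min_def using t by (auto; linarith)
qed

definition dyadic_mid :: "nat \<Rightarrow> int \<Rightarrow> real" where
  "dyadic_mid \<eta> i = (of_int i + 1 / 2) / 2 ^ \<eta>"

lemma dyadic_mid_mem:
  assumes "0 \<le> i" "i < 2 ^ \<eta>"
  shows "dyadic_mid \<eta> i \<in> {0..1}"
proof -
  have "real_of_int (i + 1) \<le> real_of_int (2 ^ \<eta>)"
    unfolding of_int_le_iff using assms(2) by simp
  then have "real_of_int i + 1 / 2 \<le> 2 ^ \<eta>" "0 \<le> real_of_int i + 1 / 2"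
    using assms(1) by simp_all
  then show ?thesis by (simp add: dyadic_mid_def divide_le_eq_1)
qed

lemma cell_index_dyadic_mid:
  assumes "i < 2 ^ \<eta>"
  shows "cell_index \<eta> (dyadic_mid \<eta> i) = i"
proof -
  have "2 ^ \<eta> * dyadic_mid \<eta> i = of_int i + 1 / 2" by (simp add: dyadic_mid_def)
  then have "\<lfloor>2 ^ \<eta> * dyadic_mid \<eta> i\<rfloor> = i" by (simp add: floor_eq_iff)
  then show ?thesis using assms by (simp add: cell_index_def)
qed

lemma dist_dyadic_mid:
  assumes "t \<in> {0..1}"
  shows "\<bar>t - dyadic_mid \<eta> (cell_index \<eta> t)\<bar> \<le> (1 / 2) ^ \<eta> / 2"
proof -
  have "\<bar>2 ^ \<eta> * t - (of_int (cell_index \<eta> t) + 1 / 2)\<bar> \<le> 1 / 2"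
    using cell_index_bounds(3,4)[OF assms, of \<eta>] by linarith
  also have "2 ^ \<eta> * t - (of_int (cell_index \<eta> t) + 1 / 2) = 2 ^ \<eta> * (t - dyadic_mid \<eta> (cell_index \<eta> t))"
    by (simp add: dyadic_mid_def right_diff_distrib)
  finally show ?thesis
    by (simp only: abs_mult) (simp add: field_simps power_divide)
qed

text \<open>Nestedness of the dyadic partitions: if \<open>i\<close> is the index at the finer
  level, then the finer midpoint and \<open>t\<close> both have index \<open>i div 2\<close> at the
  coarser level.\<close>

lemma cell_index_dyadic_mid_Suc:
  assumes "t \<in> {0..1}"
  shows "cell_index \<eta> (dyadic_mid (Suc \<eta>) (cell_index (Suc \<eta>) t)) = cell_index \<eta> t"
proof -
  define i where "i = cell_index (Suc \<eta>) t"
  have i: "0 \<le> i" "i < 2 * 2 ^ \<eta>" "of_int i \<le> 2 * (2 ^ \<eta> * t)" "2 * (2 ^ \<eta> * t) \<le> of_int i + 1"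
    using cell_index_bounds[OF assms, of "Suc \<eta>"] by (simp_all add: i_def mult.assoc)
  \<comment> \<open>Only the closed last interval allows equality on the right, and there the index
    is known.\<close>
  have strict: "2 * (2 ^ \<eta> * t) < of_int i + 1 \<or> i = 2 * 2 ^ \<eta> - 1"
  proof (cases "\<lfloor>2 ^ Suc \<eta> * t\<rfloor> \<le> 2 ^ Suc \<eta> - 1")
    case True
    then have "i = \<lfloor>2 ^ Suc \<eta> * t\<rfloor>" by (simp add: i_def cell_index_def)
    then have "2 ^ Suc \<eta> * t < of_int i + 1" by linarith
    then show ?thesis by (simp add: mult.assoc)
  qed (simp add: i_def cell_index_def)
  have m: "2 ^ \<eta> * dyadic_mid (Suc \<eta>) i = (of_int i + 1 / 2) / 2"
    by (simp add: dyadic_mid_def)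
  have "\<lfloor>(real_of_int i + 1 / 2) / 2\<rfloor> = i div 2"
  proof (rule floor_unique)
    have "2 * (i div 2) \<le> i" "i \<le> 2 * (i div 2) + 1" by presburger+
    then have "2 * real_of_int (i div 2) \<le> of_int i" "real_of_int i \<le> 2 * of_int (i div 2) + 1"
      by linarith+
    then show "real_of_int (i div 2) \<le> (real_of_int i + 1 / 2) / 2"
      "(real_of_int i + 1 / 2) / 2 < real_of_int (i div 2) + 1" by simp_all
  qed
  then have l: "cell_index \<eta> (dyadic_mid (Suc \<eta>) i) = i div 2"
    unfolding cell_index_def m using i by simp
  have "cell_index \<eta> t = i div 2"
    using strict
  proof
    assume "2 * (2 ^ \<eta> * t) < of_int i + 1"
    then have "\<lfloor>2 * (2 ^ \<eta> * t)\<rfloor> = i" using i(3) by (intro floor_unique) auto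
    then have "\<lfloor>2 ^ \<eta> * t\<rfloor> = i div 2"
      using floor_divide_real_eq_div[of 2 "2 * (2 ^ \<eta> * t)"] by simp
    then show ?thesis using i by (simp add: cell_index_def)
  next
    assume *: "i = 2 * 2 ^ \<eta> - 1"
    then have "real_of_int i = 2 * 2 ^ \<eta> - 1" by simp
    then have "2 ^ \<eta> - 1 \<le> 2 ^ \<eta> * t" using i(3) by linarith
    then have "2 ^ \<eta> - 1 \<le> \<lfloor>2 ^ \<eta> * t\<rfloor>" by (simp add: le_floor_iff)
    then show ?thesis using * by (simp add: cell_index_def)
  qed
  then show ?thesis using l by (simp add: i_def)
qed

text \<open>Cells are labelled by their midpoints throughout. Thus \<open>cell_midpoint\<close> is a
  quantizer of the cube with values in this finite set, the cells are its fibres, and a sum over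
  cells is a sum over \<open>grid\<close>.\<close>

definition grid :: "(nat \<Rightarrow> nat) \<Rightarrow> nat \<Rightarrow> nat set \<Rightarrow> (nat \<times> nat \<Rightarrow> real) set" where
  "grid d \<eta> S = PiE (coords d S) (\<lambda>_. dyadic_mid \<eta> ` {0..<2 ^ \<eta>})"

lemma cell_midpoint_eq:
  "cell_midpoint d \<eta> S x = (\<lambda>j\<in>coords d S. dyadic_mid \<eta> (cell_index \<eta> (x j)))"
  by (simp add: cell_midpoint_def dyadic_mid_def)

lemma finite_grid: "finite S \<Longrightarrow> finite (grid d \<eta> S)"
  by (simp add: grid_def finite_PiE)

lemma card_grid:
  assumes "finite S"
  shows "card (grid d \<eta> S) = 2 ^ (\<eta> * (\<Sum>k\<in>S. d k))"
proof -
  have "inj_on (dyadic_mid \<eta>) {0..<2 ^ \<eta>}"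
    by (rule inj_on_inverseI[where g = "cell_index \<eta>"]) (simp add: cell_index_dyadic_mid)
  then have "card (dyadic_mid \<eta> ` {0..<2 ^ \<eta>}) = 2 ^ \<eta>"
    by (simp add: card_image nat_power_eq)
  then show ?thesis
    using assms by (simp add: grid_def card_PiE card_coords power_mult)
qed

lemma cell_midpoint_grid: "x \<in> space (cube d S) \<Longrightarrow> cell_midpoint d \<eta> S x \<in> grid d \<eta> S"
  unfolding grid_def cell_midpoint_eq
  by (rule restrict_PiE_iff[THEN iffD2]) (auto dest!: space_cubeD intro!: imageI cell_index_bounds(1,2))

lemma grid_subset_space: "grid d \<eta> S \<subseteq> space (cube d S)"
  unfolding grid_def space_cube using dyadic_mid_mem by (intro PiE_mono) fastforce

lemma cell_midpoint_space: "x \<in> space (cube d S) \<Longrightarrow> cell_midpoint d \<eta> S x \<in> space (cube d S)"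
  using cell_midpoint_grid grid_subset_space by blast

lemma cell_midpoint_of_grid:
  assumes "b \<in> grid d \<eta> S"
  shows "cell_midpoint d \<eta> S b = b"
proof
  fix j
  show "cell_midpoint d \<eta> S b j = b j"
  proof (cases "j \<in> coords d S")
    case True
    then obtain i where "b j = dyadic_mid \<eta> i" "i < 2 ^ \<eta>"
      using assms unfolding grid_def by (auto dest!: PiE_mem)
    then have "dyadic_mid \<eta> (cell_index \<eta> (b j)) = b j"
      using cell_index_dyadic_mid by metis
    with True show ?thesis unfolding cell_midpoint_eq by (simp only: restrict_apply if_True)
  next
    case False
    moreover from False have "b j = undefined"
      using assms unfolding grid_def by (rule PiE_arb[rotated])
    ultimately show ?thesis by (simp add: cell_midpoint_eq)
  qed
qed

lemma cell_midpoint_idem: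
  "x \<in> space (cube d S) \<Longrightarrow> cell_midpoint d \<eta> S (cell_midpoint d \<eta> S x) = cell_midpoint d \<eta> S x"
  by (simp add: cell_midpoint_of_grid cell_midpoint_grid)

lemma cell_midpoint_Suc:
  "x \<in> space (cube d S) \<Longrightarrow> cell_midpoint d \<eta> S (cell_midpoint d (Suc \<eta>) S x) = cell_midpoint d \<eta> S x"
  unfolding cell_midpoint_eq
  by (rule restrict_ext) (use cell_index_dyadic_mid_Suc space_cubeD in auto)

text \<open>At level 0 there is a single cell, so that chaining starts from a constant.\<close>

lemma cell_midpoint_0: "x \<in> space (cube d S) \<Longrightarrow> cell_midpoint d 0 S x = (\<lambda>j\<in>coords d S. 1 / 2)"
  unfolding cell_midpoint_eq
proof (rule restrict_ext)
  fix j assume "x \<in> space (cube d S)" "j \<in> coords d S"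
  then have "x j \<in> {0..1}" by (rule space_cubeD)
  from cell_index_bounds(1,2)[OF this, of 0] have "cell_index 0 (x j) = 0" by simp
  then show "dyadic_mid 0 (cell_index 0 (x j)) = 1 / 2" by (simp add: dyadic_mid_def)
qed

lemma cell_midpoint_proj:
  "S \<subseteq> T \<Longrightarrow> cell_midpoint d \<eta> S (proj d T x) = cell_midpoint d \<eta> S x"
  using coords_mono[of S T d] by (auto simp: cell_midpoint_eq proj_def intro!: restrict_ext)

lemma sup_dist_cell_midpoint:
  assumes "finite S" "x \<in> space (cube d S)"
  shows "sup_dist d S x (cell_midpoint d \<eta> S x) \<le> (1 / 2) ^ \<eta> / 2"
  unfolding sup_dist_le_iff[OF assms(1)] cell_midpoint_eq
  using dist_dyadic_mid[OF space_cubeD[OF assms(2)]] by simp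

lemma cell_eq:
  assumes "x \<in> space (cube d S)"
  shows "cell d \<eta> S x = {y \<in> space (cube d S). cell_midpoint d \<eta> S y = cell_midpoint d \<eta> S x}"
proof -
  have "cell_index \<eta> s = cell_index \<eta> t \<longleftrightarrow> dyadic_mid \<eta> (cell_index \<eta> s) = dyadic_mid \<eta> (cell_index \<eta> t)" for s t
    by (auto simp: dyadic_mid_def)
  then show ?thesis
    unfolding cell_def cell_midpoint_eq restrict_def fun_eq_iff by auto
qed

lemma cell_midpoint_eq_sets:
  assumes "finite S"
  shows "{x \<in> space (cube d S). cell_midpoint d \<eta> S x = b} \<in> sets (cube d S)"
proof (cases "b \<in> extensional (coords d S)")
  case True
  have [measurable]: "j \<in> coords d S \<Longrightarrow> (\<lambda>x. x j) \<in> borel_measurable (cube d S)" for j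
    by (rule measurable_coord)
  have "{x \<in> space (cube d S). \<forall>j\<in>coords d S. dyadic_mid \<eta> (cell_index \<eta> (x j)) = b j} \<in> sets (cube d S)"
    using assms unfolding dyadic_mid_def cell_index_def
    by (intro sets.sets_Collect_finite_All) measurable
  also have "{x \<in> space (cube d S). \<forall>j\<in>coords d S. dyadic_mid \<eta> (cell_index \<eta> (x j)) = b j} =
      {x \<in> space (cube d S). cell_midpoint d \<eta> S x = b}"
    using True by (auto simp: cell_midpoint_eq fun_eq_iff extensional_def)
  finally show ?thesis .
next
  case False
  then have "cell_midpoint d \<eta> S x \<noteq> b" for x
    unfolding cell_midpoint_eq using restrict_extensional by blast
  then show ?thesis by simp
qed

text \<open>Finitely many measurable fibres are enough for the discrete sigma-algebra on the target.
  Hence every function of the cell label is measurable, whatever its form.\<close>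

lemma cell_midpoint_measurable_count:
  assumes "finite S"
  shows "cell_midpoint d \<eta> S \<in> cube d S \<rightarrow>\<^sub>M count_space UNIV"
proof (rule measurableI)
  fix A :: "(nat \<times> nat \<Rightarrow> real) set"
  have "cell_midpoint d \<eta> S -` A \<inter> space (cube d S) =
      (\<Union>b\<in>A \<inter> grid d \<eta> S. {x \<in> space (cube d S). cell_midpoint d \<eta> S x = b})"
    using cell_midpoint_grid by auto
  also have "\<dots> \<in> sets (cube d S)"
    using assms by (intro sets.finite_UN cell_midpoint_eq_sets) (auto simp: finite_grid)
  finally show "cell_midpoint d \<eta> S -` A \<inter> space (cube d S) \<in> sets (cube d S)" .
qed simp

lemma cell_midpoint_comp_measurable:
  assumes "finite S"
  shows "(\<lambda>x. g (cell_midpoint d \<eta> S x) :: 'a :: topological_space) \<in> borel_measurable (cube d S)"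
  by (rule measurable_compose[OF cell_midpoint_measurable_count[OF assms]]) simp

lemma cell_sets: "finite S \<Longrightarrow> x \<in> space (cube d S) \<Longrightarrow> cell d \<eta> S x \<in> sets (cube d S)"
  by (simp add: cell_eq cell_midpoint_eq_sets)

section \<open>Wasserstein distance and Lipschitz test functions\<close>

text \<open>Measurability is part of the notion, so that test functions can be integrated without
  comparing the product sigma-algebra with the topology of the sup-distance.\<close>

definition cube_lipschitz ::
  "(nat \<Rightarrow> nat) \<Rightarrow> nat set \<Rightarrow> real \<Rightarrow> ((nat \<times> nat \<Rightarrow> real) \<Rightarrow> real) \<Rightarrow> bool" where
  "cube_lipschitz d S \<Lambda> f \<longleftrightarrow> f \<in> borel_measurable (cube d S) \<and>
     (\<forall>x\<in>space (cube d S). \<forall>y\<in>space (cube d S). \<bar>f x - f y\<bar> \<le> \<Lambda> * sup_dist d S x y)"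

lemma cube_lipschitzD:
  assumes "cube_lipschitz d S \<Lambda> f"
  shows "f \<in> borel_measurable (cube d S)"
    and "x \<in> space (cube d S) \<Longrightarrow> y \<in> space (cube d S) \<Longrightarrow> \<bar>f x - f y\<bar> \<le> \<Lambda> * sup_dist d S x y"
  using assms by (auto simp: cube_lipschitz_def)

lemma space_cube_nonempty: "space (cube d S) \<noteq> {}"
proof -
  have "(\<lambda>j\<in>coords d S. 0) \<in> space (cube d S)" by (simp add: space_cube)
  then show ?thesis by blast
qed

abbreviation cube_probs :: "(nat \<Rightarrow> nat) \<Rightarrow> nat set \<Rightarrow> (nat \<times> nat \<Rightarrow> real) measure set" where
  "cube_probs d S \<equiv> space (prob_algebra (cube d S))"

lemma prob_algebraD:
  assumes "M \<in> space (prob_algebra N)"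
  shows "prob_space M" "sets M = sets N" "space M = space N"
  using assms sets_eq_imp_space_eq[of M N] by (auto simp: space_prob_algebra)

lemma cube_lipschitz_bounded:
  assumes "cube_lipschitz d S \<Lambda> f" "finite S" "0 \<le> \<Lambda>"
  obtains B where "\<And>x. x \<in> space (cube d S) \<Longrightarrow> \<bar>f x\<bar> \<le> B"
proof -
  obtain x0 where x0: "x0 \<in> space (cube d S)" using space_cube_nonempty by blast
  have "\<bar>f x\<bar> \<le> \<bar>f x0\<bar> + \<Lambda>" if "x \<in> space (cube d S)" for x
  proof -
    have "\<bar>f x - f x0\<bar> \<le> \<Lambda> * sup_dist d S x x0"
      by (rule cube_lipschitzD(2)[OF assms(1) that x0])
    also have "\<dots> \<le> \<Lambda> * 1"
      using sup_dist_le_1[OF assms(2) that x0] assms(3) by (rule mult_left_mono)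
    finally show ?thesis by linarith
  qed
  then show thesis by (rule that)
qed

lemma integrable_bounded_prob:
  fixes f :: "'a \<Rightarrow> real"
  assumes "M \<in> space (prob_algebra N)" "f \<in> borel_measurable N"
    and "\<And>x. x \<in> space N \<Longrightarrow> \<bar>f x\<bar> \<le> B"
  shows "integrable M f"
proof -
  interpret prob_space M using assms(1) by (rule prob_algebraD)
  have "f \<in> borel_measurable M"
    using assms(2) by (simp cong: measurable_cong_sets add: prob_algebraD(2)[OF assms(1)])
  then show ?thesis
    using assms(3) by (intro integrable_const_bound[of _ B]) (auto simp: prob_algebraD(3)[OF assms(1)])
qed

lemma integrable_cube_lipschitz:
  assumes "M \<in> cube_probs d S" "cube_lipschitz d S \<Lambda> f" "finite S" "0 \<le> \<Lambda>"
  shows "integrable M f"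
  using cube_lipschitz_bounded[OF assms(2-)] integrable_bounded_prob[OF assms(1) cube_lipschitzD(1)[OF assms(2)]]
  by metis

text \<open>The easy half of duality: under any coupling the two integrals are those of
  \<open>f (fst z)\<close> and \<open>f (snd z)\<close>, which differ by at most the Lipschitz
  constant times the transport cost. It turns the hypothesis on the kernels into one on integrals of
  test functions.\<close>

lemma integral_diff_le_wasserstein:
  assumes M: "M \<in> cube_probs d S" and N: "N \<in> cube_probs d S"
    and f: "cube_lipschitz d S \<Lambda> f" and S: "finite S" and \<Lambda>: "0 \<le> \<Lambda>"
    and W: "wasserstein d S M N \<le> ennreal r" and r: "0 \<le> r"
  shows "\<bar>integral\<^sup>L M f - integral\<^sup>L N f\<bar> \<le> \<Lambda> * r"
proof (rule field_le_epsilon)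
  fix e :: real assume e: "e > 0"
  \<comment> \<open>A positive slope, to divide by it also if \<open>\<Lambda> = 0\<close>; the
    denominator \<open>r + 1\<close> makes the surplus cost at most \<open>e\<close>.\<close>
  define l where "l = \<Lambda> + e / (r + 1)"
  have l: "l > 0" using \<Lambda> e r by (simp add: l_def add_nonneg_pos)
  define I where "I = \<bar>integral\<^sup>L M f - integral\<^sup>L N f\<bar>"
  have "ennreal (I / l) \<le> (\<integral>\<^sup>+(x, y). ennreal (sup_dist d S x y) \<partial>Q)" if Q: "Q \<in> couplings M N" for Q
  proof -
    have sQ [measurable_cong]: "sets Q = sets (M \<Otimes>\<^sub>M N)"
      and dQ: "distr Q M fst = M" "distr Q N snd = N"
      using Q by (auto simp: couplings_def)
    have [measurable_cong]: "sets M = sets (cube d S)" "sets N = sets (cube d S)"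
      using M N by (simp_all add: prob_algebraD)
    have fm [measurable]: "f \<in> borel_measurable (cube d S)" by (rule cube_lipschitzD(1)[OF f])
    have spQ: "space Q = space (cube d S) \<times> space (cube d S)"
      using sets_eq_imp_space_eq[OF sQ] by (simp add: space_pair_measure prob_algebraD(3)[OF M] prob_algebraD(3)[OF N])
    have "integrable (distr Q M fst) f" "integrable (distr Q N snd) f"
      unfolding dQ by (rule integrable_cube_lipschitz[OF _ f S \<Lambda>], rule M N)+
    then have int: "integrable Q (\<lambda>z. f (fst z))" "integrable Q (\<lambda>z. f (snd z))"
      by (auto intro: integrable_distr[of fst Q M f] integrable_distr[of snd Q N f])
    have "integral\<^sup>L M f = (\<integral>z. f (fst z) \<partial>Q)"
      using integral_distr[of fst Q M f] by (simp add: dQ)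
    moreover have "integral\<^sup>L N f = (\<integral>z. f (snd z) \<partial>Q)"
      using integral_distr[of snd Q N f] by (simp add: dQ)
    ultimately have "I = \<bar>\<integral>z. f (fst z) - f (snd z) \<partial>Q\<bar>"
      using int by (simp add: I_def)
    also have "\<dots> \<le> (\<integral>z. \<bar>f (fst z) - f (snd z)\<bar> \<partial>Q)" by (rule integral_abs_bound)
    finally have "I / l \<le> (\<integral>z. \<bar>f (fst z) - f (snd z)\<bar> / l \<partial>Q)"
      using l by (simp add: divide_right_mono)
    then have "ennreal (I / l) \<le> ennreal (\<integral>z. \<bar>f (fst z) - f (snd z)\<bar> / l \<partial>Q)" by (rule ennreal_leI)
    also have "\<dots> = (\<integral>\<^sup>+z. ennreal (\<bar>f (fst z) - f (snd z)\<bar> / l) \<partial>Q)"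
      using int l by (intro nn_integral_eq_integral[symmetric]) auto
    also have "\<dots> \<le> (\<integral>\<^sup>+(x, y). ennreal (sup_dist d S x y) \<partial>Q)"
    proof (intro nn_integral_mono, clarify)
      fix x y assume "(x, y) \<in> space Q"
      then have "\<bar>f x - f y\<bar> \<le> \<Lambda> * sup_dist d S x y"
        using cube_lipschitzD(2)[OF f] by (simp add: spQ)
      also have "\<dots> \<le> l * sup_dist d S x y"
        using e r sup_dist_nonneg[OF S] by (intro mult_right_mono) (auto simp: l_def)
      finally show "ennreal (\<bar>f (fst (x, y)) - f (snd (x, y))\<bar> / l) \<le> ennreal (sup_dist d S x y)"
        using l by (intro ennreal_leI) (simp add: field_simps)
    qed
    finally show ?thesis .
  qed
  then have "ennreal (I / l) \<le> wasserstein d S M N"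
    unfolding wasserstein_def by (rule INF_greatest)
  with W have "ennreal (I / l) \<le> ennreal r" by (rule order_trans[rotated])
  then have "I \<le> l * r" using l r by (simp add: field_simps)
  also have "l * r = \<Lambda> * r + e * (r / (r + 1))" by (simp add: l_def field_simps)
  also have "e * (r / (r + 1)) \<le> e * 1" using e r by (intro mult_left_mono) (auto simp: field_simps)
  finally show "\<bar>integral\<^sup>L M f - integral\<^sup>L N f\<bar> \<le> \<Lambda> * r + e" by (simp add: I_def)
qed

section \<open>Finite quantization of measures, and lifting of couplings from labels to
  points\<close>

lemma integral_finite_valued:
  fixes g :: "'b \<Rightarrow> real"
  assumes "finite_measure M" "finite A" "\<And>x. x \<in> space M \<Longrightarrow> h x \<in> A"
    and [measurable]: "\<And>a. {x \<in> space M. h x = a} \<in> sets M"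
  shows "(\<integral>x. g (h x) \<partial>M) = (\<Sum>a\<in>A. g a * measure M {x \<in> space M. h x = a})"
    and "integrable M (\<lambda>x. g (h x))"
proof -
  interpret finite_measure M by fact
  have eq: "g (h x) = (\<Sum>a\<in>A. g a * indicator {x \<in> space M. h x = a} x)" if "x \<in> space M" for x
    using assms(2) assms(3)[OF that] that by (simp add: indicator_def if_distrib[of "\<lambda>u. _ * u"] cong: if_cong)
  show "(\<integral>x. g (h x) \<partial>M) = (\<Sum>a\<in>A. g a * measure M {x \<in> space M. h x = a})"
    by (subst Bochner_Integration.integral_cong[OF refl eq], assumption)
      (subst Bochner_Integration.integral_sum, auto simp: emeasure_eq_measure)
  show "integrable M (\<lambda>x. g (h x))"
    by (subst Bochner_Integration.integrable_cong[OF refl eq], assumption)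
      (auto intro!: Bochner_Integration.integrable_sum simp: emeasure_eq_measure)
qed

text \<open>The mass \<open>\<pi> (a, b)\<close> is spread over the product of the fibres of
  \<open>a\<close> and \<open>b\<close> as the product of the two conditioned laws. This is a
  density with respect to the product measure that is constant on such products, so marginals and
  costs reduce to finite sums over labels.\<close>

lemma lift_coupling:
  fixes \<pi> :: "'a \<times> 'b \<Rightarrow> real"
  assumes "prob_space M" "prob_space N" and fin: "finite A" "finite B"
    and h: "\<And>x. x \<in> space M \<Longrightarrow> h x \<in> A" and k: "\<And>y. y \<in> space N \<Longrightarrow> k y \<in> B"
    and hm [measurable]: "\<And>a. {x \<in> space M. h x = a} \<in> sets M"
    and km [measurable]: "\<And>b. {y \<in> space N. k y = b} \<in> sets N"
    and \<pi>0: "\<And>a b. a \<in> A \<Longrightarrow> b \<in> B \<Longrightarrow> 0 \<le> \<pi> (a, b)"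
    and \<pi>1: "\<And>a. a \<in> A \<Longrightarrow> (\<Sum>b\<in>B. \<pi> (a, b)) = measure M {x \<in> space M. h x = a}"
    and \<pi>2: "\<And>b. b \<in> B \<Longrightarrow> (\<Sum>a\<in>A. \<pi> (a, b)) = measure N {y \<in> space N. k y = b}"
  obtains Q where "Q \<in> couplings M N"
    and "\<And>g :: 'a \<Rightarrow> 'b \<Rightarrow> real. (\<And>a b. 0 \<le> g a b) \<Longrightarrow>
      (\<integral>\<^sup>+(x, y). ennreal (g (h x) (k y)) \<partial>Q) = ennreal (\<Sum>a\<in>A. \<Sum>b\<in>B. \<pi> (a, b) * g a b)"
proof -
  let ?F = "\<lambda>a. {x \<in> space M. h x = a}" and ?G = "\<lambda>b. {y \<in> space N. k y = b}"
  interpret M: prob_space M by fact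
  interpret N: prob_space N by fact
  interpret MN: pair_prob_space M N ..
  define p where "p a = measure M (?F a)" for a
  define s where "s b = measure N (?G b)" for b
  \<comment> \<open>\<open>max 0\<close> makes the density nonnegative also for labels outside
    \<open>A \<times> B\<close>, where \<pi> is arbitrary.\<close>
  define w where "w a b = max 0 (\<pi> (a, b)) / (p a * s b)" for a b
  have ps0: "0 \<le> p a" "0 \<le> s b" for a b by (simp_all add: p_def s_def)
  have w0: "0 \<le> w a b" for a b by (simp add: w_def ps0)
  \<comment> \<open>Division by zero is harmless: \<open>\<pi> (a, b)\<close> is at most the mass of
    either fibre, hence 0 if one of them is null.\<close>
  have ws: "w a b * p a * s b = \<pi> (a, b)" if ab: "a \<in> A" "b \<in> B" for a b
  proof -
    have "\<pi> (a, b) \<le> p a" unfolding p_def \<pi>1[OF ab(1), symmetric]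
      using ab fin \<pi>0 by (intro member_le_sum) auto
    moreover have "\<pi> (a, b) \<le> s b" unfolding s_def \<pi>2[OF ab(2), symmetric]
      using ab fin \<pi>0 by (intro member_le_sum[of a A "\<lambda>a. \<pi> (a, b)"]) auto
    ultimately have "p a = 0 \<or> s b = 0 \<Longrightarrow> \<pi> (a, b) = 0" using \<pi>0[OF ab] by auto
    then show ?thesis using \<pi>0[OF ab] by (auto simp: w_def)
  qed
  \<comment> \<open>One formula serves twice: with weight \<open>w\<close> it gives \<open>Q\<close>
    on rectangles and thus the marginals, with weight \<open>w a b * g a b\<close> on the whole
    product it gives the transport cost.\<close>
  have rect: "(\<integral>\<^sup>+z. ennreal (g (h (fst z)) (k (snd z))) * indicator (X \<times> Y) z \<partial>(M \<Otimes>\<^sub>M N)) =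
      ennreal (\<Sum>a\<in>A. \<Sum>b\<in>B. g a b * measure M (X \<inter> (?F a)) * measure N (Y \<inter> (?G b)))"
    if [measurable]: "X \<in> sets M" "Y \<in> sets N" and g0: "\<And>a b. 0 \<le> g a b" for g :: "'a \<Rightarrow> 'b \<Rightarrow> real" and X Y
  proof -
    have "(\<integral>\<^sup>+z. ennreal (g (h (fst z)) (k (snd z))) * indicator (X \<times> Y) z \<partial>(M \<Otimes>\<^sub>M N)) =
       (\<integral>\<^sup>+z. (\<Sum>a\<in>A. \<Sum>b\<in>B. ennreal (g a b) *
          indicator ((X \<inter> (?F a)) \<times> (Y \<inter> (?G b))) z) \<partial>(M \<Otimes>\<^sub>M N))"
    proof (rule nn_integral_cong)
      fix z assume "z \<in> space (M \<Otimes>\<^sub>M N)"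
      then obtain x y where z: "z = (x, y)" "x \<in> space M" "y \<in> space N" by (auto simp: space_pair_measure)
      have "indicator ((X \<inter> (?F a)) \<times> (Y \<inter> (?G b))) (x, y) =
         (if h x = a then if k y = b then indicator (X \<times> Y) (x, y) else 0 else (0::ennreal))" for a b
        using z by (auto simp: indicator_def)
      moreover have "(\<Sum>a\<in>A. \<Sum>b\<in>B. ennreal (g a b) *
          (if h x = a then if k y = b then indicator (X \<times> Y) (x, y) else 0 else 0)) =
          (\<Sum>a\<in>A. if h x = a then ennreal (g a (k y)) * indicator (X \<times> Y) (x, y) else 0)"
        using fin k[OF z(3)]
        by (intro sum.cong refl) (simp add: if_distrib[of "\<lambda>u. _ * u"] cong: if_cong)
      ultimately show "ennreal (g (h (fst z)) (k (snd z))) * indicator (X \<times> Y) z = (\<Sum>a\<in>A. \<Sum>b\<in>B. ennreal (g a b) *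
          indicator ((X \<inter> (?F a)) \<times> (Y \<inter> (?G b))) z)"
        using fin h[OF z(2)] by (simp add: z(1))
    qed
    also have "\<dots> = (\<Sum>a\<in>A. \<Sum>b\<in>B. ennreal (g a b) * (emeasure M (X \<inter> (?F a)) * emeasure N (Y \<inter> (?G b))))"
    proof -
      have m: "(X \<inter> (?F a)) \<times> (Y \<inter> (?G b)) \<in> sets (M \<Otimes>\<^sub>M N)" for a b
        by (intro pair_measureI sets.Int that hm km)
      have i: "(\<lambda>z. ennreal (g a b) * indicator ((X \<inter> (?F a)) \<times> (Y \<inter> (?G b))) z)
          \<in> borel_measurable (M \<Otimes>\<^sub>M N)" for a b
        by (intro borel_measurable_times_ennreal borel_measurable_indicator m borel_measurable_const)
      have e: "emeasure (M \<Otimes>\<^sub>M N) ((X \<inter> (?F a)) \<times> (Y \<inter> (?G b))) =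
          emeasure M (X \<inter> (?F a)) * emeasure N (Y \<inter> (?G b))" for a b
        by (intro N.emeasure_pair_measure_Times sets.Int that hm km)
      show ?thesis
        unfolding e[symmetric] nn_integral_cmult_indicator[OF m, symmetric]
        by (subst nn_integral_sum, rule borel_measurable_sum, rule i, intro sum.cong refl nn_integral_sum i)
    qed
    also have "\<dots> = ennreal (\<Sum>a\<in>A. \<Sum>b\<in>B. g a b * measure M (X \<inter> (?F a)) * measure N (Y \<inter> (?G b)))"
    proof -
      have "ennreal (g a b) * (emeasure M (X \<inter> (?F a)) * emeasure N (Y \<inter> (?G b))) =
          ennreal (g a b * measure M (X \<inter> (?F a)) * measure N (Y \<inter> (?G b)))" for a b
        unfolding M.emeasure_eq_measure N.emeasure_eq_measure mult.assoc
        by (simp only: ennreal_mult g0 measure_nonneg mult_nonneg_nonneg)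
      then show ?thesis
        by (simp add: sum_ennreal sum_nonneg g0)
    qed
    finally show ?thesis .
  qed
  define Q where "Q = density (M \<Otimes>\<^sub>M N) (\<lambda>z. ennreal (w (h (fst z)) (k (snd z))))"
  have hc: "h \<in> M \<rightarrow>\<^sub>M count_space A" "k \<in> N \<rightarrow>\<^sub>M count_space B"
    using fin h k hm km
    by (auto intro!: measurable_count_space_eq2[THEN iffD2] simp: vimage_def Int_def conj_commute)
  \<comment> \<open>The label pairs range over a finite set whose product sigma-algebra is discrete,
    so \<open>g\<close> may be arbitrary.\<close>
  have comp: "(\<lambda>z. ennreal (g (h (fst z)) (k (snd z)))) \<in> borel_measurable (M \<Otimes>\<^sub>M N)" for g :: "'a \<Rightarrow> 'b \<Rightarrow> real"
  proof -
    have [measurable]: "h \<in> M \<rightarrow>\<^sub>M count_space A" "k \<in> N \<rightarrow>\<^sub>M count_space B" by (rule hc)+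
    have "(\<lambda>z. (h (fst z), k (snd z))) \<in> M \<Otimes>\<^sub>M N \<rightarrow>\<^sub>M count_space A \<Otimes>\<^sub>M count_space B" by measurable
    also have "count_space A \<Otimes>\<^sub>M count_space B = count_space (A \<times> B)"
      using fin by (simp add: pair_measure_count_space)
    finally have "(\<lambda>z. (h (fst z), k (snd z))) \<in> M \<Otimes>\<^sub>M N \<rightarrow>\<^sub>M count_space (A \<times> B)" .
    from measurable_compose[OF this, of "\<lambda>(a, b). ennreal (g a b)" borel] show ?thesis by simp
  qed
  have Qrect: "emeasure Q (X \<times> Y) =
      ennreal (\<Sum>a\<in>A. \<Sum>b\<in>B. w a b * measure M (X \<inter> (?F a)) * measure N (Y \<inter> (?G b)))"
    if [measurable]: "X \<in> sets M" "Y \<in> sets N" for X Y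
    unfolding Q_def using rect[OF that w0] comp[of w] by (simp add: emeasure_density)
  have null: "measure M (X \<inter> (?F a)) = 0" if "p a = 0" for X a
  proof -
    have "measure M (X \<inter> (?F a)) \<le> p a"
      unfolding p_def by (intro M.finite_measure_mono hm) auto
    then show ?thesis using that by (simp add: measure_le_0_iff)
  qed
  have null2: "measure N (Y \<inter> (?G b)) = 0" if "s b = 0" for Y b
  proof -
    have "measure N (Y \<inter> (?G b)) \<le> s b"
      unfolding s_def by (intro N.finite_measure_mono km) auto
    then show ?thesis using that by (simp add: measure_le_0_iff)
  qed
  have "distr Q M fst = M"
  proof (rule measure_eqI)
    fix X assume "X \<in> sets (distr Q M fst)"
    then have X [measurable]: "X \<in> sets M" by simp
    have "emeasure (distr Q M fst) X = emeasure Q (X \<times> space N)"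
      using sets.sets_into_space[OF X]
      by (subst emeasure_distr) (auto simp: Q_def space_pair_measure intro!: arg_cong[where f = "emeasure _"])
    also have "\<dots> = ennreal (\<Sum>a\<in>A. \<Sum>b\<in>B. w a b * measure M (X \<inter> (?F a)) * s b)"
      by (subst Qrect) (simp_all add: s_def Int_def)
    also have "(\<Sum>a\<in>A. \<Sum>b\<in>B. w a b * measure M (X \<inter> (?F a)) * s b) =
        (\<Sum>a\<in>A. measure M (X \<inter> (?F a)))"
    proof (rule sum.cong[OF refl])
      fix a assume a: "a \<in> A"
      show "(\<Sum>b\<in>B. w a b * measure M (X \<inter> (?F a)) * s b) = measure M (X \<inter> (?F a))"
      proof (cases "p a = 0")
        case False
        have "w a b * s b = \<pi> (a, b) / p a" if "b \<in> B" for b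
          using ws[OF a that] False by (simp add: field_simps)
        then have "(\<Sum>b\<in>B. w a b * s b) = 1"
          using \<pi>1[OF a] False by (simp add: p_def flip: sum_divide_distrib)
        moreover have "(\<Sum>b\<in>B. w a b * m * s b) = m * (\<Sum>b\<in>B. w a b * s b)" for m
          by (simp add: sum_distrib_left mult_ac)
        ultimately show ?thesis by simp
      qed (simp add: null)
    qed
    also have "\<dots> = measure M (\<Union>a\<in>A. X \<inter> (?F a))"
      using fin by (intro M.finite_measure_finite_Union[symmetric]) (auto simp: disjoint_family_on_def)
    also have "(\<Union>a\<in>A. X \<inter> (?F a)) = X"
      using sets.sets_into_space[OF X] h by auto
    finally show "emeasure (distr Q M fst) X = emeasure M X" by (simp add: M.emeasure_eq_measure)
  qed simp
  moreover have "distr Q N snd = N"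
  proof (rule measure_eqI)
    fix Y assume "Y \<in> sets (distr Q N snd)"
    then have Y [measurable]: "Y \<in> sets N" by simp
    have "emeasure (distr Q N snd) Y = emeasure Q (space M \<times> Y)"
      using sets.sets_into_space[OF Y]
      by (subst emeasure_distr) (auto simp: Q_def space_pair_measure intro!: arg_cong[where f = "emeasure _"])
    also have "\<dots> = ennreal (\<Sum>a\<in>A. \<Sum>b\<in>B. w a b * p a * measure N (Y \<inter> (?G b)))"
      by (subst Qrect) (simp_all add: p_def Int_def)
    also have "(\<Sum>a\<in>A. \<Sum>b\<in>B. w a b * p a * measure N (Y \<inter> (?G b))) =
        (\<Sum>b\<in>B. \<Sum>a\<in>A. w a b * p a * measure N (Y \<inter> (?G b)))"
      by (rule sum.swap)
    also have "\<dots> = (\<Sum>b\<in>B. measure N (Y \<inter> (?G b)))"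
    proof (rule sum.cong[OF refl])
      fix b assume b: "b \<in> B"
      show "(\<Sum>a\<in>A. w a b * p a * measure N (Y \<inter> (?G b))) = measure N (Y \<inter> (?G b))"
      proof (cases "s b = 0")
        case False
        have "w a b * p a = \<pi> (a, b) / s b" if "a \<in> A" for a
          using ws[OF that b] False by (simp add: field_simps)
        then have "(\<Sum>a\<in>A. w a b * p a) = 1"
          using \<pi>2[OF b] False by (simp add: s_def flip: sum_divide_distrib)
        then show ?thesis by (simp flip: sum_distrib_right)
      qed (simp add: null2)
    qed
    also have "\<dots> = measure N (\<Union>b\<in>B. Y \<inter> (?G b))"
      using fin by (intro N.finite_measure_finite_Union[symmetric]) (auto simp: disjoint_family_on_def)
    also have "(\<Union>b\<in>B. Y \<inter> (?G b)) = Y"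
      using sets.sets_into_space[OF Y] k by auto
    finally show "emeasure (distr Q N snd) Y = emeasure N Y" by (simp add: N.emeasure_eq_measure)
  qed simp
  ultimately have "Q \<in> couplings M N"
    by (simp add: couplings_def Q_def)
  moreover have "(\<integral>\<^sup>+(x, y). ennreal (g (h x) (k y)) \<partial>Q) = ennreal (\<Sum>a\<in>A. \<Sum>b\<in>B. \<pi> (a, b) * g a b)"
    if g0: "\<And>a b. 0 \<le> g a b" for g :: "'a \<Rightarrow> 'b \<Rightarrow> real"
  proof -
    have "(\<integral>\<^sup>+(x, y). ennreal (g (h x) (k y)) \<partial>Q) =
        (\<integral>\<^sup>+z. ennreal (w (h (fst z)) (k (snd z))) * ennreal (g (h (fst z)) (k (snd z))) \<partial>(M \<Otimes>\<^sub>M N))"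
      unfolding Q_def case_prod_beta by (rule nn_integral_density) (rule comp)+
    also have "\<dots> = (\<integral>\<^sup>+z. ennreal (w (h (fst z)) (k (snd z)) * g (h (fst z)) (k (snd z))) * indicator (space M \<times> space N) z \<partial>(M \<Otimes>\<^sub>M N))"
      by (rule nn_integral_cong) (simp add: ennreal_mult w0 g0 space_pair_measure)
    also have "\<dots> = ennreal (\<Sum>a\<in>A. \<Sum>b\<in>B. w a b * g a b * p a * s b)"
      using rect[of "space M" "space N" "\<lambda>a b. w a b * g a b"] w0 g0
      by (simp add: p_def s_def Int_def)
    also have "(\<Sum>a\<in>A. \<Sum>b\<in>B. w a b * g a b * p a * s b) = (\<Sum>a\<in>A. \<Sum>b\<in>B. \<pi> (a, b) * g a b)"
      by (intro sum.cong refl) (simp add: ws[symmetric] mult_ac)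
    finally show ?thesis .
  qed
  ultimately show thesis by (rule that)
qed

definition cell_prob ::
  "(nat \<Rightarrow> nat) \<Rightarrow> nat \<Rightarrow> nat set \<Rightarrow> (nat \<times> nat \<Rightarrow> real) measure \<Rightarrow> (nat \<times> nat \<Rightarrow> real) \<Rightarrow> real" where
  "cell_prob d \<eta> S M b = measure M {x \<in> space (cube d S). cell_midpoint d \<eta> S x = b}"

lemma integral_cell_midpoint:
  fixes g :: "(nat \<times> nat \<Rightarrow> real) \<Rightarrow> real"
  assumes "finite S" and M: "M \<in> cube_probs d S"
  shows "(\<integral>x. g (cell_midpoint d \<eta> S x) \<partial>M) = (\<Sum>b\<in>grid d \<eta> S. g b * cell_prob d \<eta> S M b)"
    and "integrable M (\<lambda>x. g (cell_midpoint d \<eta> S x))"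
proof -
  interpret prob_space M using M by (rule prob_algebraD)
  note * = integral_finite_valued[of M "grid d \<eta> S" "cell_midpoint d \<eta> S" g]
  show "(\<integral>x. g (cell_midpoint d \<eta> S x) \<partial>M) = (\<Sum>b\<in>grid d \<eta> S. g b * cell_prob d \<eta> S M b)"
    unfolding cell_prob_def
    using *(1) assms cell_midpoint_eq_sets[OF assms(1)] finite_grid[OF assms(1)] cell_midpoint_grid finite_measure_axioms
    by (simp add: prob_algebraD[OF M])
  show "integrable M (\<lambda>x. g (cell_midpoint d \<eta> S x))"
    using *(2) assms cell_midpoint_eq_sets[OF assms(1)] finite_grid[OF assms(1)] cell_midpoint_grid finite_measure_axioms
    by (simp add: prob_algebraD[OF M])
qed

lemma sum_cell_prob:
  assumes "finite S" "M \<in> cube_probs d S"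
  shows "(\<Sum>b\<in>grid d \<eta> S. cell_prob d \<eta> S M b) = 1"
  using integral_cell_midpoint(1)[OF assms, of "\<lambda>_. 1" \<eta>] prob_space.prob_space[OF prob_algebraD(1)[OF assms(2)]]
  by simp

lemma integral_diff_cell_midpoint:
  assumes S: "finite S" and M: "M \<in> cube_probs d S"
    and f: "cube_lipschitz d S \<Lambda> f" and \<Lambda>: "0 \<le> \<Lambda>"
  shows "\<bar>integral\<^sup>L M f - (\<integral>x. f (cell_midpoint d \<eta> S x) \<partial>M)\<bar> \<le> \<Lambda> * ((1 / 2) ^ \<eta> / 2)"
proof -
  interpret prob_space M using M by (rule prob_algebraD)
  have int: "integrable M f" "integrable M (\<lambda>x. f (cell_midpoint d \<eta> S x))"
    using integrable_cube_lipschitz[OF M f S \<Lambda>] integral_cell_midpoint(2)[OF S M] by auto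
  have "\<bar>integral\<^sup>L M f - (\<integral>x. f (cell_midpoint d \<eta> S x) \<partial>M)\<bar> =
      \<bar>\<integral>x. f x - f (cell_midpoint d \<eta> S x) \<partial>M\<bar>"
    using int by simp
  also have "\<dots> \<le> (\<integral>x. \<bar>f x - f (cell_midpoint d \<eta> S x)\<bar> \<partial>M)" by (rule integral_abs_bound)
  also have "\<dots> \<le> (\<integral>x. \<Lambda> * ((1 / 2) ^ \<eta> / 2) \<partial>M)"
  proof (rule integral_mono)
    fix x assume "x \<in> space M"
    then have x: "x \<in> space (cube d S)" by (simp add: prob_algebraD[OF M])
    have "\<bar>f x - f (cell_midpoint d \<eta> S x)\<bar> \<le> \<Lambda> * sup_dist d S x (cell_midpoint d \<eta> S x)"
      by (intro cube_lipschitzD(2)[OF f] x cell_midpoint_space)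
    also have "\<dots> \<le> \<Lambda> * ((1 / 2) ^ \<eta> / 2)"
      by (intro mult_left_mono sup_dist_cell_midpoint S x \<Lambda>)
    finally show "\<bar>f x - f (cell_midpoint d \<eta> S x)\<bar> \<le> \<Lambda> * ((1 / 2) ^ \<eta> / 2)" .
  qed (use int in auto)
  finally show ?thesis by (simp add: prob_space)
qed

text \<open>On the finitely many values of a dyadic quantizer this is linear programming duality; as
  the dual potential can be taken of the form \<open>F x = min\<^sub>b (dist x b - \<psi> b)\<close>, it extends from the
  grid to a 1-Lipschitz function on the whole cube. The optimal plan of the grid values is lifted back
  to the cube, and the mesh tends to 0.\<close>

lemma wasserstein_le_dual:
  assumes S: "finite S" and M: "M \<in> cube_probs d S" and N: "N \<in> cube_probs d S"
    and dual: "\<And>f. cube_lipschitz d S 1 f \<Longrightarrow> integral\<^sup>L M f - integral\<^sup>L N f \<le> r"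
  shows "wasserstein d S M N \<le> ennreal r"
proof (rule ennreal_le_epsilon)
  fix e :: real assume "0 < e"
  have r0: "0 \<le> r" using dual[of "\<lambda>_. 0"] S by (simp add: cube_lipschitz_def sup_dist_nonneg)
  \<comment> \<open>Quantization is paid for twice, by \<epsilon> in the dual problem on the grid
    and by \<epsilon> when the plan is moved back to the points. Hence the mesh must be below
    \<open>e / 2\<close>.\<close>
  obtain \<eta> where \<eta>: "(1 / 2 :: real) ^ \<eta> < e / 2"
    using real_arch_pow_inv[of "e / 2" "1 / 2"] \<open>0 < e\<close> by auto
  define \<epsilon> :: real where "\<epsilon> = (1 / 2) ^ \<eta>"
  define A where "A = grid d \<eta> S"
  let ?q = "cell_midpoint d \<eta> S"
  let ?p = "cell_prob d \<eta> S M" and ?r = "cell_prob d \<eta> S N"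
  have A: "finite A" "A \<subseteq> space (cube d S)" "\<And>x. x \<in> space (cube d S) \<Longrightarrow> ?q x \<in> A"
    using S by (simp_all add: A_def finite_grid grid_subset_space cell_midpoint_grid)
  obtain x0 where x0: "x0 \<in> space (cube d S)" using space_cube_nonempty by blast
  have An: "A \<noteq> {}" using A(3)[OF x0] by blast
  have dual': "(\<Sum>a\<in>A. ?p a * \<phi> a) + (\<Sum>b\<in>A. ?r b * \<psi> b) \<le> r + \<epsilon>"
    if le: "\<And>a b. a \<in> A \<Longrightarrow> b \<in> A \<Longrightarrow> \<phi> a + \<psi> b \<le> sup_dist d S a b" for \<phi> \<psi> :: "_ \<Rightarrow> real"
  proof -
    \<comment> \<open>On the grid \<open>F\<close> dominates \<phi> and is at most
      \<open>- \<psi>\<close>, so that replacing the pair of potentials by \<open>F\<close> can only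
      increase the dual value.\<close>
    define F where "F x = Min ((\<lambda>b. sup_dist d S x b - \<psi> b) ` A)" for x
    have F_le: "F x \<le> sup_dist d S x b - \<psi> b" if "b \<in> A" for x b
      unfolding F_def using A(1) that by (intro Min_le) auto
    have F_ex: "\<exists>b\<in>A. F x = sup_dist d S x b - \<psi> b" for x
      using Min_in[of "(\<lambda>b. sup_dist d S x b - \<psi> b) ` A"] A(1) An unfolding F_def by blast
    have F1: "F x - F y \<le> sup_dist d S x y" for x y
    proof -
      obtain b where b: "b \<in> A" "F y = sup_dist d S y b - \<psi> b" using F_ex by blast
      then show ?thesis using F_le[OF b(1), of x] sup_dist_triangle[OF S, of d x b y] by linarith
    qed
    have "F \<in> borel_measurable (cube d S)"
      unfolding F_def using A(1) sup_dist_measurable[OF S]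
      by (intro borel_measurable_Min borel_measurable_diff) auto
    then have F: "cube_lipschitz d S 1 F"
      unfolding cube_lipschitz_def using F1 sup_dist_commute by (fastforce simp: abs_le_iff)
    have "\<phi> a \<le> F a" if "a \<in> A" for a
      using F_ex[of a] le[OF that] by force
    then have "(\<Sum>a\<in>A. ?p a * \<phi> a) \<le> (\<Sum>a\<in>A. F a * ?p a)"
      by (intro sum_mono) (subst mult.commute, rule mult_right_mono, auto simp: cell_prob_def)
    also have "\<dots> = (\<integral>x. F (?q x) \<partial>M)"
      unfolding A_def by (rule integral_cell_midpoint(1)[OF S M, symmetric])
    also have "\<dots> \<le> integral\<^sup>L M F + \<epsilon> / 2"
      using integral_diff_cell_midpoint[OF S M F zero_le_one, of \<eta>] unfolding \<epsilon>_def by linarith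
    finally have 1: "(\<Sum>a\<in>A. ?p a * \<phi> a) \<le> integral\<^sup>L M F + \<epsilon> / 2" .
    have "\<psi> b \<le> - F b" if "b \<in> A" for b
      using F_le[OF that, of b] S by simp
    then have "(\<Sum>b\<in>A. ?r b * \<psi> b) \<le> (\<Sum>b\<in>A. - F b * ?r b)"
      by (intro sum_mono) (subst mult.commute, rule mult_right_mono, auto simp: cell_prob_def)
    also have "\<dots> = - (\<integral>x. F (?q x) \<partial>N)"
      unfolding A_def integral_cell_midpoint(1)[OF S N] by (simp add: sum_negf)
    also have "\<dots> \<le> - integral\<^sup>L N F + \<epsilon> / 2"
      using integral_diff_cell_midpoint[OF S N F zero_le_one, of \<eta>] unfolding \<epsilon>_def by linarith
    finally have 2: "(\<Sum>b\<in>A. ?r b * \<psi> b) \<le> - integral\<^sup>L N F + \<epsilon> / 2" .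
    show ?thesis using 1 2 dual[OF F] by simp
  qed
  obtain \<pi> where \<pi>: "\<And>a b. a \<in> A \<Longrightarrow> b \<in> A \<Longrightarrow> 0 \<le> \<pi> (a, b)"
    "\<And>a. a \<in> A \<Longrightarrow> (\<Sum>b\<in>A. \<pi> (a, b)) = ?p a"
    "\<And>b. b \<in> A \<Longrightarrow> (\<Sum>a\<in>A. \<pi> (a, b)) = ?r b"
    "(\<Sum>a\<in>A. \<Sum>b\<in>A. \<pi> (a, b) * sup_dist d S a b) \<le> r + \<epsilon>"
  proof (rule finite_kantorovich[OF A(1) A(1) sup_dist_nonneg[OF S] _ _ dual'])
    show "(\<Sum>a\<in>A. ?p a) = 1" "(\<Sum>b\<in>A. ?r b) = 1"
      unfolding A_def by (rule sum_cell_prob[OF S M], rule sum_cell_prob[OF S N])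
  qed (assumption | rule that)+
  interpret M: prob_space M using M by (rule prob_algebraD)
  interpret N: prob_space N using N by (rule prob_algebraD)
  have spM: "space M = space (cube d S)" "space N = space (cube d S)"
    "sets M = sets (cube d S)" "sets N = sets (cube d S)"
    using M N by (simp_all add: prob_algebraD)
  obtain Q where Q: "Q \<in> couplings M N"
    and cost: "\<And>g :: (nat \<times> nat \<Rightarrow> real) \<Rightarrow> (nat \<times> nat \<Rightarrow> real) \<Rightarrow> real. (\<And>a b. 0 \<le> g a b) \<Longrightarrow>
      (\<integral>\<^sup>+(x, y). ennreal (g (?q x) (?q y)) \<partial>Q) = ennreal (\<Sum>a\<in>A. \<Sum>b\<in>A. \<pi> (a, b) * g a b)"
  proof (rule lift_coupling[of M N A A ?q ?q \<pi>])
    show "prob_space M" "prob_space N" "finite A" "finite A" by (fact A M.prob_space_axioms N.prob_space_axioms)+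
    show "{x \<in> space M. ?q x = a} \<in> sets M" "{x \<in> space N. ?q x = a} \<in> sets N" for a
      unfolding spM by (rule cell_midpoint_eq_sets[OF S])+
    show "(\<Sum>b\<in>A. \<pi> (a, b)) = measure M {x \<in> space M. ?q x = a}" if "a \<in> A" for a
      using \<pi>(2)[OF that] by (simp add: spM cell_prob_def)
    show "(\<Sum>a\<in>A. \<pi> (a, b)) = measure N {x \<in> space N. ?q x = b}" if "b \<in> A" for b
      using \<pi>(3)[OF that] by (simp add: spM cell_prob_def)
  qed (use A \<pi>(1) in \<open>auto simp: spM\<close>)
  have spQ: "space Q = space (cube d S) \<times> space (cube d S)"
    using Q sets_eq_imp_space_eq[of Q "M \<Otimes>\<^sub>M N"] by (auto simp: couplings_def space_pair_measure spM)
  have "wasserstein d S M N \<le> (\<integral>\<^sup>+(x, y). ennreal (sup_dist d S x y) \<partial>Q)"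
    unfolding wasserstein_def using Q by (rule INF_lower)
  also have "\<dots> \<le> (\<integral>\<^sup>+(x, y). ennreal (sup_dist d S (?q x) (?q y) + \<epsilon>) \<partial>Q)"
  proof (intro nn_integral_mono, clarify, rule ennreal_leI)
    fix x y assume "(x, y) \<in> space Q"
    then have xy: "x \<in> space (cube d S)" "y \<in> space (cube d S)" by (auto simp: spQ)
    have "sup_dist d S x y \<le> sup_dist d S x (?q x) + (sup_dist d S (?q x) (?q y) + sup_dist d S (?q y) y)"
      using sup_dist_triangle[OF S, of d x y "?q x"] sup_dist_triangle[OF S, of d "?q x" y "?q y"] by linarith
    then show "sup_dist d S x y \<le> sup_dist d S (?q x) (?q y) + \<epsilon>"
      using sup_dist_cell_midpoint[OF S xy(1), of \<eta>] sup_dist_cell_midpoint[OF S xy(2), of \<eta>]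
      by (simp add: sup_dist_commute[of d S "?q y" y] \<epsilon>_def)
  qed
  also have "\<dots> = ennreal (\<Sum>a\<in>A. \<Sum>b\<in>A. \<pi> (a, b) * (sup_dist d S a b + \<epsilon>))"
    by (rule cost) (simp add: \<epsilon>_def sup_dist_nonneg[OF S])
  also have "(\<Sum>a\<in>A. \<Sum>b\<in>A. \<pi> (a, b) * (sup_dist d S a b + \<epsilon>)) =
      (\<Sum>a\<in>A. \<Sum>b\<in>A. \<pi> (a, b) * sup_dist d S a b) + (\<Sum>a\<in>A. \<Sum>b\<in>A. \<pi> (a, b)) * \<epsilon>"
    by (simp add: distrib_left sum.distrib sum_distrib_right)
  also have "(\<Sum>a\<in>A. \<Sum>b\<in>A. \<pi> (a, b)) = 1"
    using \<pi>(2) sum_cell_prob[OF S M, of \<eta>] by (simp add: A_def)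
  also have "ennreal ((\<Sum>a\<in>A. \<Sum>b\<in>A. \<pi> (a, b) * sup_dist d S a b) + 1 * \<epsilon>) \<le> ennreal (r + e)"
    using \<pi>(4) \<eta> by (intro ennreal_leI) (simp add: \<epsilon>_def)
  finally show "wasserstein d S M N \<le> ennreal r + ennreal e"
    using r0 \<open>0 < e\<close> by simp
qed

text \<open>Chaining: \<open>f\<close> is telescoped along the dyadic quantizers, and the increment at level \<open>j\<close> is a
  function of the level \<open>j\<close> quantizer that is bounded by \<open>\<Lambda> 2^-j\<close>.\<close>

lemma integral_diff_le_chaining:
  assumes S: "finite S" and M: "M \<in> cube_probs d S" and N: "N \<in> cube_probs d S"
    and f: "cube_lipschitz d S \<Lambda> f" and \<Lambda>: "0 \<le> \<Lambda>"
  shows "integral\<^sup>L M f - integral\<^sup>L N f \<le>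
    \<Lambda> * ((1 / 2) ^ J + (\<Sum>j=1..J. (1 / 2) ^ j * (\<Sum>b\<in>grid d j S. \<bar>cell_prob d j S M b - cell_prob d j S N b\<bar>)))"
proof -
  have "(\<integral>x. f (cell_midpoint d J S x) \<partial>M) - (\<integral>x. f (cell_midpoint d J S x) \<partial>N) \<le>
    \<Lambda> * (\<Sum>j=1..J. (1 / 2) ^ j * (\<Sum>b\<in>grid d j S. \<bar>cell_prob d j S M b - cell_prob d j S N b\<bar>))"
  proof (induction J)
    case 0
    have "(\<integral>x. f (cell_midpoint d 0 S x) \<partial>P) = f (\<lambda>j\<in>coords d S. 1 / 2)"
      if P: "P \<in> cube_probs d S" for P
    proof -
      interpret prob_space P using P by (rule prob_algebraD)
      have "(\<integral>x. f (cell_midpoint d 0 S x) \<partial>P) = (\<integral>x. f (\<lambda>j\<in>coords d S. 1 / 2) \<partial>P)"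
        by (rule Bochner_Integration.integral_cong) (simp_all add: prob_algebraD[OF P] cell_midpoint_0)
      then show ?thesis by (simp add: prob_space)
    qed
    then show ?case using M N by simp
  next
    case (Suc J)
    let ?D = "\<lambda>b. cell_prob d (Suc J) S M b - cell_prob d (Suc J) S N b"
    \<comment> \<open>By nestedness the increment between two levels is a function of the finer
      label; its size is controlled by half the side of the coarser cell.\<close>
    define h where "h b = f b - f (cell_midpoint d J S b)" for b
    have hb: "\<bar>h b\<bar> \<le> \<Lambda> * (1 / 2) ^ Suc J" if "b \<in> space (cube d S)" for b
    proof -
      have "\<bar>h b\<bar> \<le> \<Lambda> * sup_dist d S b (cell_midpoint d J S b)"
        unfolding h_def by (intro cube_lipschitzD(2)[OF f] that cell_midpoint_space)
      also have "\<dots> \<le> \<Lambda> * (1 / 2) ^ Suc J"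
        using sup_dist_cell_midpoint[OF S that, of J] \<Lambda> by (intro mult_left_mono) auto
      finally show ?thesis .
    qed
    have step: "(\<integral>x. f (cell_midpoint d (Suc J) S x) \<partial>P) =
      (\<integral>x. f (cell_midpoint d J S x) \<partial>P) + (\<Sum>b\<in>grid d (Suc J) S. h b * cell_prob d (Suc J) S P b)"
      if P: "P \<in> cube_probs d S" for P
    proof -
      have "(\<integral>x. h (cell_midpoint d (Suc J) S x) \<partial>P) =
          (\<integral>x. f (cell_midpoint d (Suc J) S x) - f (cell_midpoint d J S x) \<partial>P)"
        by (rule Bochner_Integration.integral_cong) (simp_all add: prob_algebraD[OF P] h_def cell_midpoint_Suc)
      also have "\<dots> = (\<integral>x. f (cell_midpoint d (Suc J) S x) \<partial>P) - (\<integral>x. f (cell_midpoint d J S x) \<partial>P)"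
        by (intro Bochner_Integration.integral_diff integral_cell_midpoint(2)[OF S P])
      finally show ?thesis unfolding integral_cell_midpoint(1)[OF S P, of h] by simp
    qed
    have "(\<Sum>b\<in>grid d (Suc J) S. h b * cell_prob d (Suc J) S M b) - (\<Sum>b\<in>grid d (Suc J) S. h b * cell_prob d (Suc J) S N b)
      = (\<Sum>b\<in>grid d (Suc J) S. h b * ?D b)"
      by (simp add: sum_subtractf right_diff_distrib)
    also have "\<dots> \<le> (\<Sum>b\<in>grid d (Suc J) S. (\<Lambda> * (1 / 2) ^ Suc J) * \<bar>?D b\<bar>)"
    proof (rule sum_mono)
      fix b assume "b \<in> grid d (Suc J) S"
      then have "\<bar>h b\<bar> \<le> \<Lambda> * (1 / 2) ^ Suc J" using grid_subset_space hb by blast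
      then have "\<bar>h b\<bar> * \<bar>?D b\<bar> \<le>
          (\<Lambda> * (1 / 2) ^ Suc J) * \<bar>?D b\<bar>"
        by (rule mult_right_mono) simp
      then show "h b * ?D b \<le>
          (\<Lambda> * (1 / 2) ^ Suc J) * \<bar>?D b\<bar>"
        unfolding abs_mult[symmetric] by linarith
    qed
    also have "\<dots> = \<Lambda> * ((1 / 2) ^ Suc J * (\<Sum>b\<in>grid d (Suc J) S. \<bar>?D b\<bar>))"
      by (simp only: sum_distrib_left[symmetric] mult.assoc)
    finally show ?case
      unfolding step[OF M] step[OF N] sum.cl_ivl_Suc
      using Suc by (simp only: distrib_left le_add1 One_nat_def if_False not_less Suc_le_mono le0 split: if_split) linarith
  qed
  \<comment> \<open>Stopping at level \<open>J\<close> costs half a side length for each of the two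
    laws, together \<open>(1 / 2) ^ J\<close>, times the Lipschitz constant.\<close>
  moreover have "integral\<^sup>L M f \<le> (\<integral>x. f (cell_midpoint d J S x) \<partial>M) + \<Lambda> * ((1 / 2) ^ J / 2)"
    using integral_diff_cell_midpoint[OF S M f \<Lambda>, of J] by linarith
  moreover have "integral\<^sup>L N f \<ge> (\<integral>x. f (cell_midpoint d J S x) \<partial>N) - \<Lambda> * ((1 / 2) ^ J / 2)"
    using integral_diff_cell_midpoint[OF S N f \<Lambda>, of J] by linarith
  ultimately show ?thesis by (simp add: distrib_left)
qed

section \<open>Smoothed kernels\<close>

lemma cell_cell_midpoint:
  "x \<in> space (cube d S) \<Longrightarrow> cell d \<eta> S (cell_midpoint d \<eta> S x) = cell d \<eta> S x"
  by (simp add: cell_eq cell_midpoint_space cell_midpoint_idem)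

lemma cell_cond_cell_midpoint:
  "x \<in> space (cube d S) \<Longrightarrow> cell_cond d \<eta> \<nu> S (cell_midpoint d \<eta> S x) = cell_cond d \<eta> \<nu> S x"
  by (simp add: cell_cond_def cell_cell_midpoint cell_midpoint_idem)

lemma marginal_prob:
  assumes "\<nu> \<in> cube_probs d T" "S \<subseteq> T"
  shows "marginal d S \<nu> \<in> cube_probs d S"
proof -
  interpret prob_space \<nu> using assms(1) by (rule prob_algebraD)
  have "proj d S \<in> \<nu> \<rightarrow>\<^sub>M cube d S"
    using proj_measurable[OF assms(2)] by (simp cong: measurable_cong_sets add: prob_algebraD[OF assms(1)])
  then show ?thesis by (simp add: space_prob_algebra marginal_def prob_space_distr)
qed

lemma emeasure_marginal:
  assumes "\<nu> \<in> cube_probs d T" "S \<subseteq> T" "A \<in> sets (cube d S)"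
  shows "emeasure (marginal d S \<nu>) A = emeasure \<nu> {x \<in> space (cube d T). proj d S x \<in> A}"
proof -
  have "proj d S \<in> \<nu> \<rightarrow>\<^sub>M cube d S"
    using proj_measurable[OF assms(2)] by (simp cong: measurable_cong_sets add: prob_algebraD[OF assms(1)])
  then have "emeasure (marginal d S \<nu>) A = emeasure \<nu> (proj d S -` A \<inter> space \<nu>)"
    unfolding marginal_def using assms(3) by (simp add: emeasure_distr)
  also have "proj d S -` A \<inter> space \<nu> = {x \<in> space (cube d T). proj d S x \<in> A}"
    by (auto simp: prob_algebraD[OF assms(1)])
  finally show ?thesis .
qed

lemma cell_cond_prob:
  assumes \<nu>: "\<nu> \<in> cube_probs d T" and "S \<subseteq> T" "finite S" "x \<in> space (cube d S)"
  shows "cell_cond d \<eta> \<nu> S x \<in> cube_probs d S"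
proof -
  note m = marginal_prob[OF \<nu> assms(2)]
  interpret prob_space "marginal d S \<nu>" using m by (rule prob_algebraD)
  show ?thesis
    using cell_midpoint_space[OF assms(4), of \<eta>] prob_space_uniform_measure[of "marginal d S \<nu>" "cell d \<eta> S x"] emeasure_finite
    by (auto simp: cell_cond_def space_prob_algebra prob_space_return prob_algebraD(2)[OF m])
qed

text \<open>Both branches of \<open>cell_cond\<close> are carried by the cell: in the null case the
  Dirac mass sits at its midpoint.\<close>

lemma AE_cell_cond:
  assumes \<nu>: "\<nu> \<in> cube_probs d T" and "S \<subseteq> T" "finite S" "x \<in> space (cube d S)"
  shows "AE x' in cell_cond d \<eta> \<nu> S x. x' \<in> space (cube d S) \<and> cell_midpoint d \<eta> S x' = cell_midpoint d \<eta> S x"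
proof (cases "emeasure (marginal d S \<nu>) (cell d \<eta> S x) = 0")
  case True
  have "{x' \<in> space (cube d S). cell_midpoint d \<eta> S x' = cell_midpoint d \<eta> S x} \<in> sets (cube d S)"
    by (rule cell_midpoint_eq_sets[OF assms(3)])
  then have "AE x' in return (cube d S) (cell_midpoint d \<eta> S x).
      x' \<in> space (cube d S) \<and> cell_midpoint d \<eta> S x' = cell_midpoint d \<eta> S x"
    by (subst AE_return) (simp_all add: pred_def cell_midpoint_space assms(4) cell_midpoint_idem)
  moreover have "cell_cond d \<eta> \<nu> S x = return (cube d S) (cell_midpoint d \<eta> S x)"
    using True by (simp add: cell_cond_def)
  ultimately show ?thesis by (simp only:)
next
  case False
  have "cell d \<eta> S x \<in> sets (marginal d S \<nu>)"
    using cell_sets[OF assms(3,4)] prob_algebraD(2)[OF marginal_prob[OF \<nu> assms(2)]] by simp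
  from AE_uniform_measureI[OF this, of "\<lambda>y. y \<in> cell d \<eta> S x"] False
  have "AE y in uniform_measure (marginal d S \<nu>) (cell d \<eta> S x). y \<in> cell d \<eta> S x" by simp
  moreover have "cell_cond d \<eta> \<nu> S x = uniform_measure (marginal d S \<nu>) (cell d \<eta> S x)"
    using False by (simp add: cell_cond_def)
  ultimately have "AE y in cell_cond d \<eta> \<nu> S x. y \<in> cell d \<eta> S x" by (simp only:)
  then show ?thesis by eventually_elim (simp add: cell_eq[OF assms(4)])
qed

text \<open>A function that is constant on cells factors through the quantizer, and every map on the
  discrete space of labels is measurable. The value at \<open>x0\<close> only fills in labels
  outside the cube. Smoothed kernels get their measurability from here.\<close>

lemma cell_constant_measurable:
  assumes "finite S" and s: "\<And>x. x \<in> space (cube d S) \<Longrightarrow> s x \<in> space N"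
    and const: "\<And>x. x \<in> space (cube d S) \<Longrightarrow> s (cell_midpoint d \<eta> S x) = s x"
  shows "s \<in> cube d S \<rightarrow>\<^sub>M N"
proof -
  obtain x0 where x0: "x0 \<in> space (cube d S)" using space_cube_nonempty by blast
  have "(\<lambda>c. if c \<in> space (cube d S) then s c else s x0) \<in> count_space UNIV \<rightarrow>\<^sub>M N"
    using s x0 by auto
  from measurable_compose[OF cell_midpoint_measurable_count[OF assms(1), of d \<eta>] this]
  show ?thesis
    by (rule measurable_cong[THEN iffD1, rotated]) (simp add: cell_midpoint_space const)
qed

lemma bind_prob_algebra:
  "A \<in> space (prob_algebra M) \<Longrightarrow> B \<in> M \<rightarrow>\<^sub>M prob_algebra N \<Longrightarrow> A \<bind> B \<in> space (prob_algebra N)"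
  using prob_space_bind'[of A M B N] sets_bind'[of A M B N] by (simp add: space_prob_algebra)

text \<open>For every version \<kappa> the kernel averaged over a cell is an elementary conditional
  probability. In multiplied form the identity also covers null cells. It is used for \<mu>, where
  it centres the fluctuations, and for the empirical measure; the level \<open>j\<close> of the
  child is free because chaining runs through all scales.\<close>

lemma cell_cond_bind_cell_prob:
  assumes \<nu>: "\<nu> \<in> cube_probs d T" and S: "S \<subseteq> T" "finite S" and k: "k \<in> T" and c: "c \<in> grid d \<eta> S"
    and \<kappa>: "is_rcd d \<nu> S k \<kappa>"
  shows "measure \<nu> {x \<in> space (cube d T). cell_midpoint d \<eta> S x = c \<and> cell_midpoint d j {k} x = b} =
    measure \<nu> {x \<in> space (cube d T). cell_midpoint d \<eta> S x = c} * cell_prob d j {k} (cell_cond d \<eta> \<nu> S c \<bind> \<kappa>) b"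
proof -
  let ?C = "{x \<in> space (cube d T). cell_midpoint d \<eta> S x = c}"
  let ?CB = "{x \<in> space (cube d T). cell_midpoint d \<eta> S x = c \<and> cell_midpoint d j {k} x = b}"
  interpret prob_space \<nu> using \<nu> by (rule prob_algebraD)
  have cS: "c \<in> space (cube d S)" using c grid_subset_space by blast
  define B where "B = {y \<in> space (cube d {k}). cell_midpoint d j {k} y = b}"
  have B: "B \<in> sets (cube d {k})" unfolding B_def by (rule cell_midpoint_eq_sets) simp
  have C: "cell d \<eta> S c \<in> sets (cube d S)" by (rule cell_sets[OF S(2) cS])
  have inC: "proj d S x \<in> cell d \<eta> S c \<longleftrightarrow> cell_midpoint d \<eta> S x = c" if "x \<in> space (cube d T)" for x
    using proj_space[OF S(1) that]
    by (simp add: cell_eq[OF cS] cell_midpoint_of_grid[OF c] cell_midpoint_proj proj_def restrict_def)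
      (simp add: cell_midpoint_eq restrict_def cong: if_cong)
  have inB: "proj d {k} x \<in> B \<longleftrightarrow> cell_midpoint d j {k} x = b" if "x \<in> space (cube d T)" for x
    using proj_space[OF _ that, of "{k}"] k cell_midpoint_proj[of "{k}" "{k}" d j x] by (simp add: B_def)
  have \<kappa>m: "\<kappa> \<in> cube d S \<rightarrow>\<^sub>M prob_algebra (cube d {k})" using \<kappa> by (simp add: is_rcd_def)
  define m where "m = marginal d S \<nu>"
  have m: "m \<in> cube_probs d S" unfolding m_def by (rule marginal_prob[OF \<nu> S(1)])
  interpret m: prob_space m using m by (rule prob_algebraD)
  have mC: "emeasure m (cell d \<eta> S c) = emeasure \<nu> ?C"
    unfolding m_def emeasure_marginal[OF \<nu> S(1) C] using inC by (intro arg_cong[where f = "emeasure \<nu>"]) auto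
  have "{x \<in> space \<nu>. proj d S x \<in> cell d \<eta> S c \<and> proj d {k} x \<in> B} =
      ?CB"
    unfolding prob_algebraD(3)[OF \<nu>] using inC inB by blast
  moreover have "emeasure \<nu> {x \<in> space \<nu>. proj d S x \<in> cell d \<eta> S c \<and> proj d {k} x \<in> B} =
      (\<integral>\<^sup>+x\<in>cell d \<eta> S c. emeasure (\<kappa> x) B \<partial>marginal d S \<nu>)"
    using \<kappa> C B unfolding is_rcd_def by blast
  ultimately have joint: "emeasure \<nu> ?CB =
      (\<integral>\<^sup>+x\<in>cell d \<eta> S c. emeasure (\<kappa> x) B \<partial>m)"
    by (simp only: m_def)
  show ?thesis
  proof (cases "emeasure m (cell d \<eta> S c) = 0")
    case True
    then have z: "emeasure \<nu> ?C = 0" by (simp add: mC)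
    have n: "?C \<in> sets \<nu>"
    proof -
      have "?C = proj d S -` cell d \<eta> S c \<inter> space (cube d T)"
        using inC by auto
      then show ?thesis using measurable_sets[OF proj_measurable[OF S(1)] C] by (simp add: prob_algebraD[OF \<nu>])
    qed
    have "emeasure \<nu> ?CB = 0"
      by (rule emeasure_eq_0[OF n z]) auto
    then show ?thesis using True mC by (simp add: measure_def)
  next
    case False
    define p where "p = measure \<nu> ?C"
    have ep: "emeasure m (cell d \<eta> S c) = ennreal p" by (simp add: mC p_def emeasure_eq_measure)
    have p: "p > 0" using False ep by (simp add: zero_less_measure_iff p_def emeasure_eq_measure mC less_le)
    have cc: "cell_cond d \<eta> \<nu> S c = uniform_measure m (cell d \<eta> S c)"
      using False by (simp add: cell_cond_def m_def)
    note ccp = cell_cond_prob[OF \<nu> S cS, of \<eta>]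
    have em: "(\<lambda>x. emeasure (\<kappa> x) B) \<in> borel_measurable m"
      using measurable_emeasure_kernel[OF measurable_prob_algebraD[OF \<kappa>m] B]
      by (simp cong: measurable_cong_sets add: prob_algebraD[OF m])
    have bp: "cell_cond d \<eta> \<nu> S c \<bind> \<kappa> \<in> cube_probs d {k}"
      by (rule bind_prob_algebra[OF ccp \<kappa>m])
    interpret b: prob_space "cell_cond d \<eta> \<nu> S c \<bind> \<kappa>" using bp by (rule prob_algebraD)
    have "emeasure (cell_cond d \<eta> \<nu> S c \<bind> \<kappa>) B = (\<integral>\<^sup>+x. emeasure (\<kappa> x) B \<partial>uniform_measure m (cell d \<eta> S c))"
      using emeasure_bind_prob_algebra[OF ccp \<kappa>m B] by (simp only: cc)
    also have "\<dots> = (\<integral>\<^sup>+x\<in>cell d \<eta> S c. emeasure (\<kappa> x) B \<partial>m) / ennreal p"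
      unfolding ep[symmetric] using C em by (intro nn_integral_uniform_measure) (simp_all add: prob_algebraD[OF m])
    finally have "ennreal (cell_prob d j {k} (cell_cond d \<eta> \<nu> S c \<bind> \<kappa>) b) =
      ennreal (measure \<nu> ?CB) / ennreal p"
      unfolding joint[symmetric] by (simp add: cell_prob_def B_def emeasure_eq_measure b.emeasure_eq_measure)
    also have "\<dots> = ennreal (measure \<nu> ?CB / p)"
      using p by (simp add: divide_ennreal)
    finally have "cell_prob d j {k} (cell_cond d \<eta> \<nu> S c \<bind> \<kappa>) b =
      measure \<nu> ?CB / p"
      using p by (subst (asm) ennreal_inj) (auto simp: cell_prob_def)
    then show ?thesis using p unfolding p_def[symmetric] by simp
  qed
qed

lemma integral_le_bound_prob:
  fixes f :: "'b \<Rightarrow> real"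
  assumes M: "M \<in> space (prob_algebra B)"
    and f: "f \<in> borel_measurable B" "\<And>y. y \<in> space B \<Longrightarrow> \<bar>f y\<bar> \<le> C"
  shows "\<bar>integral\<^sup>L M f\<bar> \<le> C"
proof -
  interpret prob_space M using M by (rule prob_algebraD)
  have int: "integrable M f" by (rule integrable_bounded_prob[OF M f])
  have "\<bar>integral\<^sup>L M f\<bar> \<le> (\<integral>x. \<bar>f x\<bar> \<partial>M)" by (rule integral_abs_bound)
  also have "\<dots> \<le> (\<integral>x. C \<partial>M)"
    using int f(2) by (intro integral_mono) (auto simp: prob_algebraD(3)[OF M])
  finally show ?thesis by (simp add: prob_space)
qed

lemma integral_bind_prob:
  fixes f :: "'b \<Rightarrow> real"
  assumes M: "M \<in> space (prob_algebra A)" and \<kappa>: "\<kappa> \<in> A \<rightarrow>\<^sub>M prob_algebra B"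
    and f: "f \<in> borel_measurable B" "\<And>y. y \<in> space B \<Longrightarrow> \<bar>f y\<bar> \<le> C"
  shows "integral\<^sup>L (M \<bind> \<kappa>) f = (\<integral>x. integral\<^sup>L (\<kappa> x) f \<partial>M)"
    and "(\<lambda>x. integral\<^sup>L (\<kappa> x) f) \<in> borel_measurable A"
proof -
  interpret prob_space M using M by (rule prob_algebraD)
  have \<kappa>': "\<kappa> \<in> M \<rightarrow>\<^sub>M subprob_algebra B"
    using measurable_prob_algebraD[OF \<kappa>] by (simp cong: measurable_cong_sets add: prob_algebraD[OF M])
  show "integral\<^sup>L (M \<bind> \<kappa>) f = (\<integral>x. integral\<^sup>L (\<kappa> x) f \<partial>M)"
  proof (rule integral_bind[where K = B and B = C and B' = 1])
    show "finite_measure M" by unfold_locales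
    show "AE x in M. emeasure (\<kappa> x) (space (\<kappa> x)) \<le> ennreal 1"
      using subprob_space.emeasure_space_le_1[OF subprob_space_kernel[OF \<kappa>']] by simp
  qed (use f \<kappa>' in auto)
  show "(\<lambda>x. integral\<^sup>L (\<kappa> x) f) \<in> borel_measurable A"
    using measurable_prob_algebraD[OF \<kappa>] integral_measurable_subprob_algebra[OF f(1)]
    by (rule measurable_compose)
qed

text \<open>Two points of one cell are at most \<open>(1 / 2) ^ \<eta>\<close> apart, half of it
  from each to the common midpoint. This is the bias of smoothing a Lipschitz kernel.\<close>

lemma integral_cell_cond_bind:
  assumes \<nu>: "\<nu> \<in> cube_probs d T" and S: "S \<subseteq> T" "finite S" and x: "x \<in> space (cube d S)"
    and \<kappa>: "\<kappa> \<in> cube d S \<rightarrow>\<^sub>M prob_algebra (cube d {k})"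
    and lip: "\<And>x x'. x \<in> space (cube d S) \<Longrightarrow> x' \<in> space (cube d S) \<Longrightarrow>
       \<bar>integral\<^sup>L (\<kappa> x) f - integral\<^sup>L (\<kappa> x') f\<bar> \<le> l * sup_dist d S x x'"
    and l: "0 \<le> l" and f: "f \<in> borel_measurable (cube d {k})" "\<And>y. y \<in> space (cube d {k}) \<Longrightarrow> \<bar>f y\<bar> \<le> C"
  shows "\<bar>integral\<^sup>L (\<kappa> x) f - integral\<^sup>L (cell_cond d \<eta> \<nu> S x \<bind> \<kappa>) f\<bar> \<le> l * (1 / 2) ^ \<eta>"
proof -
  note cc = cell_cond_prob[OF \<nu> S x, of \<eta>]
  interpret prob_space "cell_cond d \<eta> \<nu> S x" using cc by (rule prob_algebraD)
  have int: "integrable (cell_cond d \<eta> \<nu> S x) (\<lambda>x. integral\<^sup>L (\<kappa> x) f)"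
  proof (rule integrable_bounded_prob[OF cc])
    show "(\<lambda>x. integral\<^sup>L (\<kappa> x) f) \<in> borel_measurable (cube d S)"
      by (rule integral_bind_prob(2)[OF cc \<kappa> f])
    show "\<bar>integral\<^sup>L (\<kappa> x) f\<bar> \<le> C" if "x \<in> space (cube d S)" for x
      using integral_le_bound_prob[OF measurable_space[OF \<kappa> that] f] .
  qed
  have "integral\<^sup>L (\<kappa> x) f - integral\<^sup>L (cell_cond d \<eta> \<nu> S x \<bind> \<kappa>) f =
      (\<integral>x'. integral\<^sup>L (\<kappa> x) f - integral\<^sup>L (\<kappa> x') f \<partial>cell_cond d \<eta> \<nu> S x)"
    using int by (simp add: integral_bind_prob(1)[OF cc \<kappa> f] prob_space)
  moreover have "\<bar>\<integral>x'. integral\<^sup>L (\<kappa> x) f - integral\<^sup>L (\<kappa> x') f \<partial>cell_cond d \<eta> \<nu> S x\<bar> \<le>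
      (\<integral>x'. \<bar>integral\<^sup>L (\<kappa> x) f - integral\<^sup>L (\<kappa> x') f\<bar> \<partial>cell_cond d \<eta> \<nu> S x)"
    by (rule integral_abs_bound)
  moreover have "\<dots> \<le> (\<integral>x'. l * (1 / 2) ^ \<eta> \<partial>cell_cond d \<eta> \<nu> S x)"
  proof (rule integral_mono_AE)
    show "AE x' in cell_cond d \<eta> \<nu> S x. \<bar>integral\<^sup>L (\<kappa> x) f - integral\<^sup>L (\<kappa> x') f\<bar> \<le> l * (1 / 2) ^ \<eta>"
      using AE_cell_cond[OF \<nu> S x, of \<eta>]
    proof eventually_elim
      case (elim x')
      have "sup_dist d S x x' \<le> sup_dist d S x (cell_midpoint d \<eta> S x) + sup_dist d S (cell_midpoint d \<eta> S x') x'"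
        using elim sup_dist_triangle[OF S(2), of d x x' "cell_midpoint d \<eta> S x"] by simp
      also have "\<dots> \<le> (1 / 2) ^ \<eta>"
        using sup_dist_cell_midpoint[OF S(2) x, of \<eta>] sup_dist_cell_midpoint[OF S(2), of x' d \<eta>] elim
        by (simp add: sup_dist_commute[of d S _ x'])
      finally have "l * sup_dist d S x x' \<le> l * (1 / 2) ^ \<eta>" using l by (rule mult_left_mono)
      then show ?case using lip[OF x, of x'] elim by simp
    qed
  qed (use int in auto)
  moreover have "(\<integral>x'. l * (1 / 2) ^ \<eta> \<partial>cell_cond d \<eta> \<nu> S x) = l * (1 / 2) ^ \<eta>"
    by (simp add: prob_space)
  ultimately show ?thesis by linarith
qed

section \<open>Products of kernels\<close>

abbreviation extend ::
  "(nat \<Rightarrow> nat) \<Rightarrow> nat \<Rightarrow> (nat \<times> nat \<Rightarrow> real) \<Rightarrow> (nat \<times> nat \<Rightarrow> real) \<Rightarrow> nat \<times> nat \<Rightarrow> real" where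
  "extend d m x y \<equiv> merge (coords d {1..m}) (coords d {Suc m}) (x, y)"

definition dag_kernels where
  "dag_kernels d E \<kappa> m \<longleftrightarrow>
     (\<forall>k\<in>{1..m}. pa E k \<subseteq> {1..<k} \<and> \<kappa> k \<in> cube d (pa E k) \<rightarrow>\<^sub>M prob_algebra (cube d {k}))"

lemma coords_Suc: "coords d {1..m} \<union> coords d {Suc m} = coords d {1..Suc m}"
  by (auto simp: coords_def)

lemma extend_measurable:
  "(\<lambda>(x, y). extend d m x y) \<in> cube d {1..m} \<Otimes>\<^sub>M cube d {Suc m} \<rightarrow>\<^sub>M cube d {1..Suc m}"
proof -
  have "merge (coords d {1..m}) (coords d {Suc m}) \<in> cube d {1..m} \<Otimes>\<^sub>M cube d {Suc m} \<rightarrow>\<^sub>M cube d {1..Suc m}"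
    unfolding cube_def coords_Suc[symmetric] by (rule measurable_merge)
  moreover have "(\<lambda>(x, y). extend d m x y) = merge (coords d {1..m}) (coords d {Suc m})" by auto
  ultimately show ?thesis by simp
qed

lemma extend_space:
  "x \<in> space (cube d {1..m}) \<Longrightarrow> y \<in> space (cube d {Suc m}) \<Longrightarrow> extend d m x y \<in> space (cube d {1..Suc m})"
  using measurable_space[OF extend_measurable, of "(x, y)" d m] by (simp add: space_pair_measure)

lemma extend_old: "S \<subseteq> {1..m} \<Longrightarrow> j \<in> coords d S \<Longrightarrow> extend d m x y j = x j"
  using coords_mono[of S "{1..m}" d] by (auto simp: merge_def)

lemma extend_new: "j \<in> coords d {Suc m} \<Longrightarrow> extend d m x y j = y j"
  by (auto simp: merge_def coords_def)

lemma cell_midpoint_congI: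
  "(\<And>j. j \<in> coords d S \<Longrightarrow> x j = y j) \<Longrightarrow> cell_midpoint d \<eta> S x = cell_midpoint d \<eta> S y"
  unfolding cell_midpoint_eq by (rule restrict_ext) simp

lemma cell_midpoint_extend:
  "S \<subseteq> {1..m} \<Longrightarrow> cell_midpoint d \<eta> S (extend d m x y) = cell_midpoint d \<eta> S x"
  "cell_midpoint d \<eta> {Suc m} (extend d m x y) = cell_midpoint d \<eta> {Suc m} y"
  by (rule cell_midpoint_congI, erule (1) extend_old) (rule cell_midpoint_congI, erule extend_new)

text \<open>In the sup-norm, freezing one block of coordinates leaves the distance in the other
  block, so no constant is lost when a node is integrated out.\<close>

lemma sup_dist_extend_le:
  shows "sup_dist d {1..Suc m} (extend d m x y) (extend d m x' y) \<le> sup_dist d {1..m} x x'"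
    and "sup_dist d {1..Suc m} (extend d m x y) (extend d m x y') \<le> sup_dist d {Suc m} y y'"
proof -
  have *: "j \<in> coords d {1..m} \<or> j \<in> coords d {Suc m}" if "j \<in> coords d {1..Suc m}" for j
    using that unfolding coords_Suc[symmetric] by blast
  show "sup_dist d {1..Suc m} (extend d m x y) (extend d m x' y) \<le> sup_dist d {1..m} x x'"
    unfolding sup_dist_le_iff[OF finite_atLeastAtMost]
  proof (intro conjI ballI sup_dist_nonneg finite_atLeastAtMost)
    fix j assume "j \<in> coords d {1..Suc m}"
    from *[OF this] show "\<bar>extend d m x y j - extend d m x' y j\<bar> \<le> sup_dist d {1..m} x x'"
      using abs_le_sup_dist[OF finite_atLeastAtMost, of j d 1 m x x'] sup_dist_nonneg[OF finite_atLeastAtMost, of d 1 m x x']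
      by (auto simp only: extend_new extend_old[OF order_refl] diff_self abs_zero)
  qed
  show "sup_dist d {1..Suc m} (extend d m x y) (extend d m x y') \<le> sup_dist d {Suc m} y y'"
    unfolding sup_dist_le_iff[OF finite_atLeastAtMost]
  proof (intro conjI ballI sup_dist_nonneg finite.intros)
    fix j assume "j \<in> coords d {1..Suc m}"
    from *[OF this] show "\<bar>extend d m x y j - extend d m x y' j\<bar> \<le> sup_dist d {Suc m} y y'"
      using abs_le_sup_dist[of "{Suc m}" j d y y'] sup_dist_nonneg[of "{Suc m}" d y y']
      by (auto simp only: extend_new extend_old[OF order_refl] finite.intros diff_self abs_zero)
  qed
qed

lemma dag_kernel_step:
  assumes "dag_kernels d E \<kappa> (Suc m)"
  shows "pa E (Suc m) \<subseteq> {1..m}"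
    and "(\<lambda>x. \<kappa> (Suc m) (proj d (pa E (Suc m)) x)) \<in> cube d {1..m} \<rightarrow>\<^sub>M prob_algebra (cube d {Suc m})"
    and "(\<lambda>x. distr (\<kappa> (Suc m) (proj d (pa E (Suc m)) x)) (cube d {1..Suc m}) (extend d m x))
      \<in> cube d {1..m} \<rightarrow>\<^sub>M prob_algebra (cube d {1..Suc m})"
proof -
  show pa: "pa E (Suc m) \<subseteq> {1..m}"
    using assms unfolding dag_kernels_def by (metis atLeastLessThanSuc_atLeastAtMost atLeastAtMost_iff le_add1 order_refl plus_1_eq_Suc)
  have "\<kappa> (Suc m) \<in> cube d (pa E (Suc m)) \<rightarrow>\<^sub>M prob_algebra (cube d {Suc m})"
    using assms by (auto simp: dag_kernels_def)
  with proj_measurable[OF pa]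
  show k: "(\<lambda>x. \<kappa> (Suc m) (proj d (pa E (Suc m)) x)) \<in> cube d {1..m} \<rightarrow>\<^sub>M prob_algebra (cube d {Suc m})"
    by (rule measurable_compose)
  show "(\<lambda>x. distr (\<kappa> (Suc m) (proj d (pa E (Suc m)) x)) (cube d {1..Suc m}) (extend d m x))
      \<in> cube d {1..m} \<rightarrow>\<^sub>M prob_algebra (cube d {1..Suc m})"
    by (rule measurable_distr_prob_space2[OF k extend_measurable])
qed

lemma dag_kernels_mono: "dag_kernels d E \<kappa> m \<Longrightarrow> l \<le> m \<Longrightarrow> dag_kernels d E \<kappa> l"
  by (auto simp: dag_kernels_def)

lemma kernel_prod_prob:
  "dag_kernels d E \<kappa> m \<Longrightarrow> kernel_prod d E \<kappa> m \<in> cube_probs d {1..m}"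
proof (induction m)
  case 0
  have "(\<lambda>_. undefined) \<in> space (cube d {1..0})" by (simp add: space_cube coords_def)
  then show ?case by (simp add: space_prob_algebra prob_space_return)
next
  case (Suc m)
  have "dag_kernels d E \<kappa> m" by (rule dag_kernels_mono[OF Suc.prems]) simp
  from bind_prob_algebra[OF Suc.IH[OF this] dag_kernel_step(3)[OF Suc.prems]]
  show ?case by simp
qed

lemma integral_kernel_prod_Suc:
  fixes f :: "(nat \<times> nat \<Rightarrow> real) \<Rightarrow> real"
  assumes \<kappa>: "dag_kernels d E \<kappa> (Suc m)"
    and f: "f \<in> borel_measurable (cube d {1..Suc m})" "\<And>z. z \<in> space (cube d {1..Suc m}) \<Longrightarrow> \<bar>f z\<bar> \<le> B"
  shows "integral\<^sup>L (kernel_prod d E \<kappa> (Suc m)) f =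
    (\<integral>x. (\<integral>y. f (extend d m x y) \<partial>\<kappa> (Suc m) (proj d (pa E (Suc m)) x)) \<partial>kernel_prod d E \<kappa> m)"
proof -
  have M: "kernel_prod d E \<kappa> m \<in> cube_probs d {1..m}"
    by (rule kernel_prod_prob[OF dag_kernels_mono[OF \<kappa>]]) simp
  have "integral\<^sup>L (kernel_prod d E \<kappa> (Suc m)) f =
    (\<integral>x. (\<integral>z. f z \<partial>distr (\<kappa> (Suc m) (proj d (pa E (Suc m)) x)) (cube d {1..Suc m}) (extend d m x)) \<partial>kernel_prod d E \<kappa> m)"
    unfolding kernel_prod.simps by (rule integral_bind_prob(1)[OF M dag_kernel_step(3)[OF \<kappa>] f])
  also have "\<dots> = (\<integral>x. (\<integral>y. f (extend d m x y) \<partial>\<kappa> (Suc m) (proj d (pa E (Suc m)) x)) \<partial>kernel_prod d E \<kappa> m)"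
  proof (rule Bochner_Integration.integral_cong[OF refl])
    fix x assume "x \<in> space (kernel_prod d E \<kappa> m)"
    then have x: "x \<in> space (cube d {1..m})" by (simp add: prob_algebraD[OF M])
    note k = measurable_space[OF dag_kernel_step(2)[OF \<kappa>] x]
    have "extend d m x \<in> cube d {Suc m} \<rightarrow>\<^sub>M cube d {1..Suc m}"
      using measurable_compose[OF measurable_Pair1'[OF x] extend_measurable] by simp
    then show "(\<integral>z. f z \<partial>distr (\<kappa> (Suc m) (proj d (pa E (Suc m)) x)) (cube d {1..Suc m}) (extend d m x)) =
        (\<integral>y. f (extend d m x y) \<partial>\<kappa> (Suc m) (proj d (pa E (Suc m)) x))"
      by (intro integral_distr f) (simp cong: measurable_cong_sets add: prob_algebraD[OF k])
  qed
  finally show ?thesis .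
qed

lemma kernel_integral_measurable:
  fixes f :: "(nat \<times> nat \<Rightarrow> real) \<Rightarrow> real"
  assumes k: "k \<in> cube d {1..m} \<rightarrow>\<^sub>M prob_algebra (cube d {Suc m})"
    and f: "f \<in> borel_measurable (cube d {1..Suc m})"
  shows "(\<lambda>x. \<integral>y. f (extend d m x y) \<partial>k x) \<in> borel_measurable (cube d {1..m})"
proof -
  have "(\<lambda>x. integral\<^sup>L (distr (k x) (cube d {1..Suc m}) (extend d m x)) f) \<in> borel_measurable (cube d {1..m})"
    by (rule measurable_compose[OF measurable_prob_algebraD[OF measurable_distr_prob_space2[OF k extend_measurable]]
          integral_measurable_subprob_algebra[OF f]])
  moreover have "integral\<^sup>L (distr (k x) (cube d {1..Suc m}) (extend d m x)) f = (\<integral>y. f (extend d m x y) \<partial>k x)"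
    if x: "x \<in> space (cube d {1..m})" for x
  proof (rule integral_distr[OF _ f])
    show "extend d m x \<in> k x \<rightarrow>\<^sub>M cube d {1..Suc m}"
      using measurable_compose[OF measurable_Pair1'[OF x] extend_measurable]
      by (simp cong: measurable_cong_sets add: prob_algebraD[OF measurable_space[OF k x]])
  qed
  ultimately show ?thesis by (rule measurable_cong[THEN iffD1, rotated])
qed

text \<open>Drawing one more node leaves the earlier coordinates untouched: projected back, the last
  step is a Dirac kernel, and binding with \<open>return\<close> changes nothing.\<close>

lemma marginal_kernel_prod_Suc:
  assumes \<kappa>: "dag_kernels d E \<kappa> (Suc m)"
  shows "distr (kernel_prod d E \<kappa> (Suc m)) (cube d {1..m}) (proj d {1..m}) = kernel_prod d E \<kappa> m"
proof -
  let ?k = "\<lambda>x. \<kappa> (Suc m) (proj d (pa E (Suc m)) x)"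
  let ?J = "\<lambda>x. distr (?k x) (cube d {1..Suc m}) (extend d m x)"
  have M: "kernel_prod d E \<kappa> m \<in> cube_probs d {1..m}"
    by (rule kernel_prod_prob[OF dag_kernels_mono[OF \<kappa>]]) simp
  note pr = proj_measurable[of "{1..m}" "{1..Suc m}" d]
  have "distr (kernel_prod d E \<kappa> (Suc m)) (cube d {1..m}) (proj d {1..m}) =
    kernel_prod d E \<kappa> m \<bind> (\<lambda>x. distr (?J x) (cube d {1..m}) (proj d {1..m}))"
    unfolding kernel_prod.simps
  proof (rule distr_bind)
    show "(\<lambda>x. ?J x)
        \<in> kernel_prod d E \<kappa> m \<rightarrow>\<^sub>M subprob_algebra (cube d {1..Suc m})"
      using measurable_prob_algebraD[OF dag_kernel_step(3)[OF \<kappa>]]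
      by (simp cong: measurable_cong_sets add: prob_algebraD[OF M])
    show "space (kernel_prod d E \<kappa> m) \<noteq> {}" using space_cube_nonempty by (simp add: prob_algebraD[OF M])
  qed (rule pr, auto)
  also have "\<dots> = kernel_prod d E \<kappa> m \<bind> return (kernel_prod d E \<kappa> m)"
  proof (rule bind_cong[OF refl])
    fix x assume "x \<in> space (kernel_prod d E \<kappa> m)"
    then have x: "x \<in> space (cube d {1..m})" by (simp add: prob_algebraD[OF M])
    note k = measurable_space[OF dag_kernel_step(2)[OF \<kappa>] x]
    interpret k: prob_space "?k x" using k by (rule prob_algebraD)
    have em: "extend d m x \<in> ?k x \<rightarrow>\<^sub>M cube d {1..Suc m}"
      using measurable_compose[OF measurable_Pair1'[OF x] extend_measurable]
      by (simp cong: measurable_cong_sets add: prob_algebraD[OF k])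
    have "proj d {1..m} (extend d m x y) = x" for y
    proof -
      have "proj d {1..m} (extend d m x y) = proj d {1..m} x"
        unfolding proj_def by (rule restrict_ext) (rule extend_old[OF order_refl])
      then show ?thesis using proj_ident[OF x] by simp
    qed
    then have "distr (?J x) (cube d {1..m}) (proj d {1..m})
      = distr (?k x) (cube d {1..m}) (\<lambda>_. x)"
      using distr_distr[OF pr em] by (simp add: comp_def)
    also have "\<dots> = return (cube d {1..m}) x"
      using x by (rule k.distr_const)
    also have "\<dots> = return (kernel_prod d E \<kappa> m) x"
      by (rule return_cong[symmetric]) (simp add: prob_algebraD[OF M])
    finally show "distr (?J x) (cube d {1..m}) (proj d {1..m})
      = return (kernel_prod d E \<kappa> m) x" .
  qed
  also have "\<dots> = kernel_prod d E \<kappa> m"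
    by (rule bind_return'') (simp add: prob_algebraD[OF M])
  finally show ?thesis .
qed

text \<open>Later draws do not change the law of earlier nodes. Thus a property that holds almost
  surely under a parent marginal of \<mu> can be used under the law of the preceding nodes.\<close>

lemma marginal_kernel_prod:
  assumes "dag_kernels d E \<kappa> K" "m \<le> K" "S \<subseteq> {1..m}"
  shows "marginal d S (kernel_prod d E \<kappa> K) = marginal d S (kernel_prod d E \<kappa> m)"
  using assms(2,1)
proof (induction K rule: dec_induct)
  case (step K)
  note pr = proj_measurable[of "{1..K}" "{1..Suc K}" d]
  note P = kernel_prod_prob[OF step.prems]
  have S: "S \<subseteq> {1..K}" using assms(3) step.hyps by auto
  have "marginal d S (kernel_prod d E \<kappa> K) =
      distr (distr (kernel_prod d E \<kappa> (Suc K)) (cube d {1..K}) (proj d {1..K})) (cube d S) (proj d S)"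
    unfolding marginal_kernel_prod_Suc[OF step.prems] marginal_def ..
  also have "\<dots> = marginal d S (kernel_prod d E \<kappa> (Suc K))"
    unfolding marginal_def
    using distr_distr[OF proj_measurable[OF S], of "proj d {1..K}" "kernel_prod d E \<kappa> (Suc K)"] pr proj_proj[OF S]
    by (simp cong: measurable_cong_sets add: prob_algebraD[OF P] comp_def del: kernel_prod.simps)
  finally show ?case using step by (simp add: dag_kernels_mono del: kernel_prod.simps)
qed simp

section \<open>Joint laws of parent and child cells, and versions of conditional
  distributions\<close>

lemma integral_cell_midpoint_pair:
  fixes G :: "_ \<Rightarrow> _ \<Rightarrow> real"
  assumes T: "finite T" and M: "M \<in> cube_probs d T" and S: "S \<subseteq> T" "S' \<subseteq> T"
  shows "(\<integral>x. G (cell_midpoint d \<eta> S x) (cell_midpoint d j S' x) \<partial>M) =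
    (\<Sum>c\<in>grid d \<eta> S. \<Sum>b\<in>grid d j S'. G c b * measure M {x \<in> space (cube d T). cell_midpoint d \<eta> S x = c \<and> cell_midpoint d j S' x = b})"
    and "{x \<in> space (cube d T). cell_midpoint d \<eta> S x = c \<and> cell_midpoint d j S' x = b} \<in> sets (cube d T)"
    and "integrable M (\<lambda>x. G (cell_midpoint d \<eta> S x) (cell_midpoint d j S' x))"
proof -
  interpret prob_space M using M by (rule prob_algebraD)
  have fin: "finite S" "finite S'" using S T finite_subset by auto
  have meas: "{x \<in> space (cube d T). cell_midpoint d \<eta> S x = c} \<in> sets (cube d T)" if "S \<subseteq> T" "finite S" for S \<eta> c
  proof -
    have "{x \<in> space (cube d T). cell_midpoint d \<eta> S x = c} =
      proj d S -` {x \<in> space (cube d S). cell_midpoint d \<eta> S x = c} \<inter> space (cube d T)"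
      using proj_space[OF that(1)] cell_midpoint_proj[OF order_refl, of d] by auto
    then show ?thesis
      using measurable_sets[OF proj_measurable[OF that(1)] cell_midpoint_eq_sets[OF that(2)]] by simp
  qed
  show m: "{x \<in> space (cube d T). cell_midpoint d \<eta> S x = c \<and> cell_midpoint d j S' x = b} \<in> sets (cube d T)" for c b
    by (intro sets.sets_Collect_conj meas S fin)
  have gr: "cell_midpoint d \<eta> S x \<in> grid d \<eta> S" if "S \<subseteq> T" "x \<in> space (cube d T)" for S x \<eta>
    using cell_midpoint_grid[OF proj_space[OF that]] cell_midpoint_proj[OF order_refl] by metis
  note * = integral_finite_valued[of M "grid d \<eta> S \<times> grid d j S'" "\<lambda>x. (cell_midpoint d \<eta> S x, cell_midpoint d j S' x)" "case_prod G"]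
  show "(\<integral>x. G (cell_midpoint d \<eta> S x) (cell_midpoint d j S' x) \<partial>M) =
    (\<Sum>c\<in>grid d \<eta> S. \<Sum>b\<in>grid d j S'. G c b * measure M {x \<in> space (cube d T). cell_midpoint d \<eta> S x = c \<and> cell_midpoint d j S' x = b})"
    using *(1) fin gr[OF S(1)] gr[OF S(2)] m finite_measure_axioms
    by (auto simp: finite_grid prob_algebraD[OF M] sum.cartesian_product intro!: sum.cong)
  show "integrable M (\<lambda>x. G (cell_midpoint d \<eta> S x) (cell_midpoint d j S' x))"
    using *(2) fin gr[OF S(1)] gr[OF S(2)] m finite_measure_axioms
    by (auto simp: finite_grid prob_algebraD[OF M])
qed

lemma is_rcdD:
  "is_rcd d \<nu> S k \<kappa> \<Longrightarrow> A \<in> sets (cube d S) \<Longrightarrow> B \<in> sets (cube d {k}) \<Longrightarrow>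
    (\<integral>\<^sup>+x\<in>A. emeasure (\<kappa> x) B \<partial>marginal d S \<nu>) =
    emeasure \<nu> {x \<in> space \<nu>. proj d S x \<in> A \<and> proj d {k} x \<in> B}"
  by (simp add: is_rcd_def)

text \<open>The kernels in the product formula and the Lipschitz ones agree only almost surely.
  Integrals of Lipschitz functions are determined by the masses of countably many dyadic cells, so
  one null set serves all test functions at once.\<close>

lemma AE_rcd_unique:
  assumes \<nu>: "\<nu> \<in> cube_probs d T" and S: "S \<subseteq> T" "finite S"
    and \<kappa>: "is_rcd d \<nu> S k \<kappa>" "is_rcd d \<nu> S k \<kappa>'"
  shows "AE x in marginal d S \<nu>. \<forall>\<Lambda>\<ge>0. \<forall>f. cube_lipschitz d {k} \<Lambda> f \<longrightarrow> integral\<^sup>L (\<kappa> x) f = integral\<^sup>L (\<kappa>' x) f"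
proof -
  define m where "m = marginal d S \<nu>"
  have m: "m \<in> cube_probs d S" unfolding m_def by (rule marginal_prob[OF \<nu> S(1)])
  interpret m: prob_space m using m by (rule prob_algebraD)
  have km: "\<kappa> \<in> cube d S \<rightarrow>\<^sub>M prob_algebra (cube d {k})" "\<kappa>' \<in> cube d S \<rightarrow>\<^sub>M prob_algebra (cube d {k})"
    using \<kappa> by (simp_all add: is_rcd_def)
  have ae: "AE x in m. emeasure (\<kappa> x) B = emeasure (\<kappa>' x) B" if B: "B \<in> sets (cube d {k})" for B
  proof -
    have em: "(\<lambda>x. emeasure (\<kappa> x) B) \<in> borel_measurable m" "(\<lambda>x. emeasure (\<kappa>' x) B) \<in> borel_measurable m"
      using measurable_emeasure_kernel[OF measurable_prob_algebraD[OF km(1)] B]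
        measurable_emeasure_kernel[OF measurable_prob_algebraD[OF km(2)] B]
      by (simp_all cong: measurable_cong_sets add: prob_algebraD[OF m])
    have "(\<integral>\<^sup>+x. emeasure (\<kappa> x) B \<partial>m) \<le> (\<integral>\<^sup>+x. 1 \<partial>m)"
    proof (rule nn_integral_mono)
      fix x assume "x \<in> space m"
      then have "\<kappa> x \<in> cube_probs d {k}"
        using measurable_space[OF km(1)] by (simp add: prob_algebraD[OF m])
      then interpret k: prob_space "\<kappa> x" by (rule prob_algebraD)
      show "emeasure (\<kappa> x) B \<le> 1" by (rule k.measure_le_1)
    qed
    then have "(\<integral>\<^sup>+x. emeasure (\<kappa> x) B \<partial>m) \<noteq> \<infinity>"
      by (auto simp: m.emeasure_space_1 top_unique)
    \<comment> \<open>Both densities integrate over \<open>A\<close> to the joint mass of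
      \<open>A\<close> and \<open>B\<close> under \<nu>; as this mass is finite, densities are
      unique almost everywhere.\<close>
    moreover have "density m (\<lambda>x. emeasure (\<kappa> x) B) = density m (\<lambda>x. emeasure (\<kappa>' x) B)"
    proof (rule measure_eqI)
      fix A assume "A \<in> sets (density m (\<lambda>x. emeasure (\<kappa> x) B))"
      then have A: "A \<in> sets m" by simp
      then have A': "A \<in> sets (cube d S)" by (simp add: prob_algebraD[OF m])
      have "(\<integral>\<^sup>+x\<in>A. emeasure (\<kappa> x) B \<partial>m) = (\<integral>\<^sup>+x\<in>A. emeasure (\<kappa>' x) B \<partial>m)"
        unfolding m_def is_rcdD[OF \<kappa>(1) A' B] is_rcdD[OF \<kappa>(2) A' B] ..
      then show "emeasure (density m (\<lambda>x. emeasure (\<kappa> x) B)) A = emeasure (density m (\<lambda>x. emeasure (\<kappa>' x) B)) A"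
        using em A by (simp add: emeasure_density)
    qed simp
    ultimately show ?thesis using finite_density_unique[OF em] by simp
  qed
  have "AE x in m. \<forall>j. \<forall>b\<in>grid d j {k}. cell_prob d j {k} (\<kappa> x) b = cell_prob d j {k} (\<kappa>' x) b"
    unfolding AE_all_countable
  proof (intro allI AE_finite_allI finite_grid finite.intros)
    fix j b
    show "AE x in m. cell_prob d j {k} (\<kappa> x) b = cell_prob d j {k} (\<kappa>' x) b"
      using ae[OF cell_midpoint_eq_sets[of "{k}" d j b, OF finite.insertI[OF finite.emptyI]]] by eventually_elim (simp add: cell_prob_def measure_def)
  qed
  moreover have "AE x in m. x \<in> space m" by simp
  ultimately show ?thesis unfolding m_def[symmetric]
  proof eventually_elim
    case (elim x)
    have k: "\<kappa> x \<in> cube_probs d {k}" "\<kappa>' x \<in> cube_probs d {k}"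
      using measurable_space[OF km(1)] measurable_space[OF km(2)] elim(2) by (simp_all add: prob_algebraD[OF m])
    have le: "integral\<^sup>L P f \<le> integral\<^sup>L Q f"
      if f: "cube_lipschitz d {k} \<Lambda> f" and \<Lambda>: "0 \<le> \<Lambda>"
        and P: "P \<in> cube_probs d {k}" and Q: "Q \<in> cube_probs d {k}"
        and eq: "\<forall>j. \<forall>b\<in>grid d j {k}. cell_prob d j {k} P b = cell_prob d j {k} Q b" for P Q f \<Lambda>
    proof -
      \<comment> \<open>All increments in the chaining bound vanish, and only the stopping error is
        left, at every level.\<close>
      have "integral\<^sup>L P f - integral\<^sup>L Q f \<le> \<Lambda> * (1 / 2) ^ J" for J
        using integral_diff_le_chaining[OF _ P Q f \<Lambda>, of J] eq by simp
      moreover have "(\<lambda>J. \<Lambda> * (1 / 2) ^ J) \<longlonglongrightarrow> \<Lambda> * 0"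
        by (intro tendsto_mult tendsto_const LIMSEQ_realpow_zero) auto
      ultimately have "integral\<^sup>L P f - integral\<^sup>L Q f \<le> \<Lambda> * 0"
        by (intro LIMSEQ_le_const) auto
      then show ?thesis by simp
    qed
    show ?case
      using le[OF _ _ k] le[OF _ _ k(2,1)] elim(1) by (metis antisym)
  qed
qed

lemma cell_midpoint_empty: "cell_midpoint d \<eta> {} x = (\<lambda>_. undefined)"
  by (simp add: cell_midpoint_eq coords_def restrict_def)

text \<open>The version for pairs with an empty second node set, which has a single label.\<close>

lemma integral_cell_midpoint_sub:
  fixes g :: "_ \<Rightarrow> real"
  assumes "finite T" "M \<in> cube_probs d T" "S \<subseteq> T"
  shows "(\<integral>x. g (cell_midpoint d \<eta> S x) \<partial>M) =
      (\<Sum>c\<in>grid d \<eta> S. g c * measure M {x \<in> space (cube d T). cell_midpoint d \<eta> S x = c})"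
    and "{x \<in> space (cube d T). cell_midpoint d \<eta> S x = c} \<in> sets (cube d T)"
    and "integrable M (\<lambda>x. g (cell_midpoint d \<eta> S x))"
proof -
  have *: "grid d \<eta> {} = {\<lambda>_. undefined}" "cell_midpoint d \<eta> {} x = (\<lambda>_. undefined)" for x
    by (simp_all add: grid_def cell_midpoint_empty coords_def)
  show "(\<integral>x. g (cell_midpoint d \<eta> S x) \<partial>M) =
      (\<Sum>c\<in>grid d \<eta> S. g c * measure M {x \<in> space (cube d T). cell_midpoint d \<eta> S x = c})"
    using integral_cell_midpoint_pair(1)[OF assms empty_subsetI, where G = "\<lambda>c b. g c" and j = \<eta> and \<eta> = \<eta>]
    by (simp add: *)
  show "{x \<in> space (cube d T). cell_midpoint d \<eta> S x = c} \<in> sets (cube d T)"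
    using integral_cell_midpoint_pair(2)[OF assms empty_subsetI, where c = c and j = \<eta> and \<eta> = \<eta> and b = "\<lambda>_. undefined"]
    by (simp add: *)
  show "integrable M (\<lambda>x. g (cell_midpoint d \<eta> S x))"
    using integral_cell_midpoint_pair(3)[OF assms empty_subsetI, where G = "\<lambda>c b. g c" and j = \<eta> and \<eta> = \<eta>] .
qed

lemma finite_valued_bounded:
  fixes g :: "'a \<Rightarrow> real"
  assumes "finite A"
  obtains B where "\<And>a. a \<in> A \<Longrightarrow> \<bar>g a\<bar> \<le> B"
proof
  fix a assume "a \<in> A"
  then show "\<bar>g a\<bar> \<le> Max ((\<lambda>a. \<bar>g a\<bar>) ` A)" using assms by (intro Max_ge) auto
qed

lemma cell_midpoint_grid_sub:
  "S \<subseteq> T \<Longrightarrow> x \<in> space (cube d T) \<Longrightarrow> cell_midpoint d \<eta> S x \<in> grid d \<eta> S"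
  using cell_midpoint_grid[OF proj_space, of S T x d \<eta>] cell_midpoint_proj[of S S d \<eta> x] by simp

lemma cell_midpoint_comp_measurable_sub:
  assumes "S \<subseteq> T" "finite T"
  shows "(\<lambda>x. g (cell_midpoint d \<eta> S x) :: real) \<in> borel_measurable (cube d T)"
  using measurable_compose[OF proj_measurable[OF assms(1)] cell_midpoint_comp_measurable[of S g d \<eta>]]
    assms cell_midpoint_proj[of S S d \<eta>] finite_subset[OF assms] by simp

text \<open>A product of smoothed kernels has the same law of grid cells as the smoothed measure on every
  fully connected set of nodes: if the largest node of the set is \<open>m + 1\<close>, the other ones are parents of \<open>m + 1\<close>,
  and the parents of \<open>m + 1\<close> are fully connected themselves.\<close>

lemma kernel_prod_cell_law:
  fixes g :: "_ \<Rightarrow> real"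
  assumes s: "dag_kernels d E s m" and \<nu>: "\<nu> \<in> cube_probs d T" and T: "finite T" "{1..m} \<subseteq> T"
    and fc: "\<And>k. k \<in> {1..m} \<Longrightarrow> fully_connected E (pa E k)"
    and const: "\<And>k x. k \<in> {1..m} \<Longrightarrow> x \<in> space (cube d (pa E k)) \<Longrightarrow> s k (cell_midpoint d \<eta> (pa E k) x) = s k x"
    and law: "\<And>k c b. k \<in> {1..m} \<Longrightarrow> c \<in> grid d \<eta> (pa E k) \<Longrightarrow>
      measure \<nu> {x \<in> space (cube d T). cell_midpoint d \<eta> (pa E k) x = c \<and> cell_midpoint d \<eta> {k} x = b} =
      measure \<nu> {x \<in> space (cube d T). cell_midpoint d \<eta> (pa E k) x = c} * cell_prob d \<eta> {k} (s k c) b"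
    and S: "S \<subseteq> {1..m}" "fully_connected E S"
  shows "(\<integral>x. g (cell_midpoint d \<eta> S x) \<partial>kernel_prod d E s m) = (\<integral>x. g (cell_midpoint d \<eta> S x) \<partial>\<nu>)"
  using assms
proof (induction m arbitrary: S g)
  case 0
  then have "S = {}" by simp
  then have *: "g (cell_midpoint d \<eta> S x) = g (\<lambda>_. undefined)" for x by (simp add: cell_midpoint_empty)
  interpret N: prob_space "kernel_prod d E s 0" using kernel_prod_prob[OF 0(1)] by (rule prob_algebraD)
  interpret \<nu>: prob_space \<nu> using \<nu> by (rule prob_algebraD)
  show ?case unfolding * using N.prob_space \<nu>.prob_space by simp
next
  case (Suc m)
  note s = Suc.prems(1) and T = Suc.prems(3,4)
  let ?k = "Suc m" and ?P = "pa E (Suc m)"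
  let ?N1 = "kernel_prod d E s (Suc m)" and ?q = "\<lambda>U. cell_midpoint d \<eta> U"
  let ?N = "kernel_prod d E s m"
  note step = dag_kernel_step[OF s]
  have sm: "dag_kernels d E s m" using s by (rule dag_kernels_mono) simp
  have N: "?N \<in> cube_probs d {1..m}" by (rule kernel_prod_prob[OF sm])
  have N1: "?N1 \<in> cube_probs d {1..Suc m}" by (rule kernel_prod_prob[OF s])
  have IH: "(\<integral>x. h (?q U x) \<partial>?N) = (\<integral>x. h (?q U x) \<partial>\<nu>)"
    if "U \<subseteq> {1..m}" "fully_connected E U" for U and h :: "_ \<Rightarrow> real"
    using that Suc.prems by (intro Suc.IH[OF sm]) auto
  obtain B where B: "\<And>c. c \<in> grid d \<eta> S \<Longrightarrow> \<bar>g c\<bar> \<le> B"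
    using finite_valued_bounded[OF finite_grid[of S d \<eta>], of g] Suc.prems(8) finite_subset by blast
  have expand: "(\<integral>x. g (?q S x) \<partial>?N1) =
      (\<integral>x. (\<integral>y. g (?q S (extend d m x y)) \<partial>s ?k (proj d ?P x)) \<partial>?N)"
    using B cell_midpoint_grid_sub[OF Suc.prems(8)]
    by (intro integral_kernel_prod_Suc[OF s, where B = B] cell_midpoint_comp_measurable_sub Suc.prems(8)) auto
  show ?case
  proof (cases "?k \<in> S")
    case False
    then have S: "S \<subseteq> {1..m}" using Suc.prems(8) by (auto simp: le_Suc_eq)
    have "(\<integral>x. g (?q S x) \<partial>?N1) = (\<integral>x. g (?q S x) \<partial>?N)"
      unfolding expand
    proof (rule Bochner_Integration.integral_cong[OF refl])
      fix x assume "x \<in> space ?N"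
      then have x: "x \<in> space (cube d {1..m})" by (simp add: prob_algebraD[OF N])
      interpret k: prob_space "s ?k (proj d ?P x)"
        using measurable_space[OF step(2) x] by (rule prob_algebraD)
      show "(\<integral>y. g (?q S (extend d m x y)) \<partial>s ?k (proj d ?P x)) = g (?q S x)"
        unfolding cell_midpoint_extend(1)[OF S] by (simp add: k.prob_space)
    qed
    then show ?thesis using IH[OF S Suc.prems(9)] by simp
  next
    case True
    have SP: "S - {?k} \<subseteq> ?P"
    proof
      fix i assume i: "i \<in> S - {?k}"
      then have "i < ?k" using Suc.prems(8) by auto
      then show "i \<in> ?P" using i True Suc.prems(9) unfolding fully_connected_def pa_def by blast
    qed
    have PT: "?P \<subseteq> T" "{?k} \<subseteq> T" using step(1) T(2) by fastforce+
    \<comment> \<open>The label on \<open>S\<close> is assembled from the child label at the new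
      node and the parent label elsewhere; by \<open>SP\<close> these cover all of
      \<open>S\<close>.\<close>
    define G where "G c b = g (\<lambda>j\<in>coords d S. if fst j = ?k then b j else c j)" for c b
    have gG: "g (?q S z) = G (?q ?P z) (?q {?k} z)" for z
    proof -
      have "j \<in> coords d S \<Longrightarrow> j \<in> coords d {?k} \<and> fst j = ?k \<or> j \<in> coords d ?P \<and> fst j \<noteq> ?k" for j
        using SP by (auto simp: coords_def)
      then have "?q S z = (\<lambda>j\<in>coords d S. if fst j = ?k then ?q {?k} z j else ?q ?P z j)"
        unfolding cell_midpoint_eq[of d \<eta> S] by (intro restrict_ext) (auto simp: cell_midpoint_eq)
      then show ?thesis by (simp add: G_def)
    qed
    \<comment> \<open>The conditional mean of \<open>G\<close> given the parent cell. It is a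
      function of that cell because the kernels \<open>s\<close> are constant on cells.\<close>
    define H where "H c = (\<Sum>b\<in>grid d \<eta> {?k}. G c b * cell_prob d \<eta> {?k} (s ?k c) b)" for c
    have "(\<integral>x. g (?q S x) \<partial>?N1) = (\<integral>x. H (?q ?P x) \<partial>?N)"
      unfolding expand
    proof (rule Bochner_Integration.integral_cong[OF refl])
      fix x assume "x \<in> space ?N"
      then have x: "x \<in> space (cube d {1..m})" by (simp add: prob_algebraD[OF N])
      have sx: "s ?k (proj d ?P x) = s ?k (?q ?P x)"
        using Suc.prems(6)[of ?k "proj d ?P x"] proj_space[OF step(1) x] cell_midpoint_proj[of ?P ?P d \<eta> x] by simp
      show "(\<integral>y. g (?q S (extend d m x y)) \<partial>s ?k (proj d ?P x)) = H (?q ?P x)"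
        unfolding gG cell_midpoint_extend(1)[OF step(1)] cell_midpoint_extend(2) H_def sx[symmetric]
        by (rule integral_cell_midpoint(1)[OF _ measurable_space[OF step(2) x]]) simp
    qed
    \<comment> \<open>The induction hypothesis is applied to the full parent set and not to
      \<open>S\<close> without the new node. This is where the parents have to be fully
      connected.\<close>
    also have "\<dots> = (\<integral>x. H (?q ?P x) \<partial>\<nu>)"
      by (rule IH[OF step(1)]) (simp add: Suc.prems(5))
    also have "\<dots> = (\<Sum>c\<in>grid d \<eta> ?P. H c * measure \<nu> {x \<in> space (cube d T). ?q ?P x = c})"
      by (rule integral_cell_midpoint_sub(1)[OF T(1) \<nu> PT(1)])
    also have "\<dots> = (\<Sum>c\<in>grid d \<eta> ?P. \<Sum>b\<in>grid d \<eta> {?k}. G c b *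
        measure \<nu> {x \<in> space (cube d T). ?q ?P x = c \<and> ?q {?k} x = b})"
      unfolding H_def sum_distrib_right
      by (intro sum.cong refl) (simp add: Suc.prems(7) mult_ac)
    also have "\<dots> = (\<integral>x. g (?q S x) \<partial>\<nu>)"
      unfolding gG by (rule integral_cell_midpoint_pair(1)[OF T(1) \<nu> PT, symmetric])
    finally show ?thesis .
  qed
qed

text \<open>The two laws are compared by replacing one kernel after another: integrating out \<open>x\<^sub>m\<^sub>+\<^sub>1\<close> with a
  Lipschitz kernel turns a \<open>\<Lambda>\<close>-Lipschitz test function into a \<open>\<Lambda> (1 + L)\<close>-Lipschitz one.\<close>

lemma kernel_prod_telescope:
  assumes \<kappa>: "dag_kernels d E \<kappa> m" and \<kappa>': "dag_kernels d E \<kappa>' m" and s: "dag_kernels d E s m"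
    and L: "0 \<le> L" and \<nu>: "\<nu> \<in> cube_probs d T" and T: "finite T" "{1..m} \<subseteq> T"
    and ae: "\<And>k. k < m \<Longrightarrow> AE x in kernel_prod d E \<kappa> k. \<forall>\<Lambda>\<ge>0. \<forall>f. cube_lipschitz d {Suc k} \<Lambda> f \<longrightarrow>
      integral\<^sup>L (\<kappa> (Suc k) (proj d (pa E (Suc k)) x)) f = integral\<^sup>L (\<kappa>' (Suc k) (proj d (pa E (Suc k)) x)) f"
    and lip: "\<And>k \<Lambda> f x x'. k < m \<Longrightarrow> 0 \<le> \<Lambda> \<Longrightarrow> cube_lipschitz d {Suc k} \<Lambda> f \<Longrightarrow>
      x \<in> space (cube d (pa E (Suc k))) \<Longrightarrow> x' \<in> space (cube d (pa E (Suc k))) \<Longrightarrow>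
      \<bar>integral\<^sup>L (\<kappa>' (Suc k) x) f - integral\<^sup>L (\<kappa>' (Suc k) x') f\<bar> \<le> \<Lambda> * L * sup_dist d (pa E (Suc k)) x x'"
    and disc: "\<And>k \<Lambda> f x. k < m \<Longrightarrow> 0 \<le> \<Lambda> \<Longrightarrow> cube_lipschitz d {Suc k} \<Lambda> f \<Longrightarrow>
      x \<in> space (cube d (pa E (Suc k))) \<Longrightarrow>
      integral\<^sup>L (\<kappa>' (Suc k) x) f - integral\<^sup>L (s (Suc k) x) f \<le> \<Lambda> * D (Suc k) (cell_midpoint d \<eta> (pa E (Suc k)) x)"
    and agree: "\<And>k g. k < m \<Longrightarrow> (\<integral>x. g (cell_midpoint d \<eta> (pa E (Suc k)) x) \<partial>kernel_prod d E s k) =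
      (\<integral>x. g (cell_midpoint d \<eta> (pa E (Suc k)) x) \<partial>\<nu> :: real)"
    and f: "cube_lipschitz d {1..m} \<Lambda> f" "0 \<le> \<Lambda>"
  shows "integral\<^sup>L (kernel_prod d E \<kappa> m) f - integral\<^sup>L (kernel_prod d E s m) f \<le>
    \<Lambda> * (\<Sum>k<m. (1 + L) ^ (m - Suc k) * (\<integral>x. D (Suc k) (cell_midpoint d \<eta> (pa E (Suc k)) x) \<partial>\<nu>))"
  using assms
proof (induction m arbitrary: f \<Lambda>)
  case 0
  then show ?case by simp
next
  case (Suc m)
  let ?I = "\<lambda>k. \<integral>x. D (Suc k) (cell_midpoint d \<eta> (pa E (Suc k)) x) \<partial>\<nu>"
  note \<kappa> = Suc.prems(1) and \<kappa>' = Suc.prems(2) and s = Suc.prems(3)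
  note ae = Suc.prems(8)[OF lessI] and lip = Suc.prems(9)[OF lessI] and disc = Suc.prems(10)[OF lessI]
  note agree = Suc.prems(11)[OF lessI] and f = Suc.prems(12) and \<Lambda> = Suc.prems(13)
  let ?k = "Suc m" and ?P = "pa E (Suc m)"
  let ?M = "kernel_prod d E \<kappa> m" and ?N = "kernel_prod d E s m"
  have m: "dag_kernels d E \<kappa> m" "dag_kernels d E \<kappa>' m" "dag_kernels d E s m"
    using \<kappa> \<kappa>' s by (auto intro: dag_kernels_mono)
  have M: "?M \<in> cube_probs d {1..m}" by (rule kernel_prod_prob[OF m(1)])
  have N: "?N \<in> cube_probs d {1..m}" by (rule kernel_prod_prob[OF m(3)])
  interpret M: prob_space ?M using M by (rule prob_algebraD)
  interpret N: prob_space ?N using N by (rule prob_algebraD)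
  have P: "?P \<subseteq> {1..m}" by (rule dag_kernel_step(1)[OF \<kappa>])
  obtain B where B: "\<And>z. z \<in> space (cube d {1..Suc m}) \<Longrightarrow> \<bar>f z\<bar> \<le> B"
    using cube_lipschitz_bounded[OF f _ \<Lambda>] by auto
  note fm = cube_lipschitzD(1)[OF f]
  have fe: "cube_lipschitz d {?k} \<Lambda> (\<lambda>y. f (extend d m x y))" if x: "x \<in> space (cube d {1..m})" for x
    unfolding cube_lipschitz_def
  proof (intro conjI ballI)
    show "(\<lambda>y. f (extend d m x y)) \<in> borel_measurable (cube d {?k})"
      using measurable_compose[OF measurable_compose[OF measurable_Pair1'[OF x] extend_measurable] fm] by simp
    fix y y' assume y: "y \<in> space (cube d {?k})" "y' \<in> space (cube d {?k})"
    have "\<bar>f (extend d m x y) - f (extend d m x y')\<bar> \<le> \<Lambda> * sup_dist d {1..Suc m} (extend d m x y) (extend d m x y')"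
      by (intro cube_lipschitzD(2)[OF f] extend_space x y)
    also have "\<dots> \<le> \<Lambda> * sup_dist d {?k} y y'"
      by (intro mult_left_mono sup_dist_extend_le \<Lambda>)
    finally show "\<bar>f (extend d m x y) - f (extend d m x y')\<bar> \<le> \<Lambda> * sup_dist d {?k} y y'" .
  qed
  \<comment> \<open>\<open>g\<close> uses the Lipschitz version and stays a Lipschitz test function
    for the induction. \<open>h\<close> uses the smoothed kernel, which jumps between cells, and is
    compared with \<open>g\<close> only under the smoothed law of the preceding nodes.\<close>
  define g where "g x = (\<integral>y. f (extend d m x y) \<partial>\<kappa>' ?k (proj d ?P x))" for x
  define h where "h x = (\<integral>y. f (extend d m x y) \<partial>s ?k (proj d ?P x))" for x
  have gm: "g \<in> borel_measurable (cube d {1..m})"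
    unfolding g_def by (rule kernel_integral_measurable[OF dag_kernel_step(2)[OF \<kappa>'] fm])
  have hm: "h \<in> borel_measurable (cube d {1..m})"
    unfolding h_def by (rule kernel_integral_measurable[OF dag_kernel_step(2)[OF s] fm])
  have expand: "integral\<^sup>L (kernel_prod d E \<kappa> (Suc m)) f =
      (\<integral>x. (\<integral>y. f (extend d m x y) \<partial>\<kappa> ?k (proj d ?P x)) \<partial>?M)"
    "integral\<^sup>L (kernel_prod d E s (Suc m)) f =
      (\<integral>x. (\<integral>y. f (extend d m x y) \<partial>s ?k (proj d ?P x)) \<partial>?N)"
    by (rule integral_kernel_prod_Suc[OF \<kappa> fm B], assumption) (rule integral_kernel_prod_Suc[OF s fm B], assumption)
  have Mg: "integral\<^sup>L (kernel_prod d E \<kappa> (Suc m)) f = integral\<^sup>L ?M g"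
    unfolding expand g_def
  proof (rule integral_cong_AE)
    show "AE x in ?M. (\<integral>y. f (extend d m x y) \<partial>\<kappa> ?k (proj d ?P x)) = (\<integral>y. f (extend d m x y) \<partial>\<kappa>' ?k (proj d ?P x))"
      using ae AE_space
    proof eventually_elim
      case (elim x)
      then have "x \<in> space (cube d {1..m})" by (simp add: prob_algebraD[OF M])
      from fe[OF this] elim(1) \<Lambda> show ?case by blast
    qed
  qed (use kernel_integral_measurable[OF dag_kernel_step(2)[OF \<kappa>] fm]
        kernel_integral_measurable[OF dag_kernel_step(2)[OF \<kappa>'] fm] in
       \<open>simp_all cong: measurable_cong_sets add: prob_algebraD[OF M]\<close>)
  have Nh: "integral\<^sup>L (kernel_prod d E s (Suc m)) f = integral\<^sup>L ?N h"
    unfolding expand h_def ..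
  have gb: "\<bar>g x\<bar> \<le> B" and hb: "\<bar>h x\<bar> \<le> B" if x: "x \<in> space (cube d {1..m})" for x
    unfolding g_def h_def
    using fe[OF x] B extend_space[OF x]
    by (auto intro!: integral_le_bound_prob[OF measurable_space[OF dag_kernel_step(2)[OF \<kappa>'] x]]
        integral_le_bound_prob[OF measurable_space[OF dag_kernel_step(2)[OF s] x]] dest: cube_lipschitzD(1))
  \<comment> \<open>The point enters twice: through the coordinates seen by \<open>f\<close>, which
    contributes the factor 1, and as the argument of the kernel, which contributes
    \<open>L\<close>.\<close>
  have glip: "cube_lipschitz d {1..m} (\<Lambda> * (1 + L)) g"
    unfolding cube_lipschitz_def
  proof (intro conjI ballI gm)
    fix x x' assume x: "x \<in> space (cube d {1..m})" and x': "x' \<in> space (cube d {1..m})"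
    note k = measurable_space[OF dag_kernel_step(2)[OF \<kappa>'] x]
    interpret k: prob_space "\<kappa>' ?k (proj d ?P x)" using k by (rule prob_algebraD)
    have int: "integrable (\<kappa>' ?k (proj d ?P x)) (\<lambda>y. f (extend d m z y))" if "z \<in> space (cube d {1..m})" for z
      by (rule integrable_cube_lipschitz[OF k fe[OF that] _ \<Lambda>]) simp
    have "\<bar>g x - (\<integral>y. f (extend d m x' y) \<partial>\<kappa>' ?k (proj d ?P x))\<bar> =
        \<bar>\<integral>y. f (extend d m x y) - f (extend d m x' y) \<partial>\<kappa>' ?k (proj d ?P x)\<bar>"
      unfolding g_def using int[OF x] int[OF x'] by simp
    also have "\<dots> \<le> \<Lambda> * sup_dist d {1..m} x x'"
    proof (rule integral_le_bound_prob[OF k])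
      show "(\<lambda>y. f (extend d m x y) - f (extend d m x' y)) \<in> borel_measurable (cube d {?k})"
        by (intro borel_measurable_diff cube_lipschitzD(1)[OF fe] x x')
      fix y assume y: "y \<in> space (cube d {?k})"
      have "\<bar>f (extend d m x y) - f (extend d m x' y)\<bar> \<le> \<Lambda> * sup_dist d {1..Suc m} (extend d m x y) (extend d m x' y)"
        by (intro cube_lipschitzD(2)[OF f] extend_space x x' y)
      also have "\<dots> \<le> \<Lambda> * sup_dist d {1..m} x x'"
        by (intro mult_left_mono sup_dist_extend_le \<Lambda>)
      finally show "\<bar>f (extend d m x y) - f (extend d m x' y)\<bar> \<le> \<Lambda> * sup_dist d {1..m} x x'" .
    qed
    finally have 1: "\<bar>g x - (\<integral>y. f (extend d m x' y) \<partial>\<kappa>' ?k (proj d ?P x))\<bar> \<le> \<Lambda> * sup_dist d {1..m} x x'" .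
    have "\<bar>(\<integral>y. f (extend d m x' y) \<partial>\<kappa>' ?k (proj d ?P x)) - g x'\<bar> \<le> \<Lambda> * L * sup_dist d ?P (proj d ?P x) (proj d ?P x')"
      unfolding g_def by (intro lip \<Lambda> fe x' proj_space[OF P] x)
    also have "\<dots> \<le> \<Lambda> * L * sup_dist d {1..m} x x'"
      using sup_dist_mono[OF _ P, of d x x'] \<Lambda> Suc.prems(4)
      by (intro mult_left_mono) (auto simp: sup_dist_proj)
    finally show "\<bar>g x - g x'\<bar> \<le> \<Lambda> * (1 + L) * sup_dist d {1..m} x x'"
      using 1 by (simp add: algebra_simps)
  qed
  have IH: "integral\<^sup>L ?M g - integral\<^sup>L ?N g \<le> \<Lambda> * (1 + L) *
      (\<Sum>k<m. (1 + L) ^ (m - Suc k) * ?I k)"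
  proof (rule Suc.IH[OF m Suc.prems(4,5,6) _ Suc.prems(8)[OF less_SucI] Suc.prems(9)[OF less_SucI]
      Suc.prems(10)[OF less_SucI] Suc.prems(11)[OF less_SucI] glip])
    show "{1..m} \<subseteq> T" using Suc.prems(7) by auto
    show "0 \<le> \<Lambda> * (1 + L)" using \<Lambda> Suc.prems(4) by simp
  qed assumption+
  have intN: "integrable ?N g" "integrable ?N h"
    by (rule integrable_bounded_prob[OF N gm gb], assumption) (rule integrable_bounded_prob[OF N hm hb])
  have DN: "integrable ?N (\<lambda>x. D ?k (cell_midpoint d \<eta> ?P x))"
    by (rule integral_cell_midpoint_sub(3)[OF _ N P]) simp
  have "integral\<^sup>L ?N g - integral\<^sup>L ?N h = (\<integral>x. g x - h x \<partial>?N)"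
    using intN by simp
  also have "\<dots> \<le> (\<integral>x. \<Lambda> * D ?k (cell_midpoint d \<eta> ?P x) \<partial>?N)"
  proof (rule integral_mono)
    fix x assume "x \<in> space ?N"
    then have x: "x \<in> space (cube d {1..m})" by (simp add: prob_algebraD[OF N])
    show "g x - h x \<le> \<Lambda> * D ?k (cell_midpoint d \<eta> ?P x)"
      unfolding g_def h_def
      using disc[OF \<Lambda> fe[OF x] proj_space[OF P x]] cell_midpoint_proj[of ?P ?P d \<eta> x] by simp
  qed (use intN DN in auto)
  \<comment> \<open>The bound is a function of the parent cell, and on such functions the smoothed
    law of the preceding nodes coincides with \<nu>.\<close>
  also have "\<dots> = \<Lambda> * (\<integral>x. D ?k (cell_midpoint d \<eta> ?P x) \<partial>\<nu>)"
    using agree[of "D ?k"] by simp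
  finally have "integral\<^sup>L (kernel_prod d E \<kappa> (Suc m)) f - integral\<^sup>L (kernel_prod d E s (Suc m)) f \<le>
     \<Lambda> * ((1 + L) * (\<Sum>k<m. (1 + L) ^ (m - Suc k) * ?I k))
     + \<Lambda> * (\<integral>x. D ?k (cell_midpoint d \<eta> ?P x) \<partial>\<nu>)"
    unfolding Mg Nh using IH by (simp only: mult.assoc)
  also have "(1 + L) * (\<Sum>k<m. (1 + L) ^ (m - Suc k) * ?I k) =
     (\<Sum>k<m. (1 + L) ^ (Suc m - Suc k) * ?I k)"
    unfolding sum_distrib_left
  proof (rule sum.cong[OF refl])
    fix k assume "k \<in> {..<m}"
    then have "Suc m - Suc k = Suc (m - Suc k)" by auto
    then show "(1 + L) * ((1 + L) ^ (m - Suc k) * ?I k) =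
      (1 + L) ^ (Suc m - Suc k) * ?I k"
      by (simp only: power_Suc mult.assoc)
  qed
  finally show ?case by (simp add: distrib_left del: kernel_prod.simps)
qed

section \<open>Empirical measures and their smoothing\<close>

lemma singleton_sets_cube:
  assumes "finite S" "x \<in> space (cube d S)"
  shows "{x} \<in> sets (cube d S)"
proof -
  have [measurable]: "j \<in> coords d S \<Longrightarrow> (\<lambda>x. x j) \<in> borel_measurable (cube d S)" for j
    by (rule measurable_coord)
  have "{y \<in> space (cube d S). \<forall>j\<in>coords d S. y j = x j} \<in> sets (cube d S)"
    using assms(1) by (intro sets.sets_Collect_finite_All) measurable
  also have "{y \<in> space (cube d S). \<forall>j\<in>coords d S. y j = x j} = {x}"
    using assms(2) unfolding space_cube by (auto intro: PiE_ext)
  finally show ?thesis .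
qed

text \<open>Elementary conditioning on the finitely many values of the parents. Existence ensures
  that the choice made by \<open>rcd\<close> for an empirical measure is a genuine conditional
  distribution.\<close>

lemma rcd_exists_finite_support:
  assumes \<nu>: "\<nu> \<in> cube_probs d T" and T: "finite T" "S \<subseteq> T" "k \<in> T"
    and F: "finite F" "F \<subseteq> space (cube d T)" "AE z in \<nu>. z \<in> F"
  shows "\<exists>\<kappa>. is_rcd d \<nu> S k \<kappa>"
proof -
  interpret prob_space \<nu> using \<nu> by (rule prob_algebraD)
  have [measurable_cong]: "sets \<nu> = sets (cube d T)" by (rule prob_algebraD[OF \<nu>])
  have finS: "finite S" using T finite_subset by blast
  have kT: "{k} \<subseteq> T" using T by simp
  note pS [measurable] = proj_measurable[OF T(2), of d] and pk [measurable] = proj_measurable[OF kT, of d]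
  define F' where "F' = proj d S ` F"
  have F': "finite F'" "F' \<subseteq> space (cube d S)"
    using F proj_space[OF T(2)] by (auto simp: F'_def)
  define W where "W x = {z \<in> space \<nu>. proj d S z = x}" for x
  have W: "W x \<in> sets \<nu>" if "x \<in> F'" for x
  proof -
    have "{x} \<in> sets (cube d S)" using singleton_sets_cube[OF finS] that F' by blast
    then have "proj d S -` {x} \<inter> space \<nu> \<in> sets \<nu>" by (rule measurable_sets[rotated]) measurable
    also have "proj d S -` {x} \<inter> space \<nu> = W x" by (auto simp: W_def)
    finally show ?thesis .
  qed
  obtain y0 where y0: "y0 \<in> space (cube d {k})" using space_cube_nonempty by blast
  \<comment> \<open>A fixed Dirac mass is the default off the atoms: then \<kappa> differs from a
    constant kernel only at finitely many measurable points, which makes it measurable.\<close>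
  define \<kappa> where "\<kappa> x = (if x \<in> F' \<and> emeasure \<nu> (W x) \<noteq> 0
      then distr (uniform_measure \<nu> (W x)) (cube d {k}) (proj d {k}) else return (cube d {k}) y0)" for x
  have r: "return (cube d {k}) y0 \<in> cube_probs d {k}"
    using y0 by (simp add: space_prob_algebra prob_space_return)
  have \<kappa>p: "\<kappa> x \<in> cube_probs d {k}" for x
  proof (cases "x \<in> F' \<and> emeasure \<nu> (W x) \<noteq> 0")
    case True
    interpret u: prob_space "uniform_measure \<nu> (W x)"
      using True by (intro prob_space_uniform_measure) (auto simp: emeasure_eq_measure)
    have "prob_space (distr (uniform_measure \<nu> (W x)) (cube d {k}) (proj d {k}))"
      by (rule u.prob_space_distr) measurable
    then show ?thesis using True by (simp add: \<kappa>_def space_prob_algebra)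
  next
    case False
    show ?thesis unfolding \<kappa>_def if_not_P[OF False] by (rule r)
  qed
  have "is_rcd d \<nu> S k \<kappa>"
    unfolding is_rcd_def
  proof (intro conjI ballI)
    have [simp]: "countable F'" using F'(1) by (rule countable_finite)
    show km: "\<kappa> \<in> cube d S \<rightarrow>\<^sub>M prob_algebra (cube d {k})"
    proof (rule measurable_discrete_difference[where X = F' and f = "\<lambda>_. return (cube d {k}) y0"])
      show "{x} \<in> sets (cube d S)" if "x \<in> F'" for x using singleton_sets_cube[OF finS] that F' by blast
      show "\<kappa> x \<in> cube_probs d {k}" for x by (rule \<kappa>p)
      show "return (cube d {k}) y0 = \<kappa> x" if "x \<notin> F'" for x using that by (simp add: \<kappa>_def)
    qed (use r in auto)
    fix A B assume A [measurable]: "A \<in> sets (cube d S)" and B [measurable]: "B \<in> sets (cube d {k})"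
    let ?g = "\<lambda>x. emeasure (\<kappa> x) B * indicator A x" and ?B = "{z \<in> space \<nu>. proj d {k} z \<in> B}"
    define X where "X = {z \<in> space \<nu>. proj d S z \<in> A \<and> proj d {k} z \<in> B}"
    have Xs: "X \<in> sets \<nu>" unfolding X_def by measurable
    have em: "(\<lambda>x. emeasure (\<kappa> x) B) \<in> borel_measurable (cube d S)"
      by (rule measurable_emeasure_kernel[OF measurable_prob_algebraD[OF km] B])
    \<comment> \<open>Conditional probability times the mass of the fibre is the joint mass; on null
      fibres both sides are 0.\<close>
    have summand: "emeasure (\<kappa> x) B * indicator A x * emeasure \<nu> (W x) = emeasure \<nu> (X \<inter> W x)" if x: "x \<in> F'" for x
    proof (cases "emeasure \<nu> (W x) = 0")
      case True
      then have "emeasure \<nu> (X \<inter> W x) = 0" by (intro emeasure_eq_0[OF W[OF x] True]) auto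
      then show ?thesis using True by simp
    next
      case False
      have Bs: "?B \<in> sets \<nu>" by measurable
      have "emeasure (\<kappa> x) B = emeasure (distr (uniform_measure \<nu> (W x)) (cube d {k}) (proj d {k})) B"
        using False x by (simp add: \<kappa>_def)
      also have "\<dots> = emeasure (uniform_measure \<nu> (W x)) (proj d {k} -` B \<inter> space (uniform_measure \<nu> (W x)))"
        by (rule emeasure_distr) measurable
      also have "proj d {k} -` B \<inter> space (uniform_measure \<nu> (W x)) = ?B" by auto
      also have "emeasure (uniform_measure \<nu> (W x)) ?B =
          emeasure \<nu> (W x \<inter> ?B) / emeasure \<nu> (W x)"
        using W[OF x] Bs by simp
      finally have e0: "emeasure (\<kappa> x) B = emeasure \<nu> (W x \<inter> ?B) / emeasure \<nu> (W x)" .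
      have self: "emeasure \<nu> (W x) / emeasure \<nu> (W x) = 1"
        using False emeasure_finite[of "W x"] by (intro ennreal_divide_self) (auto simp: less_top[symmetric])
      have e: "emeasure (\<kappa> x) B * emeasure \<nu> (W x) = emeasure \<nu> (W x \<inter> ?B)"
        unfolding e0 ennreal_divide_times self by simp
      have "X \<inter> W x = (if x \<in> A then W x \<inter> ?B else {})"
        by (auto simp: X_def W_def)
      then show ?thesis using e by (auto simp: indicator_def)
    qed
    have aeF: "AE z in \<nu>. z \<in> space \<nu> \<and> proj d S z \<in> F'"
      using F(3) AE_space by eventually_elim (auto simp: F'_def)
    have "(\<integral>\<^sup>+x\<in>A. emeasure (\<kappa> x) B \<partial>marginal d S \<nu>) = (\<integral>\<^sup>+z. emeasure (\<kappa> (proj d S z)) B * indicator A (proj d S z) \<partial>\<nu>)"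
      unfolding marginal_def
    proof (rule nn_integral_distr)
      show "proj d S \<in> \<nu> \<rightarrow>\<^sub>M cube d S" by measurable
      show "(\<lambda>x. emeasure (\<kappa> x) B * indicator A x) \<in> borel_measurable (distr \<nu> (cube d S) (proj d S))"
        using borel_measurable_times_ennreal[OF em borel_measurable_indicator[OF A]] by simp
    qed
    also have "\<dots> = (\<integral>\<^sup>+z. (\<Sum>x\<in>F'. ?g x * indicator (W x) z) \<partial>\<nu>)"
    proof (rule nn_integral_cong_AE)
      show "AE z in \<nu>. emeasure (\<kappa> (proj d S z)) B * indicator A (proj d S z) =
          (\<Sum>x\<in>F'. ?g x * indicator (W x) z)"
        using aeF
      proof eventually_elim
        case (elim z)
        have "(\<Sum>x\<in>F'. ?g x * indicator (W x) z) =
            (\<Sum>x\<in>F'. if proj d S z = x then ?g x else 0)"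
          using elim by (intro sum.cong refl) (simp add: W_def indicator_def)
        then show ?case using elim F'(1) by simp
      qed
    qed
    also have "\<dots> = (\<Sum>x\<in>F'. ?g x * emeasure \<nu> (W x))"
    proof -
      have "(\<integral>\<^sup>+z. (\<Sum>x\<in>F'. ?g x * indicator (W x) z) \<partial>\<nu>) =
          (\<Sum>x\<in>F'. \<integral>\<^sup>+z. ?g x * indicator (W x) z \<partial>\<nu>)"
        using W by (intro nn_integral_sum borel_measurable_times_ennreal borel_measurable_indicator borel_measurable_const)
      then show ?thesis using W by (simp add: nn_integral_cmult_indicator)
    qed
    also have "\<dots> = (\<Sum>x\<in>F'. emeasure \<nu> (X \<inter> W x))"
      by (rule sum.cong[OF refl summand])
    also have "\<dots> = emeasure \<nu> (\<Union>x\<in>F'. X \<inter> W x)"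
      using F'(1) W Xs by (intro sum_emeasure) (auto simp: disjoint_family_on_def W_def)
    also have "\<dots> = emeasure \<nu> X"
    proof (rule emeasure_eq_AE)
      show "AE z in \<nu>. (z \<in> (\<Union>x\<in>F'. X \<inter> W x)) = (z \<in> X)"
        using aeF by eventually_elim (auto simp: W_def)
      show "(\<Union>x\<in>F'. X \<inter> W x) \<in> sets \<nu>" using F'(1) W Xs by (intro sets.finite_UN) auto
    qed (rule Xs)
    finally show "emeasure \<nu> {z \<in> space \<nu>. proj d S z \<in> A \<and> proj d {k} z \<in> B} = (\<integral>\<^sup>+x\<in>A. emeasure (\<kappa> x) B \<partial>marginal d S \<nu>)"
      by (simp add: X_def)
  qed
  then show ?thesis by blast
qed

lemma empirical_prob:
  assumes "1 \<le> n" "\<And>i. i < n \<Longrightarrow> \<omega> i \<in> space (cube d {1..K})"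
  shows "empirical d K n \<omega> \<in> cube_probs d {1..K}"
proof -
  interpret prob_space "uniform_count_measure {..<n}"
    using assms(1) by (intro prob_space_uniform_count_measure) (auto simp: lessThan_empty_iff)
  have "\<omega> \<in> uniform_count_measure {..<n} \<rightarrow>\<^sub>M cube d {1..K}"
    using assms(2) by (auto simp: measurable_def space_uniform_count_measure sets_uniform_count_measure)
  then show ?thesis by (simp add: empirical_def space_prob_algebra prob_space_distr)
qed

lemma measure_empirical:
  assumes n: "1 \<le> n" and \<omega>: "\<And>i. i < n \<Longrightarrow> \<omega> i \<in> space (cube d {1..K})" and X: "X \<in> sets (cube d {1..K})"
  shows "measure (empirical d K n \<omega>) X = (\<Sum>i<n. indicator X (\<omega> i)) / real n"
proof -
  have "\<omega> \<in> uniform_count_measure {..<n} \<rightarrow>\<^sub>M cube d {1..K}"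
    using \<omega> by (auto simp: measurable_def space_uniform_count_measure sets_uniform_count_measure)
  then have "measure (empirical d K n \<omega>) X = measure (uniform_count_measure {..<n}) {i \<in> {..<n}. \<omega> i \<in> X}"
    unfolding empirical_def using X by (subst measure_distr) (auto simp: vimage_def Int_def conj_commute space_uniform_count_measure)
  also have "\<dots> = real (card {i \<in> {..<n}. \<omega> i \<in> X}) / real n"
    using n by (subst measure_uniform_count_measure) auto
  also have "real (card {i \<in> {..<n}. \<omega> i \<in> X}) = (\<Sum>i<n. indicator X (\<omega> i))"
    by (simp add: indicator_def sum.If_cases Int_def)
  finally show ?thesis .
qed

lemma AE_empirical:
  assumes n: "1 \<le> n" and \<omega>: "\<And>i. i < n \<Longrightarrow> \<omega> i \<in> space (cube d {1..K})"
  shows "AE z in empirical d K n \<omega>. z \<in> \<omega> ` {..<n}"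
proof -
  have "\<omega> \<in> uniform_count_measure {..<n} \<rightarrow>\<^sub>M cube d {1..K}"
    using \<omega> by (auto simp: measurable_def space_uniform_count_measure sets_uniform_count_measure)
  moreover have "\<omega> ` {..<n} \<in> sets (cube d {1..K})"
  proof -
    have "(\<Union>i<n. {\<omega> i}) \<in> sets (cube d {1..K})"
      using \<omega> by (intro sets.finite_UN singleton_sets_cube) auto
    then show ?thesis by (simp add: UNION_singleton_eq_range)
  qed
  then have "{z \<in> space (cube d {1..K}). z \<in> \<omega> ` {..<n}} \<in> sets (cube d {1..K})"
    using sets.Int_space_eq2 by (simp add: Collect_conj_eq Int_commute)
  ultimately show ?thesis
    unfolding empirical_def by (subst AE_distr_iff) (auto intro!: AE_I2 simp: space_uniform_count_measure)
qed

text \<open>What the comparison uses of smoothed kernels. Nodes without parents fit in: the empty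
  parent set has one cell, of mass 1, and the product rule for cells reduces to the definition of
  the marginal.\<close>

lemma smoothed_kernel_props:
  assumes \<nu>: "\<nu> \<in> cube_probs d T" and T: "finite T" "pa E k \<subseteq> T" "k \<in> T"
    and ex: "\<exists>\<kappa>. is_rcd d \<nu> (pa E k) k \<kappa>"
  shows "smoothed_kernel d E \<eta> \<nu> k \<in> cube d (pa E k) \<rightarrow>\<^sub>M prob_algebra (cube d {k})"
    and "x \<in> space (cube d (pa E k)) \<Longrightarrow>
      smoothed_kernel d E \<eta> \<nu> k (cell_midpoint d \<eta> (pa E k) x) = smoothed_kernel d E \<eta> \<nu> k x"
    and "c \<in> grid d \<eta> (pa E k) \<Longrightarrow>
      measure \<nu> {x \<in> space (cube d T). cell_midpoint d \<eta> (pa E k) x = c \<and> cell_midpoint d j {k} x = b} =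
      measure \<nu> {x \<in> space (cube d T). cell_midpoint d \<eta> (pa E k) x = c} *
        cell_prob d j {k} (smoothed_kernel d E \<eta> \<nu> k c) b"
proof -
  have fin: "finite (pa E k)" using T finite_subset by blast
  have rcd: "is_rcd d \<nu> (pa E k) k (rcd d \<nu> (pa E k) k)"
    unfolding rcd_def using ex by (rule someI_ex)
  have kT: "{k} \<subseteq> T" using T by simp
  show const: "smoothed_kernel d E \<eta> \<nu> k (cell_midpoint d \<eta> (pa E k) x) = smoothed_kernel d E \<eta> \<nu> k x"
    if "x \<in> space (cube d (pa E k))" for x
    using that by (simp add: smoothed_kernel_def cell_cond_cell_midpoint)
  show "smoothed_kernel d E \<eta> \<nu> k \<in> cube d (pa E k) \<rightarrow>\<^sub>M prob_algebra (cube d {k})"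
  proof (rule cell_constant_measurable[where \<eta> = \<eta>, OF fin])
    fix x assume x: "x \<in> space (cube d (pa E k))"
    show "smoothed_kernel d E \<eta> \<nu> k x \<in> cube_probs d {k}"
      using marginal_prob[OF \<nu> kT] bind_prob_algebra[OF cell_cond_prob[OF \<nu> T(2) fin x]] rcd
      by (auto simp: smoothed_kernel_def is_rcd_def)
  qed (rule const)
  show "measure \<nu> {x \<in> space (cube d T). cell_midpoint d \<eta> (pa E k) x = c \<and> cell_midpoint d j {k} x = b} =
      measure \<nu> {x \<in> space (cube d T). cell_midpoint d \<eta> (pa E k) x = c} *
        cell_prob d j {k} (smoothed_kernel d E \<eta> \<nu> k c) b"
    if c: "c \<in> grid d \<eta> (pa E k)" for c
  proof (cases "pa E k = {}")
    case False
    then show ?thesis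
      using cell_cond_bind_cell_prob[OF \<nu> T(2) fin T(3) c rcd, of j b] by (simp add: smoothed_kernel_def)
  next
    case True
    interpret prob_space \<nu> using \<nu> by (rule prob_algebraD)
    have "c = (\<lambda>_. undefined)" using c by (simp add: True grid_def coords_def)
    moreover have "measure \<nu> (space (cube d T)) = 1"
      using prob_space by (simp add: prob_algebraD[OF \<nu>])
    moreover have "cell_prob d j {k} (marginal d {k} \<nu>) b = measure \<nu> {x \<in> space (cube d T). cell_midpoint d j {k} x = b}"
    proof -
      have "{x \<in> space (cube d T). proj d {k} x \<in> {y \<in> space (cube d {k}). cell_midpoint d j {k} y = b}} =
          {x \<in> space (cube d T). cell_midpoint d j {k} x = b}"
        using proj_space[OF kT] cell_midpoint_proj[OF order_refl, of d j "{k}"] by auto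
      then show ?thesis
        using emeasure_marginal[OF \<nu> kT cell_midpoint_eq_sets[of "{k}" d j b]]
        by (simp add: cell_prob_def measure_def)
    qed
    ultimately show ?thesis by (simp add: True smoothed_kernel_def cell_midpoint_empty)
  qed
qed

section \<open>Weighted conditional cell frequencies as sample means\<close>

definition cell_set where
  "cell_set d T \<eta> S c = {x \<in> space (cube d T). cell_midpoint d \<eta> S x = c}"

definition cell_set_pair where
  "cell_set_pair d T \<eta> S c j k b = {x \<in> space (cube d T). cell_midpoint d \<eta> S x = c \<and> cell_midpoint d j {k} x = b}"

definition fluctuation where
  "fluctuation d T \<eta> S p j k c b x =
     cell_prob d j {k} (p c) b * indicator (cell_set d T \<eta> S c) x - indicator (cell_set_pair d T \<eta> S c j k b) x"

text \<open>The mean of \<open>fluctuation\<close> over the sample is \<open>p\<^sub>c(b) \<nu>(c) - \<nu>(c \<times> b)\<close> with the empirical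
  measure \<open>\<nu>\<close>; it has expectation 0 if \<open>p\<^sub>c(b)\<close> is the conditional probability of \<open>b\<close> given \<open>c\<close>.\<close>

lemma cell_set_sets:
  assumes "finite T" "S \<subseteq> T" "k \<in> T"
  shows "cell_set d T \<eta> S c \<in> sets (cube d T)" "cell_set_pair d T \<eta> S c j k b \<in> sets (cube d T)"
proof -
  \<comment> \<open>Measurability of cells is read off from lemmas about a probability measure; a
    Dirac mass provides one.\<close>
  obtain x0 where "x0 \<in> space (cube d T)" using space_cube_nonempty by blast
  then have M: "return (cube d T) x0 \<in> cube_probs d T"
    by (simp add: space_prob_algebra prob_space_return)
  show "cell_set d T \<eta> S c \<in> sets (cube d T)"
    unfolding cell_set_def by (rule integral_cell_midpoint_sub(2)[OF assms(1) M assms(2)])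
  show "cell_set_pair d T \<eta> S c j k b \<in> sets (cube d T)"
    unfolding cell_set_pair_def using assms by (intro integral_cell_midpoint_pair(2)[OF assms(1) M assms(2)]) simp
qed

text \<open>Integration gives each cell its \<nu>-mass as weight. Multiplied by it, the smoothed
  conditional probability becomes the joint mass of parent and child cell: inside the absolute value
  the error is then linear in \<nu>, and null cells drop out.\<close>

lemma integral_discrepancy:
  assumes \<nu>: "\<nu> \<in> cube_probs d T" and T: "finite T" "S \<subseteq> T" "k \<in> T"
    and law: "\<And>c j b. c \<in> grid d \<eta> S \<Longrightarrow> measure \<nu> (cell_set_pair d T \<eta> S c j k b) =
      measure \<nu> (cell_set d T \<eta> S c) * cell_prob d j {k} (s c) b"
  shows "(\<integral>x. (\<lambda>c. A + (\<Sum>j=1..\<eta>. (1 / 2) ^ j * (\<Sum>b\<in>grid d j {k}. \<bar>cell_prob d j {k} (p c) b - cell_prob d j {k} (s c) b\<bar>)))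
        (cell_midpoint d \<eta> S x) \<partial>\<nu>) =
    A + (\<Sum>j=1..\<eta>. (1 / 2) ^ j * (\<Sum>c\<in>grid d \<eta> S. \<Sum>b\<in>grid d j {k}.
      \<bar>cell_prob d j {k} (p c) b * measure \<nu> (cell_set d T \<eta> S c) - measure \<nu> (cell_set_pair d T \<eta> S c j k b)\<bar>))"
proof -
  interpret prob_space \<nu> using \<nu> by (rule prob_algebraD)
  let ?m = "\<lambda>c. measure \<nu> (cell_set d T \<eta> S c)"
  let ?D = "\<lambda>c j b. \<bar>cell_prob d j {k} (p c) b - cell_prob d j {k} (s c) b\<bar>"
  have one: "(\<Sum>c\<in>grid d \<eta> S. ?m c) = 1"
    using integral_cell_midpoint_sub(1)[OF T(1) \<nu> T(2), of "\<lambda>_. 1" \<eta>] prob_space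
    by (simp add: cell_set_def)
  have "(\<integral>x. (\<lambda>c. A + (\<Sum>j=1..\<eta>. (1 / 2) ^ j * (\<Sum>b\<in>grid d j {k}. ?D c j b))) (cell_midpoint d \<eta> S x) \<partial>\<nu>) =
    (\<Sum>c\<in>grid d \<eta> S. (A + (\<Sum>j=1..\<eta>. (1 / 2) ^ j * (\<Sum>b\<in>grid d j {k}. ?D c j b))) * ?m c)"
    unfolding cell_set_def by (rule integral_cell_midpoint_sub(1)[OF T(1) \<nu> T(2)])
  also have "\<dots> = A * (\<Sum>c\<in>grid d \<eta> S. ?m c) + (\<Sum>c\<in>grid d \<eta> S. \<Sum>j=1..\<eta>. (1 / 2) ^ j * (\<Sum>b\<in>grid d j {k}. ?D c j b * ?m c))"
    by (simp add: distrib_right sum.distrib sum_distrib_left sum_distrib_right mult.assoc)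
  also have "(\<Sum>c\<in>grid d \<eta> S. \<Sum>j=1..\<eta>. (1 / 2) ^ j * (\<Sum>b\<in>grid d j {k}. ?D c j b * ?m c)) =
      (\<Sum>j=1..\<eta>. \<Sum>c\<in>grid d \<eta> S. (1 / 2) ^ j * (\<Sum>b\<in>grid d j {k}. ?D c j b * ?m c))"
    by (rule sum.swap)
  also have "\<dots> = (\<Sum>j=1..\<eta>. (1 / 2) ^ j * (\<Sum>c\<in>grid d \<eta> S. \<Sum>b\<in>grid d j {k}. ?D c j b * ?m c))"
    by (simp only: sum_distrib_left)
  also have "\<dots> = (\<Sum>j=1..\<eta>. (1 / 2) ^ j * (\<Sum>c\<in>grid d \<eta> S. \<Sum>b\<in>grid d j {k}.
      \<bar>cell_prob d j {k} (p c) b * ?m c - measure \<nu> (cell_set_pair d T \<eta> S c j k b)\<bar>))"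
  proof (intro sum.cong refl arg_cong[where f = "\<lambda>u. _ * u"])
    fix j c b assume c: "c \<in> grid d \<eta> S"
    have "?D c j b * ?m c = \<bar>(cell_prob d j {k} (p c) b - cell_prob d j {k} (s c) b) * ?m c\<bar>"
      by (simp add: abs_mult)
    also have "(cell_prob d j {k} (p c) b - cell_prob d j {k} (s c) b) * ?m c =
        cell_prob d j {k} (p c) b * ?m c - ?m c * cell_prob d j {k} (s c) b"
      by (simp add: left_diff_distrib)
    finally show "?D c j b * ?m c = \<bar>cell_prob d j {k} (p c) b * ?m c - measure \<nu> (cell_set_pair d T \<eta> S c j k b)\<bar>"
      unfolding law[OF c] .
  qed
  finally show ?thesis by (simp add: one)
qed

text \<open>A bound for each single sample whose only random ingredients are cell frequencies;
  \<open>p\<close> smooths \<mu> itself through the Lipschitz version. In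
  \<open>(L + 1) * (1 / 2) ^ \<eta>\<close>, the part \<open>L\<close> is the bias of that smoothing
  and 1 comes from stopping the chaining at the mesh of the partition.\<close>

lemma wasserstein_smoothing_le:
  fixes \<mu> \<eta> d E
  defines "p \<equiv> \<lambda>\<kappa>' k x. cell_cond d \<eta> \<mu> (pa E k) x \<bind> \<kappa>' k"
  assumes dag: "sorted_dag K E" and fc: "\<And>k. k \<in> {1..K} \<Longrightarrow> fully_connected E (pa E k)"
    and \<mu>: "\<mu> \<in> cube_probs d {1..K}" and L: "0 \<le> L"
    and \<kappa>: "\<And>k. k \<in> {1..K} \<Longrightarrow> is_rcd d \<mu> (pa E k) k (\<kappa> k)" "\<mu> = kernel_prod d E \<kappa> K"
    and \<kappa>': "\<And>k. k \<in> {1..K} \<Longrightarrow> is_rcd d \<mu> (pa E k) k (\<kappa>' k)"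
    and lip: "\<And>k \<Lambda> f x x'. k \<in> {1..K} \<Longrightarrow> 0 \<le> \<Lambda> \<Longrightarrow> cube_lipschitz d {k} \<Lambda> f \<Longrightarrow>
      x \<in> space (cube d (pa E k)) \<Longrightarrow> x' \<in> space (cube d (pa E k)) \<Longrightarrow>
      \<bar>integral\<^sup>L (\<kappa>' k x) f - integral\<^sup>L (\<kappa>' k x') f\<bar> \<le> \<Lambda> * L * sup_dist d (pa E k) x x'"
    and n: "1 \<le> n" and \<omega>: "\<And>i. i < n \<Longrightarrow> \<omega> i \<in> space (cube d {1..K})"
  shows "wasserstein d {1..K} \<mu> (smoothing d K E \<eta> (empirical d K n \<omega>)) \<le>
    ennreal (\<Sum>k<K. (1 + L) ^ (K - Suc k) * ((L + 1) * (1 / 2) ^ \<eta> +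
      (\<Sum>j=1..\<eta>. (1 / 2) ^ j * (\<Sum>c\<in>grid d \<eta> (pa E (Suc k)). \<Sum>b\<in>grid d j {Suc k}.
        \<bar>(\<Sum>i<n. fluctuation d {1..K} \<eta> (pa E (Suc k)) (p \<kappa>' (Suc k)) j (Suc k) c b (\<omega> i)) / real n\<bar>))))"
proof (rule wasserstein_le_dual[OF finite_atLeastAtMost \<mu>])
  let ?G = "\<lambda>k j c. \<Sum>b\<in>grid d j {Suc k}.
        \<bar>(\<Sum>i<n. fluctuation d {1..K} \<eta> (pa E (Suc k)) (p \<kappa>' (Suc k)) j (Suc k) c b (\<omega> i)) / real n\<bar>"
  define \<nu> where "\<nu> = empirical d K n \<omega>"
  define s where "s = smoothed_kernel d E \<eta> \<nu>"
  have \<nu>: "\<nu> \<in> cube_probs d {1..K}"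
    unfolding \<nu>_def by (rule empirical_prob[OF n \<omega>])
  have paK: "pa E k \<subseteq> {1..<k}" for k
    using dag by (auto simp: sorted_dag_def pa_def)
  have paT: "pa E k \<subseteq> {1..K}" "finite (pa E k)" if "k \<in> {1..K}" for k
    using paK[of k] that finite_subset[OF paK] by auto
  have rcd: "\<exists>\<kappa>. is_rcd d \<nu> (pa E k) k \<kappa>" if k: "k \<in> {1..K}" for k
  proof (rule rcd_exists_finite_support[OF \<nu> _ paT(1)[OF k] k, of "\<omega> ` {..<n}"])
    show "AE z in \<nu>. z \<in> \<omega> ` {..<n}" unfolding \<nu>_def by (rule AE_empirical[OF n \<omega>])
  qed (use \<omega> in auto)
  note sp = smoothed_kernel_props[where \<eta> = \<eta>, OF \<nu> finite_atLeastAtMost paT(1) _ rcd, folded s_def]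
  have ks: "dag_kernels d E s K" using sp(1) paK by (auto simp: dag_kernels_def)
  have k\<kappa>: "dag_kernels d E \<kappa> K" using \<kappa>(1) paK by (auto simp: dag_kernels_def is_rcd_def)
  have k\<kappa>': "dag_kernels d E \<kappa>' K" using \<kappa>' paK by (auto simp: dag_kernels_def is_rcd_def)
  show "smoothing d K E \<eta> (empirical d K n \<omega>) \<in> cube_probs d {1..K}"
    unfolding smoothing_def \<nu>_def[symmetric] s_def[symmetric] by (rule kernel_prod_prob[OF ks])
  define D where "D k c = (L + 1) * (1 / 2) ^ \<eta> + (\<Sum>j=1..\<eta>. (1 / 2) ^ j *
    (\<Sum>b\<in>grid d j {k}. \<bar>cell_prob d j {k} (p \<kappa>' k c) b - cell_prob d j {k} (s k c) b\<bar>))" for k c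
  fix f assume f: "cube_lipschitz d {1..K} 1 f"
  have "integral\<^sup>L (kernel_prod d E \<kappa> K) f - integral\<^sup>L (kernel_prod d E s K) f \<le>
    1 * (\<Sum>k<K. (1 + L) ^ (K - Suc k) * (\<integral>x. D (Suc k) (cell_midpoint d \<eta> (pa E (Suc k)) x) \<partial>\<nu>))"
  proof (rule kernel_prod_telescope[OF k\<kappa> k\<kappa>' ks L \<nu> finite_atLeastAtMost order_refl _ _ _ _ f zero_le_one])
    fix k assume "k < K"
    then have k: "Suc k \<in> {1..K}" by auto
    let ?P = "pa E (Suc k)"
    have P: "?P \<subseteq> {1..k}" using paK[of "Suc k"] by auto
    show "AE x in kernel_prod d E \<kappa> k. \<forall>\<Lambda>\<ge>0. \<forall>f. cube_lipschitz d {Suc k} \<Lambda> f \<longrightarrow>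
      integral\<^sup>L (\<kappa> (Suc k) (proj d ?P x)) f = integral\<^sup>L (\<kappa>' (Suc k) (proj d ?P x)) f"
    proof -
      have kk: "dag_kernels d E \<kappa> k" using k\<kappa> \<open>k < K\<close> by (auto intro: dag_kernels_mono)
      \<comment> \<open>Uniqueness of versions is known under the parent marginal of \<mu>, and this
        is also the parent marginal of the law of the first \<open>k\<close> nodes.\<close>
      have "AE x in marginal d ?P (kernel_prod d E \<kappa> k). \<forall>\<Lambda>\<ge>0. \<forall>f. cube_lipschitz d {Suc k} \<Lambda> f \<longrightarrow>
          integral\<^sup>L (\<kappa> (Suc k) x) f = integral\<^sup>L (\<kappa>' (Suc k) x) f"
        using AE_rcd_unique[OF \<mu> paT[OF k] \<kappa>(1)[OF k] \<kappa>'[OF k]]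
          marginal_kernel_prod[OF k\<kappa> less_imp_le[OF \<open>k < K\<close>] P] \<kappa>(2) by metis
      then show ?thesis
        unfolding marginal_def
        by (rule AE_distrD[rotated])
          (use proj_measurable[OF P] in \<open>simp cong: measurable_cong_sets add: prob_algebraD[OF kernel_prod_prob[OF kk]]\<close>)
    qed
    show "\<bar>integral\<^sup>L (\<kappa>' (Suc k) x) f - integral\<^sup>L (\<kappa>' (Suc k) x') f\<bar> \<le> \<Lambda> * L * sup_dist d ?P x x'"
      if "0 \<le> \<Lambda>" "cube_lipschitz d {Suc k} \<Lambda> f" "x \<in> space (cube d ?P)" "x' \<in> space (cube d ?P)" for \<Lambda> f x x'
      by (rule lip[OF k that])
    show "integral\<^sup>L (\<kappa>' (Suc k) x) f - integral\<^sup>L (s (Suc k) x) f \<le> \<Lambda> * D (Suc k) (cell_midpoint d \<eta> ?P x)"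
      if \<Lambda>: "0 \<le> \<Lambda>" and f: "cube_lipschitz d {Suc k} \<Lambda> f" and x: "x \<in> space (cube d ?P)" for \<Lambda> f x
    proof -
      obtain B where B: "\<And>y. y \<in> space (cube d {Suc k}) \<Longrightarrow> \<bar>f y\<bar> \<le> B"
        using cube_lipschitz_bounded[OF f _ \<Lambda>] by auto
      have km: "\<kappa>' (Suc k) \<in> cube d ?P \<rightarrow>\<^sub>M prob_algebra (cube d {Suc k})" using \<kappa>'[OF k] by (simp add: is_rcd_def)
      have 1: "\<bar>integral\<^sup>L (\<kappa>' (Suc k) x) f - integral\<^sup>L (p \<kappa>' (Suc k) x) f\<bar> \<le> (\<Lambda> * L) * (1 / 2) ^ \<eta>"
        unfolding p_def
        by (rule integral_cell_cond_bind[OF \<mu> paT[OF k] x km lip[OF k \<Lambda> f] _ cube_lipschitzD(1)[OF f] B]) (use \<Lambda> L in auto)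
      have pp: "p \<kappa>' (Suc k) x \<in> cube_probs d {Suc k}"
        unfolding p_def by (rule bind_prob_algebra[OF cell_cond_prob[OF \<mu> paT[OF k] x] km])
      have ss: "s (Suc k) x \<in> cube_probs d {Suc k}"
        by (rule measurable_space[OF sp(1)[OF k k k] x])
      \<comment> \<open>Both smoothed kernels are constant on cells, so the error at
        \<open>x\<close> can be read off at the midpoint of its cell, as the telescoping
        requires.\<close>
      have "p \<kappa>' (Suc k) (cell_midpoint d \<eta> ?P x) = p \<kappa>' (Suc k) x" by (simp add: p_def cell_cond_cell_midpoint[OF x])
      moreover have "s (Suc k) (cell_midpoint d \<eta> ?P x) = s (Suc k) x" by (rule sp(2)[OF k k k x])
      ultimately have "integral\<^sup>L (p \<kappa>' (Suc k) x) f - integral\<^sup>L (s (Suc k) x) f \<le>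
          \<Lambda> * (D (Suc k) (cell_midpoint d \<eta> ?P x) - L * (1 / 2) ^ \<eta>)"
        using integral_diff_le_chaining[OF _ pp ss f \<Lambda>, of \<eta>] by (simp add: D_def distrib_right)
      then show ?thesis using 1 by (simp add: right_diff_distrib mult.assoc)
    qed
    show "(\<integral>x. g (cell_midpoint d \<eta> ?P x) \<partial>kernel_prod d E s k) = (\<integral>x. g (cell_midpoint d \<eta> ?P x) \<partial>\<nu>)" for g :: "_ \<Rightarrow> real"
    proof (rule kernel_prod_cell_law[OF dag_kernels_mono[OF ks] \<nu> finite_atLeastAtMost])
      show "fully_connected E ?P" by (rule fc[OF k])
    qed (use \<open>k < K\<close> P fc sp in auto)
  qed
  moreover have "(\<integral>x. D (Suc k) (cell_midpoint d \<eta> (pa E (Suc k)) x) \<partial>\<nu>) = (L + 1) * (1 / 2) ^ \<eta> +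
      (\<Sum>j=1..\<eta>. (1 / 2) ^ j * (\<Sum>c\<in>grid d \<eta> (pa E (Suc k)). ?G k j c))"
    if "k < K" for k
  proof -
    have k: "Suc k \<in> {1..K}" using that by auto
    note cs = cell_set_sets[OF finite_atLeastAtMost paT(1)[OF k] k]
    have "cell_prob d j {Suc k} (p \<kappa>' (Suc k) c) b * measure \<nu> (cell_set d {1..K} \<eta> (pa E (Suc k)) c) -
        measure \<nu> (cell_set_pair d {1..K} \<eta> (pa E (Suc k)) c j (Suc k) b) =
        (\<Sum>i<n. fluctuation d {1..K} \<eta> (pa E (Suc k)) (p \<kappa>' (Suc k)) j (Suc k) c b (\<omega> i)) / real n" for c j b
      unfolding \<nu>_def fluctuation_def
      using measure_empirical[OF n \<omega> cs(1)] measure_empirical[OF n \<omega> cs(2)]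
      by (simp add: sum_subtractf sum_distrib_left diff_divide_distrib)
    note fl = this
    have law: "measure \<nu> (cell_set_pair d {1..K} \<eta> (pa E (Suc k)) c j (Suc k) b) =
        measure \<nu> (cell_set d {1..K} \<eta> (pa E (Suc k)) c) * cell_prob d j {Suc k} (s (Suc k) c) b"
      if "c \<in> grid d \<eta> (pa E (Suc k))" for c j b
      unfolding cell_set_def cell_set_pair_def by (rule sp(3)[OF k k k that])
    show ?thesis
      unfolding D_def fl[symmetric]
      by (rule integral_discrepancy[OF \<nu> finite_atLeastAtMost paT(1)[OF k] k law])
  qed
  ultimately show "integral\<^sup>L \<mu> f - integral\<^sup>L (smoothing d K E \<eta> (empirical d K n \<omega>)) f \<le>
    (\<Sum>k<K. (1 + L) ^ (K - Suc k) * ((L + 1) * (1 / 2) ^ \<eta> +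
      (\<Sum>j=1..\<eta>. (1 / 2) ^ j * (\<Sum>c\<in>grid d \<eta> (pa E (Suc k)). ?G k j c))))"
    unfolding smoothing_def \<nu>_def[symmetric] s_def[symmetric] \<kappa>(2)[symmetric] by simp
qed

section \<open>Fluctuations of the cell frequencies\<close>

text \<open>Independence and centring remove the mixed terms, so the second moment of the sum is
  \<open>n\<close> times that of one summand; the first absolute moment is at most its square
  root.\<close>

lemma integral_abs_mean_le:
  fixes z :: "'a \<Rightarrow> real"
  assumes M: "prob_space M" and zm [measurable]: "z \<in> borel_measurable M"
    and zb: "\<And>x. x \<in> space M \<Longrightarrow> \<bar>z x\<bar> \<le> B"
    and z0: "integral\<^sup>L M z = 0" and z2: "(\<integral>x. (z x)\<^sup>2 \<partial>M) \<le> v" and n: "1 \<le> n"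
  shows "integrable (PiM {..<n} (\<lambda>_. M)) (\<lambda>\<omega>. \<bar>(\<Sum>i<n. z (\<omega> i)) / real n\<bar>)"
    and "(\<integral>\<omega>. \<bar>(\<Sum>i<n. z (\<omega> i)) / real n\<bar> \<partial>PiM {..<n} (\<lambda>_. M)) \<le> sqrt (v / real n)"
proof -
  interpret M: prob_space M by fact
  interpret P: product_prob_space "\<lambda>_. M" "{..<n}" by unfold_locales
  let ?P = "PiM {..<n} (\<lambda>_. M)"
  let ?Z = "\<lambda>i j \<omega>. z (\<omega> i) * z (\<omega> j)"
  let ?E = "\<lambda>i j. integral\<^sup>L ?P (?Z i j)"
  have iz: "integrable M z" "integrable M (\<lambda>x. z x * z x)"
  proof -
    show "integrable M z" using zb by (intro M.integrable_const_bound[of _ B]) auto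
    have "\<bar>z x * z x\<bar> \<le> B * B" if "x \<in> space M" for x
      unfolding abs_mult using zb[OF that] by (intro mult_mono) auto
    then show "integrable M (\<lambda>x. z x * z x)" by (intro M.integrable_const_bound[of _ "B * B"]) auto
  qed
  have zi [measurable]: "(\<lambda>\<omega>. z (\<omega> i)) \<in> borel_measurable ?P" if "i < n" for i
    using that by (intro measurable_compose[OF _ zm] measurable_component_singleton) simp
  define X where "X \<omega> = (\<Sum>i<n. z (\<omega> i))" for \<omega>
  have pair: "integrable ?P (?Z i j)"
    "?E i j = (if i = j then \<integral>x. (z x)\<^sup>2 \<partial>M else 0)" if ij: "i < n" "j < n" for i j
  proof -
    \<comment> \<open>Writes \<open>z (\<omega> i) * z (\<omega> j)\<close> as a product over all
      coordinates with factor 1 elsewhere, so that the product formula for integrals covers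
      \<open>i = j\<close> and \<open>i \<noteq> j\<close> together.\<close>
    define f where "f a x = (if a = i then z x else 1) * (if a = j then z x else 1)" for a x
    have fi: "integrable M (f a)" for a
      unfolding f_def using iz by (cases "a = i"; cases "a = j") auto
    have eq: "(\<Prod>a\<in>{..<n}. f a (\<omega> a)) = z (\<omega> i) * z (\<omega> j)" for \<omega>
      unfolding f_def prod.distrib using ij by simp
    show "integrable ?P (?Z i j)"
      using P.product_integrable_prod[of "{..<n}" f] fi by (simp add: eq)
    have "?E i j = (\<Prod>a\<in>{..<n}. integral\<^sup>L M (f a))"
      using P.product_integral_prod[of "{..<n}" f] fi by (simp add: eq)
    also have "\<dots> = (if i = j then \<integral>x. (z x)\<^sup>2 \<partial>M else 0)"
    proof (cases "i = j")
      case True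
      then have "integral\<^sup>L M (f a) = (if a = i then \<integral>x. (z x)\<^sup>2 \<partial>M else 1)" for a
        by (simp add: f_def[abs_def] power2_eq_square M.prob_space)
      then show ?thesis using ij True by simp
    next
      case False
      then have "integral\<^sup>L M (f i) = 0" using z0 by (simp add: f_def[abs_def])
      then show ?thesis using ij False by (auto intro!: prod_zero)
    qed
    finally show "?E i j = (if i = j then \<integral>x. (z x)\<^sup>2 \<partial>M else 0)" .
  qed
  have Xsq: "(X \<omega>)\<^sup>2 = (\<Sum>i<n. \<Sum>j<n. z (\<omega> i) * z (\<omega> j))" for \<omega>
    by (simp add: X_def power2_eq_square sum_product)
  have iX2: "integrable ?P (\<lambda>\<omega>. (X \<omega>)\<^sup>2)"
    unfolding Xsq using pair(1) by (intro Bochner_Integration.integrable_sum) auto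
  have "(\<integral>\<omega>. (X \<omega>)\<^sup>2 \<partial>?P) = (\<Sum>i<n. \<Sum>j<n. ?E i j)"
    unfolding Xsq using pair(1)
    by (subst Bochner_Integration.integral_sum, force intro!: Bochner_Integration.integrable_sum)
      (intro sum.cong refl Bochner_Integration.integral_sum, auto)
  also have "\<dots> = real n * (\<integral>x. (z x)\<^sup>2 \<partial>M)"
    using pair(2) by simp
  also have "\<dots> \<le> real n * v" using z2 by (rule mult_left_mono) simp
  finally have EX2: "(\<integral>\<omega>. (X \<omega>)\<^sup>2 \<partial>?P) \<le> real n * v" .
  have iX: "integrable ?P (\<lambda>\<omega>. \<bar>X \<omega>\<bar>)"
  proof (rule P.integrable_const_bound[of _ "real n * B"])
    have "\<bar>X \<omega>\<bar> \<le> real n * B" if "\<omega> \<in> space ?P" for \<omega>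
    proof -
      have "\<bar>X \<omega>\<bar> \<le> (\<Sum>i<n. \<bar>z (\<omega> i)\<bar>)" unfolding X_def by (rule sum_abs)
      also have "\<dots> \<le> (\<Sum>i<n. B)" using that by (intro sum_mono zb) (auto simp: space_PiM)
      finally show ?thesis by simp
    qed
    then show "AE \<omega> in ?P. norm \<bar>X \<omega>\<bar> \<le> real n * B" by simp
    show "(\<lambda>\<omega>. \<bar>X \<omega>\<bar>) \<in> borel_measurable ?P" unfolding X_def by measurable
  qed
  show "integrable ?P (\<lambda>\<omega>. \<bar>(\<Sum>i<n. z (\<omega> i)) / real n\<bar>)"
    using iX by (simp add: X_def abs_divide)
  define c where "c = (\<integral>\<omega>. \<bar>X \<omega>\<bar> \<partial>?P)"
  \<comment> \<open>Nonnegativity of the variance of \<open>\<bar>X \<omega>\<bar>\<close> gives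
    that the squared mean \<open>c\<close> is at most the second moment.\<close>
  have "0 \<le> (\<integral>\<omega>. (\<bar>X \<omega>\<bar> - c)\<^sup>2 \<partial>?P)" by (rule Bochner_Integration.integral_nonneg) simp
  also have "\<dots> = (\<integral>\<omega>. (X \<omega>)\<^sup>2 - 2 * c * \<bar>X \<omega>\<bar> + c\<^sup>2 \<partial>?P)"
    by (intro Bochner_Integration.integral_cong refl) (simp add: power2_diff algebra_simps)
  also have "\<dots> = (\<integral>\<omega>. (X \<omega>)\<^sup>2 \<partial>?P) - 2 * c * c + c\<^sup>2"
    using iX iX2 prob_space.prob_space[OF prob_space_PiM[OF M], of "{..<n}"] by (simp add: c_def)
  finally have "c\<^sup>2 \<le> real n * v" using EX2 by (simp add: power2_eq_square)
  then have "(c / real n)\<^sup>2 \<le> v / real n"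
    using n by (simp add: power_divide field_simps power2_eq_square)
  then have "c / real n \<le> sqrt (v / real n)" by (rule real_le_rsqrt)
  moreover have "(\<integral>\<omega>. \<bar>(\<Sum>i<n. z (\<omega> i)) / real n\<bar> \<partial>?P) = c / real n"
    by (simp add: c_def X_def abs_divide)
  ultimately show "(\<integral>\<omega>. \<bar>(\<Sum>i<n. z (\<omega> i)) / real n\<bar> \<partial>?P) \<le> sqrt (v / real n)" by (simp only:)
qed

lemma sum_sqrt_le:
  assumes "\<And>x. x \<in> A \<Longrightarrow> 0 \<le> a x"
  shows "(\<Sum>x\<in>A. sqrt (a x)) \<le> sqrt (real (card A) * (\<Sum>x\<in>A. a x))"
proof (rule real_le_rsqrt)
  have "(\<Sum>x\<in>A. 1 * sqrt (a x))\<^sup>2 \<le> (\<Sum>x\<in>A. 1\<^sup>2) * (\<Sum>x\<in>A. (sqrt (a x))\<^sup>2)"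
    by (rule Cauchy_Schwarz_ineq_sum)
  then show "(\<Sum>x\<in>A. sqrt (a x))\<^sup>2 \<le> real (card A) * (\<Sum>x\<in>A. a x)"
    using assms by simp
qed

text \<open>By \<open>law\<close> each summand is centred, with variance at most the mass of its
  pair of cells. These masses add up to 1, so Cauchy--Schwarz over all pairs leaves the square root
  of their number divided by \<open>n\<close>.\<close>

lemma integral_fluctuation_le:
  assumes \<mu>: "\<mu> \<in> cube_probs d T" and T: "finite T" "S \<subseteq> T" "k \<in> T"
    and law: "\<And>c b. c \<in> grid d \<eta> S \<Longrightarrow> measure \<mu> (cell_set_pair d T \<eta> S c j k b) =
      measure \<mu> (cell_set d T \<eta> S c) * cell_prob d j {k} (p c) b"
    and p: "\<And>c. c \<in> grid d \<eta> S \<Longrightarrow> prob_space (p c)" and n: "1 \<le> n"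
  shows "c \<in> grid d \<eta> S \<Longrightarrow> integrable (PiM {..<n} (\<lambda>_. \<mu>)) (\<lambda>\<omega>. \<bar>(\<Sum>i<n. fluctuation d T \<eta> S p j k c b (\<omega> i)) / real n\<bar>)"
    and "(\<Sum>c\<in>grid d \<eta> S. \<Sum>b\<in>grid d j {k}.
      (\<integral>\<omega>. \<bar>(\<Sum>i<n. fluctuation d T \<eta> S p j k c b (\<omega> i)) / real n\<bar> \<partial>PiM {..<n} (\<lambda>_. \<mu>)))
      \<le> sqrt (2 ^ (\<eta> * (\<Sum>l\<in>S. d l)) * 2 ^ (j * d k) / real n)"
proof -
  let ?P = "PiM {..<n} (\<lambda>_. \<mu>)" and ?X = "\<lambda>c b \<omega>. \<bar>(\<Sum>i<n. fluctuation d T \<eta> S p j k c b (\<omega> i)) / real n\<bar>"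
  interpret prob_space \<mu> using \<mu> by (rule prob_algebraD)
  have fS: "finite S" using T finite_subset by blast
  have cs: "cell_set d T \<eta> S c \<in> sets \<mu>" "cell_set_pair d T \<eta> S c j k b \<in> sets \<mu>" for c b
    using cell_set_sets[OF T] by (simp_all add: prob_algebraD[OF \<mu>])
  have fb: "integrable ?P (\<lambda>\<omega>. ?X c b \<omega>) \<and>
    (\<integral>\<omega>. ?X c b \<omega> \<partial>?P) \<le>
      sqrt (measure \<mu> (cell_set_pair d T \<eta> S c j k b) / real n)" if c: "c \<in> grid d \<eta> S" for c b
  proof -
    define q where "q = cell_prob d j {k} (p c) b"
    let ?C = "cell_set d T \<eta> S c" and ?B = "cell_set_pair d T \<eta> S c j k b"
    let ?z = "fluctuation d T \<eta> S p j k c b"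
    have z: "?z = (\<lambda>x. q * indicator ?C x - indicator ?B x)"
      by (simp add: fluctuation_def q_def fun_eq_iff)
    have sub: "?B \<subseteq> ?C" by (auto simp: cell_set_def cell_set_pair_def)
    have q: "0 \<le> q" "q \<le> 1"
      using prob_space.prob_le_1[OF p[OF c]] by (simp_all add: q_def cell_prob_def)
    have m: "?z \<in> borel_measurable \<mu>" unfolding z using cs by simp
    have b: "\<bar>?z x\<bar> \<le> 1" for x
      using q sub by (auto simp: z indicator_def)
    have "integral\<^sup>L \<mu> ?z = q * measure \<mu> ?C - measure \<mu> ?B"
      unfolding z using cs sets.sets_into_space[OF cs(1)] sets.sets_into_space[OF cs(2)]
      by (simp add: Int_absorb1 emeasure_eq_measure)
    then have 0: "integral\<^sup>L \<mu> ?z = 0" using law[OF c] by (simp add: q_def)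
    \<comment> \<open>The mixed term simplifies because the pair cell \<open>?B\<close> lies in the
      parent cell \<open>?C\<close>.\<close>
    have "(?z x)\<^sup>2 = q\<^sup>2 * indicator ?C x - 2 * q * indicator ?B x + indicator ?B x" for x
      using sub by (auto simp: z indicator_def power2_eq_square algebra_simps)
    then have "(\<integral>x. (?z x)\<^sup>2 \<partial>\<mu>) = q\<^sup>2 * measure \<mu> ?C - 2 * q * measure \<mu> ?B + measure \<mu> ?B"
      using cs sets.sets_into_space[OF cs(1)] sets.sets_into_space[OF cs(2)]
      by (simp add: Int_absorb1 emeasure_eq_measure)
    also have "\<dots> = measure \<mu> ?B - q\<^sup>2 * measure \<mu> ?C"
      using law[OF c, of b] by (simp add: q_def power2_eq_square)
    finally have "(\<integral>x. (?z x)\<^sup>2 \<partial>\<mu>) \<le> measure \<mu> ?B" by simp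
    from integral_abs_mean_le[OF prob_space_axioms m b 0 this n] show ?thesis by blast
  qed
  then show "integrable ?P (\<lambda>\<omega>. ?X c b \<omega>)"
    if "c \<in> grid d \<eta> S" for c b
    using that by blast
  have "(\<Sum>c\<in>grid d \<eta> S. \<Sum>b\<in>grid d j {k}.
      (\<integral>\<omega>. ?X c b \<omega> \<partial>?P))
      \<le> (\<Sum>c\<in>grid d \<eta> S. \<Sum>b\<in>grid d j {k}. sqrt (measure \<mu> (cell_set_pair d T \<eta> S c j k b) / real n))"
    using fb by (intro sum_mono) blast
  also have "\<dots> = (\<Sum>u\<in>grid d \<eta> S \<times> grid d j {k}. sqrt (measure \<mu> (cell_set_pair d T \<eta> S (fst u) j k (snd u)) / real n))"
    by (simp add: sum.cartesian_product case_prod_beta)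
  also have "\<dots> \<le> sqrt (real (card (grid d \<eta> S \<times> grid d j {k})) *
      (\<Sum>u\<in>grid d \<eta> S \<times> grid d j {k}. measure \<mu> (cell_set_pair d T \<eta> S (fst u) j k (snd u)) / real n))"
    by (rule sum_sqrt_le) simp
  also have "(\<Sum>u\<in>grid d \<eta> S \<times> grid d j {k}. measure \<mu> (cell_set_pair d T \<eta> S (fst u) j k (snd u)) / real n) = 1 / real n"
  proof -
    have "(\<Sum>c\<in>grid d \<eta> S. \<Sum>b\<in>grid d j {k}. measure \<mu> (cell_set_pair d T \<eta> S c j k b)) = 1"
      using integral_cell_midpoint_pair(1)[OF T(1) \<mu> T(2), of "{k}" "\<lambda>_ _. 1" \<eta> j] T(3) prob_space
      by (simp add: cell_set_pair_def)
    then show ?thesis by (simp add: sum.cartesian_product case_prod_beta flip: sum_divide_distrib)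
  qed
  also have "real (card (grid d \<eta> S \<times> grid d j {k})) * (1 / real n) = 2 ^ (\<eta> * (\<Sum>l\<in>S. d l)) * 2 ^ (j * d k) / real n"
    by (simp add: card_cartesian_product card_grid[OF fS] card_grid)
  finally show "(\<Sum>c\<in>grid d \<eta> S. \<Sum>b\<in>grid d j {k}.
      (\<integral>\<omega>. ?X c b \<omega> \<partial>?P))
      \<le> sqrt (2 ^ (\<eta> * (\<Sum>l\<in>S. d l)) * 2 ^ (j * d k) / real n)" .
qed

section \<open>Summation over the scales\<close>

text \<open>Squaring turns the claim into a comparison of powers of 2, with \<open>N\<close> bounded
  below by \<open>2 ^ (\<eta> * D)\<close>. The slack \<open>t\<close> counts the spare factors 2 at
  scale \<open>j\<close>.\<close>

lemma scale_term_le: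
  assumes N: "2 ^ (\<eta> * D) \<le> (N::real)" and e: "2 * \<eta> + t + \<eta> * dp + j * dk \<le> \<eta> * D + 2 * j"
  shows "(1 / 2) ^ j * sqrt (2 ^ (\<eta> * dp) * 2 ^ (j * dk) / N) \<le> (1 / 2) ^ \<eta> * (3 / 4) ^ t"
proof (rule power2_le_imp_le)
  have N0: "0 < N" by (rule less_le_trans[OF _ N]) simp
  have "(2::real) ^ (2 * \<eta> + t + \<eta> * dp + j * dk) \<le> 2 ^ (\<eta> * D + 2 * j)"
    using e by (rule power_increasing) simp
  also have "\<dots> \<le> N * 2 ^ (2 * j)" unfolding power_add using N by (rule mult_right_mono) simp
  finally have A: "2 ^ (2 * \<eta>) * 2 ^ t * (2 ^ (\<eta> * dp) * 2 ^ (j * dk)) \<le> N * 2 ^ (2 * j)"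
    by (simp add: power_add mult_ac)
  have "((1 / 2) ^ j * sqrt (2 ^ (\<eta> * dp) * 2 ^ (j * dk) / N))\<^sup>2 = 2 ^ (\<eta> * dp) * 2 ^ (j * dk) / (N * 2 ^ (2 * j))"
    using N0 by (simp add: power_mult_distrib power_divide power_mult mult.commute[of 2 j] flip: power_mult)
  also have "\<dots> \<le> 1 / (2 ^ (2 * \<eta>) * 2 ^ t)"
    using A N0 by (simp add: field_simps)
  also have "\<dots> = ((1 / 2) ^ \<eta>)\<^sup>2 * (1 / 2) ^ t"
    by (simp add: power_divide mult.commute[of 2 \<eta>] flip: power_mult)
  \<comment> \<open>3/4 is a rational upper bound for 1 / sqrt 2, as 9/16 \<ge> 1/2; with it the
    geometric sum stays below 4.\<close>
  also have "\<dots> \<le> ((1 / 2) ^ \<eta>)\<^sup>2 * ((3 / 4)\<^sup>2) ^ t"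
    by (intro mult_left_mono power_mono) (auto simp: power2_eq_square)
  also have "\<dots> = ((1 / 2) ^ \<eta> * (3 / 4) ^ t)\<^sup>2"
    by (simp add: power_mult_distrib mult.commute flip: power_mult)
  finally show "((1 / 2) ^ j * sqrt (2 ^ (\<eta> * dp) * 2 ^ (j * dk) / N))\<^sup>2 \<le> ((1 / 2) ^ \<eta> * (3 / 4) ^ t)\<^sup>2" .
qed simp

lemma geometric_three_quarters: "(\<Sum>j<N. (3 / 4 :: real) ^ j) \<le> 4"
proof -
  have "(\<Sum>j<N. (3 / 4 :: real) ^ j) = 4 - 4 * (3 / 4) ^ N"
    by (induction N) simp_all
  then show ?thesis by simp
qed

text \<open>The slack decides. For \<open>dk = 1\<close>, and for \<open>dk = 2\<close> with
  \<open>dk + dp < D\<close>, it can be taken as \<open>j\<close>; for \<open>dk \<ge> 3\<close> as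
  \<open>\<eta> - j\<close>. Either way the sum is geometric. In the critical case
  \<open>dk = 2\<close>, \<open>D = dk + dp\<close> the bound has no slack, and each of the \<eta>
  scales counts once.\<close>

lemma scale_sum_le:
  assumes N: "2 ^ (\<eta> * D) \<le> (N::real)" and dk: "1 \<le> dk" and D: "max 2 dk + dp \<le> D"
    and l: "1 \<le> l" "dk = 2 \<Longrightarrow> D = dk + dp \<Longrightarrow> real \<eta> \<le> l"
  shows "(\<Sum>j=1..\<eta>. (1 / 2) ^ j * sqrt (2 ^ (\<eta> * dp) * 2 ^ (j * dk) / N)) \<le> 4 * l * (1 / 2) ^ \<eta>"
proof -
  let ?S = "\<Sum>j=1..\<eta>. (1 / 2) ^ j * sqrt (2 ^ (\<eta> * dp) * 2 ^ (j * dk) / N)"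
  have g1: "(\<Sum>j=1..\<eta>. (3 / 4 :: real) ^ j) \<le> 4"
  proof -
    have "(\<Sum>j=1..\<eta>. (3 / 4 :: real) ^ j) \<le> (\<Sum>j<Suc \<eta>. (3 / 4) ^ j)"
      by (rule sum_mono2) auto
    then show ?thesis using geometric_three_quarters order_trans by blast
  qed
  have g2: "(\<Sum>j=1..\<eta>. (3 / 4 :: real) ^ (\<eta> - j)) \<le> 4"
  proof -
    have "(\<Sum>j=1..\<eta>. (3 / 4 :: real) ^ (\<eta> - j)) = (\<Sum>i<\<eta>. (3 / 4) ^ i)"
      by (rule sum.reindex_bij_witness[of _ "\<lambda>i. \<eta> - i" "\<lambda>j. \<eta> - j"]) auto
    then show ?thesis using geometric_three_quarters by simp
  qed
  have fin: "?S \<le> u * (1 / 2) ^ \<eta>"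
    if t: "\<And>j. 1 \<le> j \<Longrightarrow> j \<le> \<eta> \<Longrightarrow> 2 * \<eta> + t j + \<eta> * dp + j * dk \<le> \<eta> * D + 2 * j"
      and u: "(\<Sum>j=1..\<eta>. (3 / 4 :: real) ^ t j) \<le> u" for t u
  proof -
    have "?S \<le> (\<Sum>j=1..\<eta>. (1 / 2) ^ \<eta> * (3 / 4) ^ t j)"
      by (intro sum_mono scale_term_le[OF N] t) auto
    also have "\<dots> = (1 / 2) ^ \<eta> * (\<Sum>j=1..\<eta>. (3 / 4) ^ t j)" by (simp add: sum_distrib_left)
    also have "\<dots> \<le> (1 / 2) ^ \<eta> * u" using u by (rule mult_left_mono) simp
    finally show ?thesis by (simp add: mult.commute)
  qed
  have four: "4 * (1 / 2) ^ \<eta> \<le> 4 * l * (1 / 2 :: real) ^ \<eta>" using l(1) by simp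
  consider "dk = 1" | "dk = 2" "D = dk + dp" | "dk = 2" "3 + dp \<le> D" | "3 \<le> dk"
    using dk D by linarith
  then show ?thesis
  proof cases
    case 1
    then have "\<eta> * (2 + dp) \<le> \<eta> * D" using D by (intro mult_left_mono) auto
    then show ?thesis using 1 by (intro order_trans[OF fin[OF _ g1] four]) (simp add: algebra_simps)
  next
    case 2
    have "?S \<le> l * (1 / 2) ^ \<eta>"
      by (rule fin[of "\<lambda>_. 0"]) (use 2 l in \<open>simp_all add: algebra_simps\<close>)
    also have "\<dots> \<le> 4 * l * (1 / 2) ^ \<eta>" using l(1) by simp
    finally show ?thesis .
  next
    case 3
    then have "\<eta> * (3 + dp) \<le> \<eta> * D" by (intro mult_left_mono) auto
    then show ?thesis using 3 by (intro order_trans[OF fin[OF _ g1] four]) (simp add: algebra_simps)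
  next
    case 4
    then obtain e where e: "dk = 3 + e" using le_Suc_ex by blast
    have D': "\<eta> * (dk + dp) \<le> \<eta> * D" using D 4 by (intro mult_left_mono) auto
    have "2 * \<eta> + (\<eta> - j) + \<eta> * dp + j * dk \<le> \<eta> * D + 2 * j" if "j \<le> \<eta>" for j
    proof -
      have "j * e \<le> \<eta> * e" using that by (rule mult_right_mono) simp
      then show ?thesis using D' that unfolding e by (simp only: distrib_left distrib_right)
    qed
    then show ?thesis by (intro order_trans[OF fin[OF _ g2] four]) auto
  qed
qed

text \<open>Rounding \<eta> down keeps the number \<open>2 ^ (\<eta> * D)\<close> below
  \<open>n\<close> and loses at most a factor 2 in the mesh.\<close>

lemma resolution_bounds:
  assumes n: "1 \<le> n" and D: "2 \<le> D" and \<eta>: "\<eta> = nat \<lfloor>1 / real D * log 2 (real n)\<rfloor>"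
  shows "2 ^ (\<eta> * D) \<le> real n" "(1 / 2) ^ \<eta> \<le> 2 * real n powr (- 1 / real D)" "real \<eta> \<le> max 1 (ln (real n))"
proof -
  define y where "y = log 2 (real n) / real D"
  have y0: "0 \<le> y" using n D by (simp add: y_def)
  have "\<eta> = nat \<lfloor>y\<rfloor>" by (simp add: \<eta> y_def)
  then have "real \<eta> = of_int \<lfloor>y\<rfloor>" using y0 by simp
  then have ey: "real \<eta> \<le> y" "y \<le> real \<eta> + 1" by linarith+
  have "(2::real) ^ (\<eta> * D) = 2 powr (real \<eta> * real D)" by (simp add: powr_realpow[symmetric])
  also have "\<dots> \<le> 2 powr (log 2 (real n))"
    using ey(1) D by (intro powr_mono) (auto simp: y_def field_simps)
  also have "\<dots> = real n" using n by simp
  finally show "2 ^ (\<eta> * D) \<le> real n" .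
  have "(1 / 2 :: real) ^ \<eta> = 2 powr (- real \<eta>)"
    by (simp add: powr_minus powr_realpow power_divide field_simps)
  also have "\<dots> \<le> 2 powr (1 - y)" using ey(2) by (intro powr_mono) auto
  also have "\<dots> = 2 * 2 powr (log 2 (real n) * (- 1 / real D))"
    by (simp add: powr_diff y_def powr_minus_divide)
  also have "2 powr (log 2 (real n) * (- 1 / real D)) = (2 powr log 2 (real n)) powr (- 1 / real D)"
    by (rule powr_powr[symmetric])
  also have "2 powr log 2 (real n) = real n" using n by simp
  finally show "(1 / 2) ^ \<eta> \<le> 2 * real n powr (- 1 / real D)" .
  have ln0: "0 \<le> ln (real n)" using n by simp
  have "y = ln (real n) / (ln 2 * real D)" by (simp add: y_def log_def)
  also have "\<dots> \<le> ln (real n) / 1"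
  proof (rule divide_left_mono[OF _ ln0])
    \<comment> \<open>From \<open>D \<ge> 2\<close> the factor \<open>ln 2 * real D\<close> is at
      least 1, so no constant appears in front of the logarithm.\<close>
    have "(2 / 3) * 2 \<le> ln 2 * real D" using ln2_ge_two_thirds D by (intro mult_mono) auto
    then show "1 \<le> ln 2 * real D" by simp
    show "0 < (ln 2 * real D) * 1" using D by simp
  qed
  finally show "real \<eta> \<le> max 1 (ln (real n))" using ey(1) by simp
qed

section \<open>The convergence rate as the expectation of the bound for single samples\<close>

theorem theorem2p2:
  fixes K :: nat and E :: "(nat \<times> nat) set" and L :: real and D :: nat
  assumes "K \<ge> 1"
    and "sorted_dag K E"
    and "\<forall>k\<in>{1..K}. fully_connected E (pa E k)"
  shows "\<exists>C>0. \<forall>(d :: nat \<Rightarrow> nat) \<mu> (n :: nat) (\<eta> :: nat).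
    (\<forall>k\<in>{1..K}. d k \<ge> 1) \<longrightarrow>
    d_loc d K E = D \<longrightarrow>
    \<mu> \<in> markov_measures d K E \<longrightarrow>
    lipschitz_kernels d K E L \<mu> \<longrightarrow>
    n \<ge> 1 \<longrightarrow>
    \<eta> = nat \<lfloor>1 / real D * log 2 (real n)\<rfloor> \<longrightarrow>
    (\<integral>\<^sup>+\<omega>. wasserstein d {1..K} \<mu> (smoothing d K E \<eta> (empirical d K n \<omega>))
        \<partial>PiM {..<n} (\<lambda>_. \<mu>))
      \<le> ennreal (C * log_factor d K E n * real n powr (- 1 / real D))"
proof -
  \<comment> \<open>The Lipschitz constant is an arbitrary real, while telescoping multiplies by
    powers of 1 plus a nonnegative one.\<close>
  define L' where "L' = max 0 L"
  have L': "0 \<le> L'" "L \<le> L'" by (simp_all add: L'_def)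
  \<comment> \<open>There are \<open>K\<close> nodes, each error amplified by at most
    \<open>(1 + L') ^ K\<close>; \<open>L' + 5\<close> is \<open>L' + 1\<close> for bias and
    stopping plus 4 for the sum over scales; the factor 2 comes from rounding \<eta> down. No
    dimension occurs.\<close>
  define C where "C = real K * (1 + L') ^ K * (L' + 5) * 2"
  have "0 < C" using \<open>K \<ge> 1\<close> L' by (simp add: C_def)
  show ?thesis
  proof (intro exI[of _ C] conjI allI impI \<open>0 < C\<close>)
    fix d :: "nat \<Rightarrow> nat" and \<mu> and n \<eta> :: nat
    assume d1: "\<forall>k\<in>{1..K}. d k \<ge> 1" and D: "d_loc d K E = D" and \<mu>_markov: "\<mu> \<in> markov_measures d K E"
      and lk: "lipschitz_kernels d K E L \<mu>" and n: "n \<ge> 1" and \<eta>: "\<eta> = nat \<lfloor>1 / real D * log 2 (real n)\<rfloor>"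
    have \<mu>: "\<mu> \<in> cube_probs d {1..K}" using \<mu>_markov by (simp add: markov_measures_def)
    obtain \<kappa> where \<kappa>: "\<And>k. k \<in> {1..K} \<Longrightarrow> is_rcd d \<mu> (pa E k) k (\<kappa> k)" "\<mu> = kernel_prod d E \<kappa> K"
      using \<mu>_markov unfolding markov_measures_def by blast
    have pa_less: "pa E k \<subseteq> {1..<k}" for k
      using assms(2) by (auto simp: sorted_dag_def pa_def)
    \<comment> \<open>Guarding the Lipschitz bound by \<open>pa E k \<noteq> {}\<close> gives one
      predicate for all nodes, including node 1; for nodes without parents the version from the
      product formula satisfies it.\<close>
    let ?lip = "\<lambda>k \<kappa>. is_rcd d \<mu> (pa E k) k \<kappa> \<and>
        (\<forall>x\<in>space (cube d (pa E k)). \<forall>x'\<in>space (cube d (pa E k)). pa E k \<noteq> {} \<longrightarrow>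
          wasserstein d {k} (\<kappa> x) (\<kappa> x') \<le> ennreal (L * sup_dist d (pa E k) x x'))"
    have ex: "\<exists>\<kappa>. ?lip k \<kappa>" if k: "k \<in> {1..K}" for k
    proof (cases "pa E k = {}")
      case True
      then show ?thesis using \<kappa>(1)[OF k] by auto
    next
      case False
      moreover have "k \<noteq> 1" using pa_less[of k] False by auto
      ultimately show ?thesis using lk k unfolding lipschitz_kernels_def by (metis atLeastAtMost_iff le_antisym not_less_eq_eq numeral_2_eq_2 One_nat_def)
    qed
    define \<kappa>' where "\<kappa>' k = (SOME \<kappa>. ?lip k \<kappa>)" for k
    note \<kappa>'_props = someI_ex[OF ex, folded \<kappa>'_def]
    have \<kappa>': "is_rcd d \<mu> (pa E k) k (\<kappa>' k)" if "k \<in> {1..K}" for k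
      using \<kappa>'_props[OF that] by blast
    have lip: "\<bar>integral\<^sup>L (\<kappa>' k x) f - integral\<^sup>L (\<kappa>' k x') f\<bar> \<le> \<Lambda> * L' * sup_dist d (pa E k) x x'"
      if k: "k \<in> {1..K}" and \<Lambda>: "0 \<le> \<Lambda>" and f: "cube_lipschitz d {k} \<Lambda> f"
        and x: "x \<in> space (cube d (pa E k))" and x': "x' \<in> space (cube d (pa E k))" for k \<Lambda> f x x'
    proof (cases "pa E k = {}")
      case True
      then have "x = x'" using x x' by (simp add: space_cube coords_def)
      then show ?thesis using True \<Lambda> L' by (simp add: sup_dist_nonneg)
    next
      case False
      have fin: "finite (pa E k)" using pa_less finite_subset by blast
      have km: "\<kappa>' k \<in> cube d (pa E k) \<rightarrow>\<^sub>M prob_algebra (cube d {k})" using \<kappa>'[OF k] by (simp add: is_rcd_def)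
      have "wasserstein d {k} (\<kappa>' k x) (\<kappa>' k x') \<le> ennreal (L * sup_dist d (pa E k) x x')"
        using \<kappa>'_props[OF k] False x x' by blast
      also have "\<dots> \<le> ennreal (L' * sup_dist d (pa E k) x x')"
        by (intro ennreal_leI mult_right_mono L' sup_dist_nonneg fin)
      finally have "\<bar>integral\<^sup>L (\<kappa>' k x) f - integral\<^sup>L (\<kappa>' k x') f\<bar> \<le> \<Lambda> * (L' * sup_dist d (pa E k) x x')"
        by (intro integral_diff_le_wasserstein[OF measurable_space[OF km x] measurable_space[OF km x'] f _ \<Lambda>])
          (simp_all add: L' sup_dist_nonneg[OF fin])
      then show ?thesis by (simp only: mult.assoc)
    qed
    define p where "p k x = cell_cond d \<eta> \<mu> (pa E k) x \<bind> \<kappa>' k" for k x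
    let ?l = "log_factor d K E n"
    define X where "X k j c b \<omega> = \<bar>(\<Sum>i<n. fluctuation d {1..K} \<eta> (pa E k) (p k) j k c b (\<omega> i)) / real n\<bar>" for k j c b \<omega>
    let ?P = "PiM {..<n} (\<lambda>_. \<mu>)"
    let ?Y = "\<lambda>k j \<omega>. \<Sum>c\<in>grid d \<eta> (pa E (Suc k)). \<Sum>b\<in>grid d j {Suc k}. X (Suc k) j c b \<omega>"
    let ?I = "\<lambda>k j. \<Sum>c\<in>grid d \<eta> (pa E k). \<Sum>b\<in>grid d j {k}. integral\<^sup>L ?P (X k j c b)"
    interpret \<mu>: prob_space \<mu> using \<mu> by (rule prob_algebraD)
    interpret P: prob_space ?P by (rule prob_space_PiM) (rule \<mu>.prob_space_axioms)
    have D2: "2 \<le> D" and Dk: "\<And>k. k \<in> {1..K} \<Longrightarrow> max 2 (d k) + d_pa d E k \<le> D"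
    proof -
      have *: "max 2 (d k) + d_pa d E k \<le> D" if "k \<in> {1..K}" for k
        unfolding D[symmetric] d_loc_def using that by (intro Max_ge) auto
      then show "\<And>k. k \<in> {1..K} \<Longrightarrow> max 2 (d k) + d_pa d E k \<le> D" .
      show "2 \<le> D" using *[of 1] \<open>K \<ge> 1\<close> by auto
    qed
    note res = resolution_bounds[OF n D2 \<eta>]
    have l1: "1 \<le> ?l" by (simp add: log_factor_def)
    \<comment> \<open>An integrable majorant of the distance. As the nonnegative integral is
      monotone for arbitrary functions, measurability of the distance in the sample is not an
      issue.\<close>
    define H where "H \<omega> = (\<Sum>k<K. (1 + L') ^ (K - Suc k) * ((L' + 1) * (1 / 2) ^ \<eta> +
      (\<Sum>j=1..\<eta>. (1 / 2) ^ j * ?Y k j \<omega>)))" for \<omega>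
    have W: "wasserstein d {1..K} \<mu> (smoothing d K E \<eta> (empirical d K n \<omega>)) \<le> ennreal (H \<omega>)"
      if \<omega>: "\<omega> \<in> space ?P" for \<omega>
      unfolding H_def X_def p_def
    proof (rule wasserstein_smoothing_le[OF assms(2) _ \<mu> L'(1) \<kappa> \<kappa>' lip n])
      show "\<omega> i \<in> space (cube d {1..K})" if "i < n" for i
        using \<omega> that by (auto simp: space_PiM prob_algebraD(3)[OF \<mu>])
    qed (use assms(3) in auto)
    have fluct: "(c \<in> grid d \<eta> (pa E k) \<longrightarrow> integrable ?P (X k j c b)) \<and>
        ?I k j
        \<le> sqrt (2 ^ (\<eta> * d_pa d E k) * 2 ^ (j * d k) / real n)" if k: "k \<in> {1..K}" for k j c b
    proof -
      have S: "pa E k \<subseteq> {1..K}" using pa_less[of k] k by auto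
      have fin: "finite (pa E k)" using S finite_subset by blast
      have km: "\<kappa>' k \<in> cube d (pa E k) \<rightarrow>\<^sub>M prob_algebra (cube d {k})" using \<kappa>'[OF k] by (simp add: is_rcd_def)
      have pp: "prob_space (p k c)" if "c \<in> grid d \<eta> (pa E k)" for c
        unfolding p_def
        by (rule prob_algebraD(1)[OF bind_prob_algebra[OF cell_cond_prob[OF \<mu> S fin subsetD[OF grid_subset_space that]] km]])
      have law: "measure \<mu> (cell_set_pair d {1..K} \<eta> (pa E k) c j k b) =
          measure \<mu> (cell_set d {1..K} \<eta> (pa E k) c) * cell_prob d j {k} (p k c) b" if "c \<in> grid d \<eta> (pa E k)" for c b
        unfolding cell_set_def cell_set_pair_def p_def
        by (rule cell_cond_bind_cell_prob[OF \<mu> S fin k that \<kappa>'[OF k]])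
      note fl = integral_fluctuation_le[where p = "p k" and j = j, OF \<mu> finite_atLeastAtMost S k law pp n]
      show ?thesis
        using fl(1)[of c b] fl(2) unfolding X_def d_pa_def by auto
    qed
    have node: "(\<Sum>j=1..\<eta>. (1 / 2) ^ j * ?I k j)
        \<le> 4 * ?l * (1 / 2) ^ \<eta>" if k: "k \<in> {1..K}" for k
    proof -
      have "(\<Sum>j=1..\<eta>. (1 / 2) ^ j * ?I k j)
        \<le> (\<Sum>j=1..\<eta>. (1 / 2) ^ j * sqrt (2 ^ (\<eta> * d_pa d E k) * 2 ^ (j * d k) / real n))"
        using fluct[OF k] by (intro sum_mono mult_left_mono) auto
      also have "\<dots> \<le> 4 * ?l * (1 / 2) ^ \<eta>"
      proof (rule scale_sum_le[OF res(1) _ Dk[OF k] l1])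
        show "1 \<le> d k" using d1 k by blast
        show "real \<eta> \<le> ?l" if "d k = 2" "D = d k + d_pa d E k"
          using res(3) that k D by (auto simp: log_factor_def)
      qed
      finally show ?thesis .
    qed
    have intX: "integrable ?P (\<lambda>\<omega>. X (Suc k) j c b \<omega>)" if "k < K" "c \<in> grid d \<eta> (pa E (Suc k))" for k j c b
      using fluct[of "Suc k" c j b] that by auto
    have eY: "(\<integral>\<omega>. ?Y k j \<omega> \<partial>?P) =
        ?I (Suc k) j"
      and iY: "integrable ?P (\<lambda>\<omega>. ?Y k j \<omega>)"
      if k: "k < K" for k j
    proof -
      have i: "integrable ?P (\<lambda>\<omega>. \<Sum>b\<in>grid d j {Suc k}. X (Suc k) j c b \<omega>)" if "c \<in> grid d \<eta> (pa E (Suc k))" for c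
        by (intro Bochner_Integration.integrable_sum intX k that)
      show "integrable ?P (\<lambda>\<omega>. ?Y k j \<omega>)"
        by (intro Bochner_Integration.integrable_sum i)
      show "(\<integral>\<omega>. ?Y k j \<omega> \<partial>?P) =
        ?I (Suc k) j"
        by (subst Bochner_Integration.integral_sum[OF i], assumption)
          (intro sum.cong refl Bochner_Integration.integral_sum intX k)
    qed
    define Z where "Z k \<omega> = (L' + 1) * (1 / 2) ^ \<eta> + (\<Sum>j=1..\<eta>. (1 / 2) ^ j *
      ?Y k j \<omega>)" for k \<omega>
    have iS: "integrable ?P (\<lambda>\<omega>. \<Sum>j=1..\<eta>. (1 / 2) ^ j *
      ?Y k j \<omega>)" if "k < K" for k
      by (intro Bochner_Integration.integrable_sum integrable_mult_right iY that)
    have iZ: "integrable ?P (Z k)" if "k < K" for k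
      unfolding Z_def by (intro Bochner_Integration.integrable_add P.integrable_const iS that)
    have eZ: "integral\<^sup>L ?P (Z k) = (L' + 1) * (1 / 2) ^ \<eta> +
      (\<Sum>j=1..\<eta>. (1 / 2) ^ j * ?I (Suc k) j)"
      if k: "k < K" for k
    proof -
      have "integral\<^sup>L ?P (Z k) = (L' + 1) * (1 / 2) ^ \<eta> + (\<integral>\<omega>. (\<Sum>j=1..\<eta>. (1 / 2) ^ j *
          ?Y k j \<omega>) \<partial>?P)"
        unfolding Z_def using iS[OF k] by (subst Bochner_Integration.integral_add) (simp_all add: P.prob_space)
      also have "(\<integral>\<omega>. (\<Sum>j=1..\<eta>. (1 / 2) ^ j *
          ?Y k j \<omega>) \<partial>?P) =
        (\<Sum>j=1..\<eta>. (1 / 2) ^ j * ?I (Suc k) j)"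
        by (subst Bochner_Integration.integral_sum, intro integrable_mult_right iY k)
          (simp only: integral_mult_right_zero eY[OF k])
      finally show ?thesis .
    qed
    have HZ: "H = (\<lambda>\<omega>. \<Sum>k<K. (1 + L') ^ (K - Suc k) * Z k \<omega>)" by (simp add: H_def Z_def fun_eq_iff)
    have iH: "integrable ?P H"
      unfolding HZ by (intro Bochner_Integration.integrable_sum integrable_mult_right iZ) simp
    have EH: "integral\<^sup>L ?P H = (\<Sum>k<K. (1 + L') ^ (K - Suc k) * ((L' + 1) * (1 / 2) ^ \<eta> +
      (\<Sum>j=1..\<eta>. (1 / 2) ^ j * ?I (Suc k) j)))"
      unfolding HZ
      by (subst Bochner_Integration.integral_sum, intro integrable_mult_right iZ, simp)
        (auto intro!: sum.cong simp only: integral_mult_right_zero eZ lessThan_iff)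
    have "integral\<^sup>L ?P H \<le> (\<Sum>k<K. (1 + L') ^ K * ((L' + 5) * ?l * (1 / 2) ^ \<eta>))"
      unfolding EH
    proof (intro sum_mono mult_mono)
      fix k assume "k \<in> {..<K}"
      then have k: "Suc k \<in> {1..K}" by auto
      have "(L' + 1) * (1 / 2) ^ \<eta> \<le> (L' + 1) * ?l * (1 / 2) ^ \<eta>"
        using l1 L' by (intro mult_right_mono) auto
      with node[OF k] show "(L' + 1) * (1 / 2) ^ \<eta> + (\<Sum>j=1..\<eta>. (1 / 2) ^ j *
          ?I (Suc k) j)
          \<le> (L' + 5) * ?l * (1 / 2) ^ \<eta>"
        by (simp add: algebra_simps)
      show "(1 + L') ^ (K - Suc k) \<le> (1 + L') ^ K" using L' by (intro power_increasing) auto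
      show "0 \<le> (L' + 1) * (1 / 2) ^ \<eta> + (\<Sum>j=1..\<eta>. (1 / 2) ^ j *
          ?I (Suc k) j)"
        using L' by (intro add_nonneg_nonneg sum_nonneg mult_nonneg_nonneg) (auto simp: X_def)
    qed (use L' in auto)
    also have "\<dots> = real K * (1 + L') ^ K * (L' + 5) * ?l * (1 / 2) ^ \<eta>" by simp
    also have "\<dots> \<le> real K * (1 + L') ^ K * (L' + 5) * ?l * (2 * real n powr (- 1 / real D))"
      using res(2) L' l1 by (intro mult_left_mono) auto
    also have "\<dots> = C * ?l * real n powr (- 1 / real D)" by (simp add: C_def)
    finally have bound: "integral\<^sup>L ?P H \<le> C * ?l * real n powr (- 1 / real D)" .
    have "(\<integral>\<^sup>+\<omega>. wasserstein d {1..K} \<mu> (smoothing d K E \<eta> (empirical d K n \<omega>)) \<partial>?P) \<le> (\<integral>\<^sup>+\<omega>. ennreal (H \<omega>) \<partial>?P)"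
      by (rule nn_integral_mono) (rule W)
    also have "\<dots> = ennreal (integral\<^sup>L ?P H)"
    proof (rule nn_integral_eq_integral[OF iH])
      show "AE \<omega> in ?P. 0 \<le> H \<omega>"
        unfolding H_def X_def using L' by (intro AE_I2 sum_nonneg mult_nonneg_nonneg add_nonneg_nonneg) auto
    qed
    also have "\<dots> \<le> ennreal (C * ?l * real n powr (- 1 / real D))"
      by (rule ennreal_leI[OF bound])
    finally show "(\<integral>\<^sup>+\<omega>. wasserstein d {1..K} \<mu> (smoothing d K E \<eta> (empirical d K n \<omega>)) \<partial>PiM {..<n} (\<lambda>_. \<mu>))
      \<le> ennreal (C * ?l * real n powr (- 1 / real D))" .
  qed
qed

end
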